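(* Let $\mathcal C,\mathcal D$ be abelian categories, let $G:\mathcal C\to\mathcal D$ be right exact, and let $n\ge1$. Let $(\mathcal U,\mathcal X)$ and $(\mathcal V,\mathcal Y)$ be right $n$-cotorsion pairs in $\mathcal C$ and $\mathcal D$, respectively. Define $$\mathfrak P_G(\mathcal U,\mathcal V)=\left\{\begin{pmatrix}U\\ D\end{pmatrix}_{\alpha}\ \middle|\ U\in\mathcal U,\ \alpha:G(U)\to D\text{ is monic},\ \operatorname{Coker}\alpha\in\mathcal V\right\},$$ $$\mathfrak A_G(\mathcal X,\mathcal Y)=\left\{\begin{pmatrix}X\\ Y\end{pmatrix}_{\alpha}\ \middle|\ X\in\mathcal X,\ Y\in\mathcal Y\right\}.$$ Assume that $L_iG(\mathcal U)=0$ for $1\le i\le n+1$, that $\mathfrak A_G(\mathcal X,\mathcal Y)$ is coresolving, and that $\mathfrak P_G(\mathcal U,\mathcal V)^\vee_{n-1}$ is closed under extensions. Then $\bigl(\mathfrak P_G(\mathcal U,\mathcal V),\mathfrak A_G(\mathcal X,\mathcal Y)\bigr)$ is a right $n$-cotorsion pair in $(G\downarrow\mathcal D)$.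
   Context: Conventions: abelian categories under consideration have enough projective and enough injective objects; subcategories (classes of objects, viewed as full subcategories) are full, additive and closed under isomorphisms; functors are additive. $L_iG$ is the $i$-th left derived functor of $G$. The comma category $(G\downarrow\mathcal D)$ has objects $\begin{pmatrix}C\\ D\end{pmatrix}_\alpha$ with $C\in\mathcal C$, $D\in\mathcal D$ and $\alpha:G(C)\to D$ a morphism in $\mathcal D$; a morphism to $\begin{pmatrix}C'\\ D'\end{pmatrix}_{\alpha'}$ is a pair $(c:C\to C',\,d:D\to D')$ with $d\alpha=\alpha'G(c)$. Since $G$ is right exact, it is abelian. For a class $\mathcal M$ in an abelian category, $\mathcal M^\vee_m$ is the class of objects $N$ admitting an exact sequence $0\to N\to M^0\to\cdots\to M^m\to0$ with all $M^j\in\mathcal M$. A pair $(\mathcal P,\mathcal R)$ of classes in an abelian category $\mathcal E$ is a right $n$-cotorsion pair if: $\mathcal R$ is closed under direct summands; $\operatorname{Ext}^i_{\mathcal E}(P,R)=0$ for all $P\in\mathcal P$, $R\in\mathcal R$, $1\le i\le n$; every $E\in\mathcal E$ admits a short exact sequence $0\to E\to R_E\to P_E\to0$ with $R_E\in\mathcal R$, $P_E\in\mathcal P^\vee_{n-1}$. A full additive subcategory is coresolving if it contains all injective objects, is closed under extensions, and is closed under cokernels of monomorphisms. *)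

theory Defs
  imports "HOL-Algebra.Elementary_Groups"
begin

section \<open>Abelian categories\<close>

text \<open>
  A category is given by a set of objects and a set of arrows, each arrow carrying its domain and
  codomain; \<open>g \<cdot> f\<close> means first \<open>f\<close>, then \<open>g\<close>. The record also carries the addition of parallel
  arrows and the zero arrows \<open>Zer a b : a \<rightarrow> b\<close>. Only the values of these operations on composable,
  respectively parallel, arrows and on objects of the category matter.
\<close>

record ('o, 'm) cat =
  Obj :: "'o set"
  Arr :: "'m set"
  Dom :: "'m \<Rightarrow> 'o"
  Cod :: "'m \<Rightarrow> 'o"
  Idt :: "'o \<Rightarrow> 'm"
  Cmp :: "'m \<Rightarrow> 'm \<Rightarrow> 'm" (infixl \<open>\<cdot>\<index>\<close> 70)
  Pls :: "'m \<Rightarrow> 'm \<Rightarrow> 'm" (infixl \<open>\<boxplus>\<index>\<close> 65)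
  Zer :: "'o \<Rightarrow> 'o \<Rightarrow> 'm"

definition Hom :: "('o, 'm) cat \<Rightarrow> 'o \<Rightarrow> 'o \<Rightarrow> 'm set" where
  "Hom E a b = {f \<in> Arr E. Dom E f = a \<and> Cod E f = b}"

definition Hom_group :: "('o, 'm) cat \<Rightarrow> 'o \<Rightarrow> 'o \<Rightarrow> 'm monoid" where
  "Hom_group E a b = \<lparr>carrier = Hom E a b, mult = Pls E, one = Zer E a b\<rparr>"

definition monic :: "('o, 'm) cat \<Rightarrow> 'm \<Rightarrow> bool" where
  "monic E f \<longleftrightarrow> f \<in> Arr E \<and>
     (\<forall>a\<in>Obj E. \<forall>g\<in>Hom E a (Dom E f). \<forall>h\<in>Hom E a (Dom E f).
        f \<cdot>\<^bsub>E\<^esub> g = f \<cdot>\<^bsub>E\<^esub> h \<longrightarrow> g = h)"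

definition epic :: "('o, 'm) cat \<Rightarrow> 'm \<Rightarrow> bool" where
  "epic E f \<longleftrightarrow> f \<in> Arr E \<and>
     (\<forall>a\<in>Obj E. \<forall>g\<in>Hom E (Cod E f) a. \<forall>h\<in>Hom E (Cod E f) a.
        g \<cdot>\<^bsub>E\<^esub> f = h \<cdot>\<^bsub>E\<^esub> f \<longrightarrow> g = h)"

definition isomorphic_objects :: "('o, 'm) cat \<Rightarrow> 'o \<Rightarrow> 'o \<Rightarrow> bool" where
  "isomorphic_objects E a b \<longleftrightarrow>
     (\<exists>f\<in>Hom E a b. \<exists>g\<in>Hom E b a. g \<cdot>\<^bsub>E\<^esub> f = Idt E a \<and> f \<cdot>\<^bsub>E\<^esub> g = Idt E b)"

definition is_zero_object :: "('o, 'm) cat \<Rightarrow> 'o \<Rightarrow> bool" where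
  "is_zero_object E z \<longleftrightarrow> z \<in> Obj E \<and>
     (\<forall>a\<in>Obj E. (\<exists>!f. f \<in> Hom E z a) \<and> (\<exists>!f. f \<in> Hom E a z))"

definition is_biproduct ::
    "('o, 'm) cat \<Rightarrow> 'o \<Rightarrow> 'o \<Rightarrow> 'o \<Rightarrow> 'm \<Rightarrow> 'm \<Rightarrow> 'm \<Rightarrow> 'm \<Rightarrow> bool" where
  "is_biproduct E a b s i j p q \<longleftrightarrow>
     i \<in> Hom E a s \<and> j \<in> Hom E b s \<and> p \<in> Hom E s a \<and> q \<in> Hom E s b \<and>
     p \<cdot>\<^bsub>E\<^esub> i = Idt E a \<and> q \<cdot>\<^bsub>E\<^esub> j = Idt E b \<and>
     q \<cdot>\<^bsub>E\<^esub> i = Zer E a b \<and> p \<cdot>\<^bsub>E\<^esub> j = Zer E b a \<and>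
     (i \<cdot>\<^bsub>E\<^esub> p) \<boxplus>\<^bsub>E\<^esub> (j \<cdot>\<^bsub>E\<^esub> q) = Idt E s"

definition is_direct_sum :: "('o, 'm) cat \<Rightarrow> 'o \<Rightarrow> 'o \<Rightarrow> 'o \<Rightarrow> bool" where
  "is_direct_sum E a b s \<longleftrightarrow> (\<exists>i j p q. is_biproduct E a b s i j p q)"

definition is_kernel :: "('o, 'm) cat \<Rightarrow> 'm \<Rightarrow> 'm \<Rightarrow> bool" where
  "is_kernel E f k \<longleftrightarrow> f \<in> Arr E \<and> k \<in> Arr E \<and> Cod E k = Dom E f \<and>
     f \<cdot>\<^bsub>E\<^esub> k = Zer E (Dom E k) (Cod E f) \<and>
     (\<forall>a\<in>Obj E. \<forall>h\<in>Hom E a (Dom E f). f \<cdot>\<^bsub>E\<^esub> h = Zer E a (Cod E f) \<longrightarrow>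
        (\<exists>!u. u \<in> Hom E a (Dom E k) \<and> k \<cdot>\<^bsub>E\<^esub> u = h))"

definition is_cokernel :: "('o, 'm) cat \<Rightarrow> 'm \<Rightarrow> 'm \<Rightarrow> bool" where
  "is_cokernel E f c \<longleftrightarrow> f \<in> Arr E \<and> c \<in> Arr E \<and> Dom E c = Cod E f \<and>
     c \<cdot>\<^bsub>E\<^esub> f = Zer E (Dom E f) (Cod E c) \<and>
     (\<forall>a\<in>Obj E. \<forall>h\<in>Hom E (Cod E f) a. h \<cdot>\<^bsub>E\<^esub> f = Zer E (Dom E f) a \<longrightarrow>
        (\<exists>!u. u \<in> Hom E (Cod E c) a \<and> u \<cdot>\<^bsub>E\<^esub> c = h))"

locale category =
  fixes E :: "('o, 'm) cat" (structure)
  assumes Dom_Obj: "f \<in> Arr E \<Longrightarrow> Dom E f \<in> Obj E"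
    and Cod_Obj: "f \<in> Arr E \<Longrightarrow> Cod E f \<in> Obj E"
    and Idt_Hom: "a \<in> Obj E \<Longrightarrow> Idt E a \<in> Hom E a a"
    and Cmp_Hom: "\<lbrakk>f \<in> Hom E a b; g \<in> Hom E b c\<rbrakk> \<Longrightarrow> g \<cdot> f \<in> Hom E a c"
    and Cmp_Idt_right: "f \<in> Hom E a b \<Longrightarrow> f \<cdot> Idt E a = f"
    and Cmp_Idt_left: "f \<in> Hom E a b \<Longrightarrow> Idt E b \<cdot> f = f"
    and Cmp_assoc: "\<lbrakk>f \<in> Hom E a b; g \<in> Hom E b c; h \<in> Hom E c d\<rbrakk> \<Longrightarrow>
          h \<cdot> (g \<cdot> f) = (h \<cdot> g) \<cdot> f"

locale additive_category = category +
  assumes Hom_comm_group: "\<lbrakk>a \<in> Obj E; b \<in> Obj E\<rbrakk> \<Longrightarrow> comm_group (Hom_group E a b)"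
    and Cmp_Pls_left: "\<lbrakk>f \<in> Hom E a b; g \<in> Hom E b c; h \<in> Hom E b c\<rbrakk> \<Longrightarrow>
          (g \<boxplus> h) \<cdot> f = (g \<cdot> f) \<boxplus> (h \<cdot> f)"
    and Cmp_Pls_right: "\<lbrakk>f \<in> Hom E a b; g \<in> Hom E a b; h \<in> Hom E b c\<rbrakk> \<Longrightarrow>
          h \<cdot> (f \<boxplus> g) = (h \<cdot> f) \<boxplus> (h \<cdot> g)"
    and ex_zero_object: "\<exists>z. is_zero_object E z"
    and ex_direct_sum: "\<lbrakk>a \<in> Obj E; b \<in> Obj E\<rbrakk> \<Longrightarrow> \<exists>s\<in>Obj E. is_direct_sum E a b s"

locale abelian_category = additive_category +
  assumes ex_kernel: "f \<in> Arr E \<Longrightarrow> \<exists>k. is_kernel E f k"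
    and ex_cokernel: "f \<in> Arr E \<Longrightarrow> \<exists>c. is_cokernel E f c"
    and monic_normal: "monic E f \<Longrightarrow> \<exists>g. is_kernel E g f"
    and epic_normal: "epic E f \<Longrightarrow> \<exists>g. is_cokernel E g f"


section \<open>Exactness, projectives and injectives\<close>

text \<open>For \<open>f : a \<rightarrow> b\<close> and \<open>g : b \<rightarrow> c\<close>: the image of \<open>f\<close>, i.e. the kernel \<open>k\<close> of its cokernel,
  is a kernel of \<open>g\<close>.\<close>

definition exact_at :: "('o, 'm) cat \<Rightarrow> 'm \<Rightarrow> 'm \<Rightarrow> bool" where
  "exact_at E f g \<longleftrightarrow> f \<in> Arr E \<and> g \<in> Arr E \<and> Cod E f = Dom E g \<and>
     (\<exists>c k. is_cokernel E f c \<and> is_kernel E c k \<and> is_kernel E g k)"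

definition short_exact :: "('o, 'm) cat \<Rightarrow> 'o \<Rightarrow> 'm \<Rightarrow> 'o \<Rightarrow> 'm \<Rightarrow> 'o \<Rightarrow> bool" where
  "short_exact E a f b g c \<longleftrightarrow>
     f \<in> Hom E a b \<and> g \<in> Hom E b c \<and> monic E f \<and> exact_at E f g \<and> epic E g"

definition projective :: "('o, 'm) cat \<Rightarrow> 'o \<Rightarrow> bool" where
  "projective E p \<longleftrightarrow> p \<in> Obj E \<and>
     (\<forall>g f. epic E g \<and> f \<in> Hom E p (Cod E g) \<longrightarrow> (\<exists>h\<in>Hom E p (Dom E g). g \<cdot>\<^bsub>E\<^esub> h = f))"

definition injective :: "('o, 'm) cat \<Rightarrow> 'o \<Rightarrow> bool" where
  "injective E i \<longleftrightarrow> i \<in> Obj E \<and>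
     (\<forall>g f. monic E g \<and> f \<in> Hom E (Dom E g) i \<longrightarrow> (\<exists>h\<in>Hom E (Cod E g) i. h \<cdot>\<^bsub>E\<^esub> g = f))"

definition enough_projectives :: "('o, 'm) cat \<Rightarrow> bool" where
  "enough_projectives E \<longleftrightarrow>
     (\<forall>a\<in>Obj E. \<exists>p. projective E p \<and> (\<exists>f\<in>Hom E p a. epic E f))"

definition enough_injectives :: "('o, 'm) cat \<Rightarrow> bool" where
  "enough_injectives E \<longleftrightarrow>
     (\<forall>a\<in>Obj E. \<exists>i. injective E i \<and> (\<exists>f\<in>Hom E a i. monic E f))"


section \<open>Ext groups\<close>

text \<open>Here \<open>d n : P (n + 1) \<rightarrow> P n\<close>, and \<open>e : P 0 \<rightarrow> a\<close> is the augmentation.\<close>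

definition proj_resolution ::
    "('o, 'm) cat \<Rightarrow> 'o \<Rightarrow> (nat \<Rightarrow> 'o) \<Rightarrow> (nat \<Rightarrow> 'm) \<Rightarrow> 'm \<Rightarrow> bool" where
  "proj_resolution E a P d e \<longleftrightarrow>
     (\<forall>n. projective E (P n)) \<and>
     (\<forall>n. d n \<in> Hom E (P (Suc n)) (P n)) \<and> e \<in> Hom E (P 0) a \<and>
     epic E e \<and> exact_at E (d 0) e \<and> (\<forall>n. exact_at E (d (Suc n)) (d n))"

definition chosen_resolution ::
    "('o, 'm) cat \<Rightarrow> 'o \<Rightarrow> (nat \<Rightarrow> 'o) \<times> (nat \<Rightarrow> 'm) \<times> 'm" where
  "chosen_resolution E a = (SOME (P, d, e). proj_resolution E a P d e)"

definition Hom_cocycles ::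
    "('o, 'm) cat \<Rightarrow> (nat \<Rightarrow> 'o) \<Rightarrow> (nat \<Rightarrow> 'm) \<Rightarrow> nat \<Rightarrow> 'o \<Rightarrow> 'm set" where
  "Hom_cocycles E P d i b = {h \<in> Hom E (P i) b. h \<cdot>\<^bsub>E\<^esub> d i = Zer E (P (Suc i)) b}"

definition Hom_coboundaries ::
    "('o, 'm) cat \<Rightarrow> (nat \<Rightarrow> 'o) \<Rightarrow> (nat \<Rightarrow> 'm) \<Rightarrow> nat \<Rightarrow> 'o \<Rightarrow> 'm set" where
  "Hom_coboundaries E P d i b =
     (case i of 0 \<Rightarrow> {Zer E (P 0) b} | Suc j \<Rightarrow> (\<lambda>h. h \<cdot>\<^bsub>E\<^esub> d j) ` Hom E (P j) b)"

text \<open>The \<open>i\<close>-th cohomology group of the complex \<open>Hom (P, b)\<close> for the chosen projective resolution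
  of \<open>a\<close>. It exists as soon as there are enough projectives, and the choice affects the group only
  up to isomorphism.\<close>

definition Ext :: "('o, 'm) cat \<Rightarrow> nat \<Rightarrow> 'o \<Rightarrow> 'o \<Rightarrow> 'm set monoid" where
  "Ext E i a b =
     (case chosen_resolution E a of (P, d, e) \<Rightarrow>
        (Hom_group E (P i) b)\<lparr>carrier := Hom_cocycles E P d i b\<rparr> Mod Hom_coboundaries E P d i b)"


section \<open>Functors and left derived functors\<close>

record ('o1, 'm1, 'o2, 'm2) functor_data =
  FObj :: "'o1 \<Rightarrow> 'o2"
  FArr :: "'m1 \<Rightarrow> 'm2"

locale additive_functor =
  fixes C :: "('o1, 'm1) cat" and D :: "('o2, 'm2) cat"
    and G :: "('o1, 'm1, 'o2, 'm2) functor_data"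
  assumes FObj_Obj: "a \<in> Obj C \<Longrightarrow> FObj G a \<in> Obj D"
    and FArr_Hom: "f \<in> Hom C a b \<Longrightarrow> FArr G f \<in> Hom D (FObj G a) (FObj G b)"
    and FArr_Idt: "a \<in> Obj C \<Longrightarrow> FArr G (Idt C a) = Idt D (FObj G a)"
    and FArr_Cmp: "\<lbrakk>f \<in> Hom C a b; g \<in> Hom C b c\<rbrakk> \<Longrightarrow>
          FArr G (g \<cdot>\<^bsub>C\<^esub> f) = FArr G g \<cdot>\<^bsub>D\<^esub> FArr G f"
    and FArr_Pls: "\<lbrakk>f \<in> Hom C a b; g \<in> Hom C a b\<rbrakk> \<Longrightarrow>
          FArr G (f \<boxplus>\<^bsub>C\<^esub> g) = FArr G f \<boxplus>\<^bsub>D\<^esub> FArr G g"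

locale right_exact_functor = additive_functor +
  assumes right_exact: "short_exact C a f b g c \<Longrightarrow>
    exact_at D (FArr G f) (FArr G g) \<and> epic D (FArr G g)"

text \<open>\<open>h\<close> is a homology object of \<open>x \<rightarrow> y \<rightarrow> z\<close> (arrows \<open>f\<close>, \<open>g\<close>, with \<open>g \<cdot> f = 0\<close>): the cokernel
  of the arrow \<open>f'\<close> from \<open>x\<close> to the kernel of \<open>g\<close> induced by \<open>f\<close>.\<close>

definition is_homology :: "('o, 'm) cat \<Rightarrow> 'm \<Rightarrow> 'm \<Rightarrow> 'o \<Rightarrow> bool" where
  "is_homology E f g h \<longleftrightarrow>
     (\<exists>k f' q. is_kernel E g k \<and> f' \<in> Hom E (Dom E f) (Dom E k) \<and> k \<cdot>\<^bsub>E\<^esub> f' = f \<and>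
        is_cokernel E f' q \<and> Cod E q = h)"

text \<open>The object \<open>L\<^sub>i G (a)\<close>, i.e. the \<open>i\<close>-th homology object of the complex \<open>G (P)\<close>, which is
  continued by zero in negative degrees.\<close>

definition left_derived_obj ::
    "('o1, 'm1) cat \<Rightarrow> ('o2, 'm2) cat \<Rightarrow> ('o1, 'm1, 'o2, 'm2) functor_data \<Rightarrow> nat \<Rightarrow> 'o1 \<Rightarrow> 'o2"
  where
  "left_derived_obj C D G i a =
     (case chosen_resolution C a of (P, d, e) \<Rightarrow>
        SOME h. is_homology D (FArr G (d i))
          (case i of 0 \<Rightarrow> Zer D (FObj G (P 0)) (SOME z. is_zero_object D z)
                   | Suc j \<Rightarrow> FArr G (d j)) h)"


section \<open>Comma categories\<close>

text \<open>The triple \<open>(c, d, \<alpha>)\<close> stands for the object of \<open>(G \<down> D)\<close> with structure arrow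
  \<open>\<alpha> : G (c) \<rightarrow> d\<close>. An arrow is a pair of arrows tagged with its source and its target.\<close>

type_synonym ('o1, 'o2, 'm2) comma_obj = "'o1 \<times> 'o2 \<times> 'm2"

type_synonym ('o1, 'm1, 'o2, 'm2) comma_arr =
  "('o1, 'o2, 'm2) comma_obj \<times> ('m1 \<times> 'm2) \<times> ('o1, 'o2, 'm2) comma_obj"

definition comma_objs :: "('o1, 'm1) cat \<Rightarrow> ('o2, 'm2) cat \<Rightarrow>
    ('o1, 'm1, 'o2, 'm2) functor_data \<Rightarrow> ('o1, 'o2, 'm2) comma_obj set" where
  "comma_objs C D G = {(c, d, \<alpha>). c \<in> Obj C \<and> d \<in> Obj D \<and> \<alpha> \<in> Hom D (FObj G c) d}"

definition comma_arrs :: "('o1, 'm1) cat \<Rightarrow> ('o2, 'm2) cat \<Rightarrow>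
    ('o1, 'm1, 'o2, 'm2) functor_data \<Rightarrow> ('o1, 'm1, 'o2, 'm2) comma_arr set" where
  "comma_arrs C D G =
     {((c, d, \<alpha>), (f, g), (c', d', \<alpha>')).
        (c, d, \<alpha>) \<in> comma_objs C D G \<and> (c', d', \<alpha>') \<in> comma_objs C D G \<and>
        f \<in> Hom C c c' \<and> g \<in> Hom D d d' \<and> g \<cdot>\<^bsub>D\<^esub> \<alpha> = \<alpha>' \<cdot>\<^bsub>D\<^esub> FArr G f}"

definition comma :: "('o1, 'm1) cat \<Rightarrow> ('o2, 'm2) cat \<Rightarrow> ('o1, 'm1, 'o2, 'm2) functor_data \<Rightarrow>
    (('o1, 'o2, 'm2) comma_obj, ('o1, 'm1, 'o2, 'm2) comma_arr) cat" where
  "comma C D G =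
     \<lparr>Obj = comma_objs C D G,
      Arr = comma_arrs C D G,
      Dom = (\<lambda>(s, _, _). s),
      Cod = (\<lambda>(_, _, t). t),
      Idt = (\<lambda>(c, d, \<alpha>). ((c, d, \<alpha>), (Idt C c, Idt D d), (c, d, \<alpha>))),
      Cmp = (\<lambda>(_, (f', g'), t) (s, (f, g), _). (s, (f' \<cdot>\<^bsub>C\<^esub> f, g' \<cdot>\<^bsub>D\<^esub> g), t)),
      Pls = (\<lambda>(s, (f, g), t) (_, (f', g'), _). (s, (f \<boxplus>\<^bsub>C\<^esub> f', g \<boxplus>\<^bsub>D\<^esub> g'), t)),
      Zer = (\<lambda>(c, d, \<alpha>) (c', d', \<alpha>'). ((c, d, \<alpha>), (Zer C c c', Zer D d d'), (c', d', \<alpha>')))\<rparr>"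


section \<open>Classes of objects and cotorsion pairs\<close>

definition additive_subcategory :: "('o, 'm) cat \<Rightarrow> 'o set \<Rightarrow> bool" where
  "additive_subcategory E M \<longleftrightarrow> M \<subseteq> Obj E \<and>
     (\<forall>a\<in>M. \<forall>b\<in>Obj E. isomorphic_objects E a b \<longrightarrow> b \<in> M) \<and>
     (\<exists>z\<in>M. is_zero_object E z) \<and>
     (\<forall>a\<in>M. \<forall>b\<in>M. \<forall>s\<in>Obj E. is_direct_sum E a b s \<longrightarrow> s \<in> M)"

definition closed_under_summands :: "('o, 'm) cat \<Rightarrow> 'o set \<Rightarrow> bool" where
  "closed_under_summands E M \<longleftrightarrow>
     (\<forall>a\<in>Obj E. \<forall>b\<in>Obj E. \<forall>s\<in>M. is_direct_sum E a b s \<longrightarrow> a \<in> M)"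

definition closed_under_extensions :: "('o, 'm) cat \<Rightarrow> 'o set \<Rightarrow> bool" where
  "closed_under_extensions E M \<longleftrightarrow>
     (\<forall>a f b g c. short_exact E a f b g c \<and> a \<in> M \<and> c \<in> M \<longrightarrow> b \<in> M)"

definition closed_under_mono_cokernels :: "('o, 'm) cat \<Rightarrow> 'o set \<Rightarrow> bool" where
  "closed_under_mono_cokernels E M \<longleftrightarrow>
     (\<forall>a f b g c. short_exact E a f b g c \<and> a \<in> M \<and> b \<in> M \<longrightarrow> c \<in> M)"

definition coresolving :: "('o, 'm) cat \<Rightarrow> 'o set \<Rightarrow> bool" where
  "coresolving E M \<longleftrightarrow> additive_subcategory E M \<and> (\<forall>i. injective E i \<longrightarrow> i \<in> M) \<and>
     closed_under_extensions E M \<and> closed_under_mono_cokernels E M"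

text \<open>The class of objects \<open>N\<close> with an exact sequence \<open>0 \<rightarrow> N \<rightarrow> M\<^sup>0 \<rightarrow> \<dots> \<rightarrow> M\<^sup>m \<rightarrow> 0\<close>: here
  \<open>X 0\<close> and \<open>X (m + 3)\<close> are the two outer zeros, \<open>X 1 = N\<close> and \<open>X (j + 2) = M\<^sup>j\<close>.\<close>

definition finite_coresolved :: "('o, 'm) cat \<Rightarrow> nat \<Rightarrow> 'o set \<Rightarrow> 'o set" where
  "finite_coresolved E m M = {N.
     \<exists>(X :: nat \<Rightarrow> 'o) (f :: nat \<Rightarrow> 'm).
       is_zero_object E (X 0) \<and> X 1 = N \<and> (\<forall>j\<le>m. X (j + 2) \<in> M) \<and>
       is_zero_object E (X (m + 3)) \<and>
       (\<forall>j\<le>m + 2. f j \<in> Hom E (X j) (X (j + 1))) \<and>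
       (\<forall>j\<le>m + 1. exact_at E (f j) (f (j + 1)))}"

definition right_cotorsion_pair :: "('o, 'm) cat \<Rightarrow> nat \<Rightarrow> 'o set \<Rightarrow> 'o set \<Rightarrow> bool" where
  "right_cotorsion_pair E n P R \<longleftrightarrow>
     additive_subcategory E P \<and> additive_subcategory E R \<and>
     closed_under_summands E R \<and>
     (\<forall>p\<in>P. \<forall>r\<in>R. \<forall>i. 1 \<le> i \<and> i \<le> n \<longrightarrow> trivial_group (Ext E i p r)) \<and>
     (\<forall>a\<in>Obj E. \<exists>r\<in>R. \<exists>p\<in>finite_coresolved E (n - 1) P. \<exists>f g. short_exact E a f r g p)"

definition P_class :: "('o1, 'm1) cat \<Rightarrow> ('o2, 'm2) cat \<Rightarrow> ('o1, 'm1, 'o2, 'm2) functor_data \<Rightarrow>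
    'o1 set \<Rightarrow> 'o2 set \<Rightarrow> ('o1, 'o2, 'm2) comma_obj set" where
  "P_class C D G U V = {(u, d, \<alpha>). (u, d, \<alpha>) \<in> Obj (comma C D G) \<and>
     u \<in> U \<and> monic D \<alpha> \<and> (\<exists>q. is_cokernel D \<alpha> q \<and> Cod D q \<in> V)}"

definition A_class :: "('o1, 'm1) cat \<Rightarrow> ('o2, 'm2) cat \<Rightarrow> ('o1, 'm1, 'o2, 'm2) functor_data \<Rightarrow>
    'o1 set \<Rightarrow> 'o2 set \<Rightarrow> ('o1, 'o2, 'm2) comma_obj set" where
  "A_class C D G X Y = {(x, y, \<alpha>). (x, y, \<alpha>) \<in> Obj (comma C D G) \<and> x \<in> X \<and> y \<in> Y}"

end

theory Submission
  imports Defs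
begin

text \<open>
  An object \<open>(u, d, \<alpha>)\<close> of the first class is an extension of \<open>(0, Coker \<alpha>)\<close> by \<open>(u, G u, id)\<close>, so its
  \<open>Ext\<close> groups into \<open>(x, y, \<beta>)\<close> are governed by those of \<open>u\<close> into \<open>x\<close> and of \<open>Coker \<alpha>\<close> into \<open>y\<close>. Concretely,
  if \<open>\<alpha>\<close> is monic and \<open>Ext\<^sup>1(u, x) = 0 = Ext\<^sup>1(Coker \<alpha>, y)\<close>, then \<open>Ext\<^sup>1\<close> vanishes in the comma category. For
  a projective object \<open>(r, s, \<rho>)\<close>, both \<open>r\<close> and \<open>Coker \<rho>\<close> are projective and \<open>\<rho>\<close> is monic, so as long as
  \<open>L\<^sub>1 G\<close> vanishes on \<open>u\<close> a syzygy of \<open>(u, d, \<alpha>)\<close> again has a monic structure arrow and consists of a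
  syzygy of \<open>u\<close> and one of \<open>Coker \<alpha>\<close>. Dimension shifting gives the vanishing in higher degrees.

  To approximate \<open>(c, d, \<alpha>)\<close>, choose \<open>0 \<rightarrow> c \<rightarrow> x \<rightarrow> k \<rightarrow> 0\<close> in the first category and push \<open>G c \<rightarrow> G x\<close>, which
  is monic because the long exact sequence forces \<open>L\<^sub>1 G(k) = 0\<close>, out along \<open>\<alpha>\<close> to get
  \<open>(c, d) \<rightarrow> (x, d')\<close> with cokernel \<open>(k, G k, id)\<close>; then embed \<open>d'\<close> into some \<open>y\<close> with cokernel \<open>l\<close>. The
  cokernel of \<open>(c, d) \<rightarrow> (x, y)\<close> is an extension of \<open>(0, l)\<close> by \<open>(k, G k, id)\<close>, and both of these inherit finite
  coresolutions.
\<close>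


section \<open>Additive and abelian categories\<close>

text \<open>\<open>Ext\<close> and \<open>left_derived_obj\<close> are computed from a resolution
  picked by \<open>SOME\<close>, and the one picked for an object of the comma category need not
  restrict to those picked for its components. Both notions are therefore replaced by conditions on
  all short exact sequences ending in an object, iterated along syzygies. By Schanuel's argument the
  presentations do not matter, so any presentation in the comma category can be compared with its
  two component presentations.

  The categories are abstract, so diagram chases run over arrows
  \<open>y : t \<rightarrow> b\<close>, and every lifting replaces \<open>t\<close> by a cover.

  The obstacle in the comma category is that \<open>G\<close> is only right exact: the structure
  arrow of a kernel starts at \<open>G\<close> of a kernel, which need not be the kernel of the
  image arrow. Vanishing of \<open>L\<^sub>1 G\<close> keeps the structure arrows of syzygies monic
  and makes \<open>N \<mapsto> (N, G N, id)\<close> exact along coresolutions. Each step of a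
  coresolution, like each syzygy, consumes one degree: to get \<open>L\<^sub>1 G(N) = 0\<close> from
  a coresolution ending in position \<open>m\<close>, vanishing in degrees up to
  \<open>m + 1\<close> on its terms is used.\<close>

lemma Hom_iff [simp]: "f \<in> Hom E a b \<longleftrightarrow> f \<in> Arr E \<and> Dom E f = a \<and> Cod E f = b"
  by (simp add: Hom_def)

section \<open>Monomorphisms and epimorphisms in a category\<close>

context category
begin

text \<open>Since \<open>Hom_iff\<close> dissolves every membership in a Hom set, typing rules are
  phrased with \<open>Arr\<close>, \<open>Dom\<close> and \<open>Cod\<close>; type checking of
  composites then becomes rewriting.\<close>

lemma Cmp_types [simp]:
  assumes "f \<in> Arr E" "g \<in> Arr E" "Dom E g = Cod E f"
  shows "g \<cdot> f \<in> Arr E" "Dom E (g \<cdot> f) = Dom E f" "Cod E (g \<cdot> f) = Cod E g"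
  using Cmp_Hom[of f "Dom E f" "Cod E f" g "Cod E g"] assms by simp_all

lemma Cmp_assoc_right [simp]:
  assumes "f \<in> Arr E" "g \<in> Arr E" "h \<in> Arr E" "Dom E g = Cod E f" "Dom E h = Cod E g"
  shows "(h \<cdot> g) \<cdot> f = h \<cdot> (g \<cdot> f)"
  using Cmp_assoc[of f "Dom E f" "Cod E f" g "Cod E g" h "Cod E h"] assms by simp

lemma Idt_types [simp]:
  assumes "a \<in> Obj E"
  shows "Idt E a \<in> Arr E" "Dom E (Idt E a) = a" "Cod E (Idt E a) = a"
  using Idt_Hom[OF assms] by simp_all

lemma Cmp_Idt [simp]:
  assumes "f \<in> Arr E"
  shows "Dom E f = a \<Longrightarrow> f \<cdot> Idt E a = f" "Cod E f = b \<Longrightarrow> Idt E b \<cdot> f = f"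
  using Cmp_Idt_left[of f "Dom E f" "Cod E f"] Cmp_Idt_right[of f "Dom E f" "Cod E f"] assms
  by auto

lemma Hom_Obj: "f \<in> Hom E a b \<Longrightarrow> a \<in> Obj E" "f \<in> Hom E a b \<Longrightarrow> b \<in> Obj E"
  by (auto simp: Dom_Obj Cod_Obj)

text \<open>Composites are normalized to right-nested form, where \<open>g \<cdot> f\<close> is no
  longer a subterm of \<open>g \<cdot> (f \<cdot> x)\<close>. This rule applies a known value of
  \<open>g \<cdot> f\<close> to a generalized element \<open>x\<close>.\<close>

lemma Cmp_eq:
  assumes "g \<cdot> f = h" "x \<in> Hom E t a" "f \<in> Hom E a b" "g \<in> Hom E b c"
  shows "g \<cdot> (f \<cdot> x) = h \<cdot> x"
  using assms by (metis Cmp_assoc)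

lemma monic_cancel:
  assumes "monic E f" "f \<cdot> g = f \<cdot> h" "f \<in> Hom E a b" "g \<in> Hom E t a" "h \<in> Hom E t a"
  shows "g = h"
proof -
  have "t \<in> Obj E" using Hom_Obj[OF assms(4)] by blast
  then show ?thesis using assms unfolding monic_def by auto
qed

lemma epic_cancel:
  assumes "epic E f" "g \<cdot> f = h \<cdot> f" "f \<in> Hom E a b" "g \<in> Hom E b t" "h \<in> Hom E b t"
  shows "g = h"
proof -
  have "t \<in> Obj E" using Hom_Obj[OF assms(4)] by blast
  then show ?thesis using assms unfolding epic_def by auto
qed

lemma monic_Arr [simp]: "monic E f \<Longrightarrow> f \<in> Arr E"
  by (simp add: monic_def)

lemma epic_Arr [simp]: "epic E f \<Longrightarrow> f \<in> Arr E"
  by (simp add: epic_def)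

lemma monic_Cmp:
  assumes "monic E f" "monic E g" "f \<in> Hom E a b" "g \<in> Hom E b c"
  shows "monic E (g \<cdot> f)"
  unfolding monic_def
proof (intro conjI ballI impI)
  show "g \<cdot> f \<in> Arr E" using assms by simp
  fix t x y assume "x \<in> Hom E t (Dom E (g \<cdot> f))" "y \<in> Hom E t (Dom E (g \<cdot> f))"
    and eq: "g \<cdot> f \<cdot> x = g \<cdot> f \<cdot> y"
  then have xy: "x \<in> Hom E t a" "y \<in> Hom E t a" using assms by simp_all
  then have f: "f \<cdot> x \<in> Hom E t b" "f \<cdot> y \<in> Hom E t b" using assms by simp_all
  have "g \<cdot> (f \<cdot> x) = g \<cdot> (f \<cdot> y)" using xy eq assms by simp
  then have "f \<cdot> x = f \<cdot> y" using monic_cancel[OF assms(2) _ assms(4) f] by blast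
  then show "x = y" using monic_cancel[OF assms(1) _ assms(3) xy] by blast
qed

lemma epic_Cmp:
  assumes "epic E f" "epic E g" "f \<in> Hom E a b" "g \<in> Hom E b c"
  shows "epic E (g \<cdot> f)"
  unfolding epic_def
proof (intro conjI ballI impI)
  show "g \<cdot> f \<in> Arr E" using assms by simp
  fix t x y assume "x \<in> Hom E (Cod E (g \<cdot> f)) t" "y \<in> Hom E (Cod E (g \<cdot> f)) t"
    and eq: "x \<cdot> (g \<cdot> f) = y \<cdot> (g \<cdot> f)"
  then have xy: "x \<in> Hom E c t" "y \<in> Hom E c t" using assms by simp_all
  then have g: "x \<cdot> g \<in> Hom E b t" "y \<cdot> g \<in> Hom E b t" using assms by simp_all
  have "(x \<cdot> g) \<cdot> f = (y \<cdot> g) \<cdot> f" using xy eq assms by simp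
  then have "x \<cdot> g = y \<cdot> g" using epic_cancel[OF assms(1) _ assms(3) g] by blast
  then show "x = y" using epic_cancel[OF assms(2) _ assms(4) xy] by blast
qed

lemma monic_right_factor:
  assumes "monic E (g \<cdot> f)" "f \<in> Hom E a b" "g \<in> Hom E b c"
  shows "monic E f"
  unfolding monic_def
proof (intro conjI ballI impI)
  show "f \<in> Arr E" using assms by simp
  fix t x y assume "x \<in> Hom E t (Dom E f)" "y \<in> Hom E t (Dom E f)" and eq: "f \<cdot> x = f \<cdot> y"
  then have xy: "x \<in> Hom E t a" "y \<in> Hom E t a" using assms by simp_all
  have "g \<cdot> f \<cdot> x = g \<cdot> f \<cdot> y" using xy eq assms by simp
  then show "x = y" using monic_cancel[OF assms(1) _ _ xy, of c] assms by simp
qed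

lemma epic_left_factor:
  assumes "epic E (g \<cdot> f)" "f \<in> Hom E a b" "g \<in> Hom E b c"
  shows "epic E g"
  unfolding epic_def
proof (intro conjI ballI impI)
  show "g \<in> Arr E" using assms by simp
  fix t x y assume "x \<in> Hom E (Cod E g) t" "y \<in> Hom E (Cod E g) t" and eq: "x \<cdot> g = y \<cdot> g"
  then have xy: "x \<in> Hom E c t" "y \<in> Hom E c t" using assms by simp_all
  have "x \<cdot> (g \<cdot> f) = y \<cdot> (g \<cdot> f)" using Cmp_eq[OF eq assms(2,3)] xy assms by simp
  then show "x = y" using epic_cancel[OF assms(1) _ _ xy, of a] assms by simp
qed

lemma monic_Idt: "a \<in> Obj E \<Longrightarrow> monic E (Idt E a)"
  unfolding monic_def by (intro conjI ballI impI) simp_all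

lemma epic_Idt: "a \<in> Obj E \<Longrightarrow> epic E (Idt E a)"
  unfolding epic_def by (intro conjI ballI impI) simp_all

lemma monic_split:
  assumes "r \<cdot> f = Idt E a" "f \<in> Hom E a b" "r \<in> Hom E b a"
  shows "monic E f"
  using monic_right_factor[of r f a b a] monic_Idt[of a] assms Hom_Obj[OF assms(2)] by simp

lemma epic_split:
  assumes "f \<cdot> r = Idt E b" "f \<in> Hom E a b" "r \<in> Hom E b a"
  shows "epic E f"
  using epic_left_factor[of f r b a b] epic_Idt[of b] assms Hom_Obj[OF assms(2)] by simp

end

section \<open>Arithmetic of parallel arrows, kernels and biproducts\<close>

context additive_category
begin

lemma Zer_types [simp]:
  assumes "a \<in> Obj E" "b \<in> Obj E"
  shows "Zer E a b \<in> Arr E" "Dom E (Zer E a b) = a" "Cod E (Zer E a b) = b"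
proof -
  interpret comm_group "Hom_group E a b" using Hom_comm_group[OF assms] .
  have "Zer E a b \<in> Hom E a b" using one_closed by (simp add: Hom_group_def)
  then show "Zer E a b \<in> Arr E" "Dom E (Zer E a b) = a" "Cod E (Zer E a b) = b"
    by simp_all
qed

lemma Pls_types [simp]:
  assumes "f \<in> Arr E" "g \<in> Arr E" "Dom E g = Dom E f" "Cod E g = Cod E f"
  shows "f \<boxplus> g \<in> Arr E" "Dom E (f \<boxplus> g) = Dom E f" "Cod E (f \<boxplus> g) = Cod E f"
proof -
  interpret comm_group "Hom_group E (Dom E f) (Cod E f)"
    using Hom_comm_group assms by (simp add: Dom_Obj Cod_Obj)
  have "f \<boxplus> g \<in> Hom E (Dom E f) (Cod E f)" using m_closed[of f g] assms
    by (simp add: Hom_group_def)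
  then show "f \<boxplus> g \<in> Arr E" "Dom E (f \<boxplus> g) = Dom E f" "Cod E (f \<boxplus> g) = Cod E f"
    by simp_all
qed

lemma Pls_assoc [simp]:
  assumes "f \<in> Arr E" "g \<in> Arr E" "h \<in> Arr E" "Dom E g = Dom E f" "Cod E g = Cod E f"
    "Dom E h = Dom E f" "Cod E h = Cod E f"
  shows "(f \<boxplus> g) \<boxplus> h = f \<boxplus> (g \<boxplus> h)"
proof -
  interpret comm_group "Hom_group E (Dom E f) (Cod E f)"
    using Hom_comm_group assms by (simp add: Dom_Obj Cod_Obj)
  show ?thesis using m_assoc[of f g h] assms by (simp add: Hom_group_def)
qed

lemma Pls_commute:
  assumes "f \<in> Arr E" "g \<in> Arr E" "Dom E g = Dom E f" "Cod E g = Cod E f"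
  shows "f \<boxplus> g = g \<boxplus> f"
proof -
  interpret comm_group "Hom_group E (Dom E f) (Cod E f)"
    using Hom_comm_group assms by (simp add: Dom_Obj Cod_Obj)
  show ?thesis using m_comm[of f g] assms by (simp add: Hom_group_def)
qed

lemma Zer_Pls [simp]:
  assumes "f \<in> Arr E" "Dom E f = a" "Cod E f = b"
  shows "Zer E a b \<boxplus> f = f" "f \<boxplus> Zer E a b = f"
proof -
  interpret comm_group "Hom_group E a b"
    using Hom_comm_group assms by (auto simp add: Dom_Obj Cod_Obj)
  show "Zer E a b \<boxplus> f = f" "f \<boxplus> Zer E a b = f" using l_one[of f] r_one[of f] assms
    by (simp_all add: Hom_group_def)
qed

definition Neg :: "'b \<Rightarrow> 'b" where
  "Neg f = inv\<^bsub>Hom_group E (Dom E f) (Cod E f)\<^esub> f"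

lemma Neg_types [simp]:
  assumes "f \<in> Arr E"
  shows "Neg f \<in> Arr E" "Dom E (Neg f) = Dom E f" "Cod E (Neg f) = Cod E f"
proof -
  interpret comm_group "Hom_group E (Dom E f) (Cod E f)"
    using Hom_comm_group assms by (auto simp add: Dom_Obj Cod_Obj)
  have "Neg f \<in> Hom E (Dom E f) (Cod E f)"
    using inv_closed[of f] assms unfolding Neg_def by (simp add: Hom_group_def)
  then show "Neg f \<in> Arr E" "Dom E (Neg f) = Dom E f" "Cod E (Neg f) = Cod E f"
    by simp_all
qed

lemma Pls_Neg [simp]:
  assumes "f \<in> Arr E"
  shows "f \<boxplus> Neg f = Zer E (Dom E f) (Cod E f)" "Neg f \<boxplus> f = Zer E (Dom E f) (Cod E f)"
proof -
  interpret comm_group "Hom_group E (Dom E f) (Cod E f)"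
    using Hom_comm_group assms by (auto simp add: Dom_Obj Cod_Obj)
  show "f \<boxplus> Neg f = Zer E (Dom E f) (Cod E f)" "Neg f \<boxplus> f = Zer E (Dom E f) (Cod E f)"
    using l_inv[of f] r_inv[of f] assms unfolding Neg_def by (simp_all add: Hom_group_def)
qed

lemma Pls_cancel:
  assumes "f \<boxplus> g = f \<boxplus> h" "f \<in> Arr E" "g \<in> Arr E" "h \<in> Arr E" "Dom E g = Dom E f"
    "Cod E g = Cod E f" "Dom E h = Dom E f" "Cod E h = Cod E f"
  shows "g = h"
proof -
  have "Neg f \<boxplus> f \<boxplus> g = Neg f \<boxplus> f \<boxplus> h"
    using assms by (simp del: Pls_Neg)
  moreover have "Neg f \<boxplus> f \<boxplus> g = g" "Neg f \<boxplus> f \<boxplus> h = h"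
    using assms by (simp_all del: Pls_assoc)
  ultimately show ?thesis by simp
qed

lemma Cmp_Pls [simp]:
  assumes "f \<in> Arr E" "g \<in> Arr E" "h \<in> Arr E"
  shows "\<lbrakk>Dom E g = Dom E f; Cod E g = Cod E f; Dom E h = Cod E f\<rbrakk> \<Longrightarrow>
      h \<cdot> (f \<boxplus> g) = (h \<cdot> f) \<boxplus> (h \<cdot> g)"
    "\<lbrakk>Dom E g = Dom E f; Cod E g = Cod E f; Cod E h = Dom E f\<rbrakk> \<Longrightarrow>
      (f \<boxplus> g) \<cdot> h = (f \<cdot> h) \<boxplus> (g \<cdot> h)"
  using assms Cmp_Pls_right[of f "Dom E f" "Cod E f" g h "Cod E h"]
    Cmp_Pls_left[of h "Dom E h" "Dom E f" f "Cod E f" g]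
  by auto

text \<open>Only the unit of a group is idempotent. This is how operations that respect sums, such
  as composition and \<open>FArr G\<close>, are seen to respect zero arrows.\<close>

lemma idempotent_Zer:
  assumes "f \<boxplus> f = f" "f \<in> Arr E" "Dom E f = a" "Cod E f = b"
  shows "f = Zer E a b"
  using Pls_cancel[of f f "Zer E a b"] assms by (auto simp: Dom_Obj Cod_Obj)

lemma Cmp_Zer [simp]:
  assumes "g \<in> Arr E"
  shows "\<lbrakk>Dom E g = b; a \<in> Obj E\<rbrakk> \<Longrightarrow> g \<cdot> Zer E a b = Zer E a (Cod E g)"
    and "\<lbrakk>Cod E g = a; b \<in> Obj E\<rbrakk> \<Longrightarrow> Zer E a b \<cdot> g = Zer E (Dom E g) b"
proof -
  assume *: "Dom E g = b" "a \<in> Obj E"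
  have b: "b \<in> Obj E" using * assms by (auto simp: Dom_Obj)
  have "g \<cdot> (Zer E a b \<boxplus> Zer E a b) = g \<cdot> Zer E a b" using * assms b by (simp del: Cmp_Pls)
  then have "g \<cdot> Zer E a b \<boxplus> g \<cdot> Zer E a b = g \<cdot> Zer E a b" using * assms b by (simp del: Zer_Pls)
  then show "g \<cdot> Zer E a b = Zer E a (Cod E g)" by (rule idempotent_Zer) (use * assms b in simp_all)
next
  assume *: "Cod E g = a" "b \<in> Obj E"
  have b: "a \<in> Obj E" using * assms by (auto simp: Cod_Obj)
  have "(Zer E a b \<boxplus> Zer E a b) \<cdot> g = Zer E a b \<cdot> g" using * assms b by (simp del: Cmp_Pls)
  then have "Zer E a b \<cdot> g \<boxplus> Zer E a b \<cdot> g = Zer E a b \<cdot> g" using * assms b by (simp del: Zer_Pls)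
  then show "Zer E a b \<cdot> g = Zer E (Dom E g) b" by (rule idempotent_Zer) (use * assms b in simp_all)
qed

lemma Neg_unique:
  assumes "f \<boxplus> g = Zer E (Dom E f) (Cod E f)" "f \<in> Arr E" "g \<in> Arr E" "Dom E g = Dom E f"
    "Cod E g = Cod E f"
  shows "g = Neg f"
  by (rule Pls_cancel[of f]) (use assms in simp_all)

lemma Cmp_Neg [simp]:
  assumes "g \<in> Arr E" "f \<in> Arr E" "Dom E g = Cod E f"
  shows "g \<cdot> Neg f = Neg (g \<cdot> f)" "Neg g \<cdot> f = Neg (g \<cdot> f)"
proof -
  have "g \<cdot> (f \<boxplus> Neg f) = Zer E (Dom E f) (Cod E g)" using assms by (simp del: Cmp_Pls add: Dom_Obj)
  then show "g \<cdot> Neg f = Neg (g \<cdot> f)"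
    using assms by - (rule Neg_unique, simp_all del: Pls_Neg)
  have "(g \<boxplus> Neg g) \<cdot> f = Zer E (Dom E f) (Cod E g)" using assms by (simp del: Cmp_Pls add: Cod_Obj)
  then show "Neg g \<cdot> f = Neg (g \<cdot> f)"
    using assms by - (rule Neg_unique, simp_all del: Pls_Neg)
qed

lemma Neg_Neg [simp]: "f \<in> Arr E \<Longrightarrow> Neg (Neg f) = f"
  by (rule Neg_unique[symmetric]) simp_all

lemma Neg_Zer [simp]: "\<lbrakk>a \<in> Obj E; b \<in> Obj E\<rbrakk> \<Longrightarrow> Neg (Zer E a b) = Zer E a b"
  by (rule Neg_unique[symmetric]) simp_all

lemma eq_of_diff_Zer:
  assumes "f \<boxplus> Neg g = Zer E (Dom E f) (Cod E f)" "f \<in> Arr E" "g \<in> Arr E" "Dom E g = Dom E f"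
    "Cod E g = Cod E f"
  shows "f = g"
proof -
  have "Neg g = Neg f" by (rule Neg_unique) (use assms in simp_all)
  then have "Neg (Neg g) = Neg (Neg f)" by simp
  then show ?thesis using assms by simp
qed

lemma monic_Zer:
  assumes "monic E f" "f \<cdot> g = Zer E t b" "f \<in> Hom E a b" "g \<in> Hom E t a"
  shows "g = Zer E t a"
  by (rule monic_cancel[OF assms(1) _ assms(3,4)]) (use assms Hom_Obj[OF assms(4)] in simp_all)

lemma epic_Zer:
  assumes "epic E f" "g \<cdot> f = Zer E a t" "f \<in> Hom E a b" "g \<in> Hom E b t"
  shows "g = Zer E b t"
  by (rule epic_cancel[OF assms(1) _ assms(3,4)]) (use assms Hom_Obj[OF assms(4)] in simp_all)

text \<open>Passing to the difference of two arrows with equal composites reduces cancellation to a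
  trivial kernel.\<close>

lemma monicI:
  assumes "f \<in> Hom E a b" and "\<And>t g. \<lbrakk>g \<in> Hom E t a; f \<cdot> g = Zer E t b\<rbrakk> \<Longrightarrow> g = Zer E t a"
  shows "monic E f"
  unfolding monic_def
proof (intro conjI ballI impI)
  show "f \<in> Arr E" using assms by simp
  fix t x y assume x: "x \<in> Hom E t (Dom E f)" and y: "y \<in> Hom E t (Dom E f)"
    and eq: "f \<cdot> x = f \<cdot> y"
  have "x \<boxplus> Neg y = Zer E t a"
    by (rule assms(2)) (use x y eq assms(1) in simp_all)
  then show "x = y" using x y assms(1) by - (rule eq_of_diff_Zer, simp_all)
qed

lemma epicI:
  assumes "f \<in> Hom E a b" and "\<And>t g. \<lbrakk>g \<in> Hom E b t; g \<cdot> f = Zer E a t\<rbrakk> \<Longrightarrow> g = Zer E b t"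
  shows "epic E f"
  unfolding epic_def
proof (intro conjI ballI impI)
  show "f \<in> Arr E" using assms by simp
  fix t x y assume x: "x \<in> Hom E (Cod E f) t" and y: "y \<in> Hom E (Cod E f) t"
    and eq: "x \<cdot> f = y \<cdot> f"
  have "x \<boxplus> Neg y = Zer E b t"
    by (rule assms(2)) (use x y eq assms(1) in simp_all)
  then show "x = y" using x y assms(1) by - (rule eq_of_diff_Zer, simp_all)
qed

lemma is_kernelI:
  assumes "f \<in> Hom E b c" "k \<in> Hom E a b" "f \<cdot> k = Zer E a c" "monic E k"
    and "\<And>t h. \<lbrakk>h \<in> Hom E t b; f \<cdot> h = Zer E t c\<rbrakk> \<Longrightarrow> \<exists>u\<in>Hom E t a. k \<cdot> u = h"
  shows "is_kernel E f k"
  unfolding is_kernel_def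
proof (intro conjI ballI impI)
  fix t h assume "h \<in> Hom E t (Dom E f)" "f \<cdot> h = Zer E t (Cod E f)"
  then have h: "h \<in> Hom E t b" "f \<cdot> h = Zer E t c" using assms(1) by simp_all
  then obtain u where u: "u \<in> Hom E t a" "k \<cdot> u = h" using assms(5) by blast
  show "\<exists>!u. u \<in> Hom E t (Dom E k) \<and> k \<cdot> u = h"
  proof (rule ex1I[of _ u])
    show "u \<in> Hom E t (Dom E k) \<and> k \<cdot> u = h" using u assms(2) by simp
    fix v assume v: "v \<in> Hom E t (Dom E k) \<and> k \<cdot> v = h"
    then have "k \<cdot> v = k \<cdot> u" using u by simp
    then show "v = u" by (rule monic_cancel[OF assms(4) _ assms(2)]) (use u v assms(2) in simp_all)
  qed
qed (use assms in simp_all)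

lemma is_cokernelI:
  assumes "f \<in> Hom E a b" "c \<in> Hom E b d" "c \<cdot> f = Zer E a d" "epic E c"
    and "\<And>t h. \<lbrakk>h \<in> Hom E b t; h \<cdot> f = Zer E a t\<rbrakk> \<Longrightarrow> \<exists>u\<in>Hom E d t. u \<cdot> c = h"
  shows "is_cokernel E f c"
  unfolding is_cokernel_def
proof (intro conjI ballI impI)
  fix t h assume "h \<in> Hom E (Cod E f) t" "h \<cdot> f = Zer E (Dom E f) t"
  then have h: "h \<in> Hom E b t" "h \<cdot> f = Zer E a t" using assms(1) by simp_all
  then obtain u where u: "u \<in> Hom E d t" "u \<cdot> c = h" using assms(5) by blast
  show "\<exists>!u. u \<in> Hom E (Cod E c) t \<and> u \<cdot> c = h"
  proof (rule ex1I[of _ u])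
    show "u \<in> Hom E (Cod E c) t \<and> u \<cdot> c = h" using u assms(2) by simp
    fix v assume v: "v \<in> Hom E (Cod E c) t \<and> v \<cdot> c = h"
    then have "v \<cdot> c = u \<cdot> c" using u by simp
    then show "v = u" by (rule epic_cancel[OF assms(4) _ assms(2)]) (use u v assms(2) in simp_all)
  qed
qed (use assms in simp_all)

lemma is_kernelD:
  assumes "is_kernel E f k" "f \<in> Hom E b c"
  shows "k \<in> Hom E (Dom E k) b" "f \<cdot> k = Zer E (Dom E k) c"
  using assms by (auto simp: is_kernel_def)

lemma is_cokernelD:
  assumes "is_cokernel E f c" "f \<in> Hom E a b"
  shows "c \<in> Hom E b (Cod E c)" "c \<cdot> f = Zer E a (Cod E c)"
  using assms by (auto simp: is_cokernel_def)

lemma is_kernel_lift: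
  assumes "is_kernel E f k" "f \<in> Hom E b c" "k \<in> Hom E a b" "h \<in> Hom E t b" "f \<cdot> h = Zer E t c"
  shows "\<exists>u\<in>Hom E t a. k \<cdot> u = h"
proof -
  have "t \<in> Obj E" using Hom_Obj[OF assms(4)] by blast
  moreover have "h \<in> Hom E t (Dom E f)" "f \<cdot> h = Zer E t (Cod E f)" "Dom E k = a" using assms by simp_all
  ultimately show ?thesis using assms(1) unfolding is_kernel_def by blast
qed

lemma is_cokernel_lift:
  assumes "is_cokernel E f c" "f \<in> Hom E a b" "c \<in> Hom E b d" "h \<in> Hom E b t" "h \<cdot> f = Zer E a t"
  shows "\<exists>u\<in>Hom E d t. u \<cdot> c = h"
proof -
  have "t \<in> Obj E" using Hom_Obj[OF assms(4)] by blast
  moreover have "h \<in> Hom E (Cod E f) t" "h \<cdot> f = Zer E (Dom E f) t" "Cod E c = d" using assms by simp_all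
  ultimately show ?thesis using assms(1) unfolding is_cokernel_def by blast
qed

lemma is_kernel_monic: assumes "is_kernel E f k" shows "monic E k"
proof -
  have k: "f \<in> Arr E" "k \<in> Arr E" "Cod E k = Dom E f" "f \<cdot> k = Zer E (Dom E k) (Cod E f)"
    using assms by (auto simp: is_kernel_def)
  show ?thesis
  proof (rule monicI)
    show "k \<in> Hom E (Dom E k) (Cod E k)" using k by simp
    fix t g assume g: "g \<in> Hom E t (Dom E k)" "k \<cdot> g = Zer E t (Cod E k)"
    have t: "t \<in> Obj E" using Hom_Obj[OF g(1)] by blast
    have "\<exists>!u. u \<in> Hom E t (Dom E k) \<and> k \<cdot> u = Zer E t (Dom E f)"
      using assms t k unfolding is_kernel_def by (simp add: Dom_Obj)
    moreover have "Zer E t (Dom E k) \<in> Hom E t (Dom E k) \<and> k \<cdot> Zer E t (Dom E k) = Zer E t (Dom E f)"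
      using t k by (simp add: Dom_Obj)
    moreover have "g \<in> Hom E t (Dom E k) \<and> k \<cdot> g = Zer E t (Dom E f)" using g k by simp
    ultimately show "g = Zer E t (Dom E k)" by blast
  qed
qed

lemma is_cokernel_epic: assumes "is_cokernel E f c" shows "epic E c"
proof -
  have k: "f \<in> Arr E" "c \<in> Arr E" "Dom E c = Cod E f" "c \<cdot> f = Zer E (Dom E f) (Cod E c)"
    using assms by (auto simp: is_cokernel_def)
  show ?thesis
  proof (rule epicI)
    show "c \<in> Hom E (Dom E c) (Cod E c)" using k by simp
    fix t g assume g: "g \<in> Hom E (Cod E c) t" "g \<cdot> c = Zer E (Dom E c) t"
    have t: "t \<in> Obj E" using Hom_Obj[OF g(1)] by blast
    have "\<exists>!u. u \<in> Hom E (Cod E c) t \<and> u \<cdot> c = Zer E (Cod E f) t"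
      using assms t k unfolding is_cokernel_def by (simp add: Cod_Obj Dom_Obj)
    moreover have "Zer E (Cod E c) t \<in> Hom E (Cod E c) t \<and> Zer E (Cod E c) t \<cdot> c = Zer E (Cod E f) t"
      using t k by (simp add: Cod_Obj)
    moreover have "g \<in> Hom E (Cod E c) t \<and> g \<cdot> c = Zer E (Cod E f) t" using g k by simp
    ultimately show "g = Zer E (Cod E c) t" by blast
  qed
qed

text \<open>Whatever \<open>g\<close> kills lifts to \<open>k\<close>, and
  \<open>k = f \<cdot> w\<close> passes the lift on to \<open>f\<close>; so \<open>f\<close>
  inherits the universal property of \<open>k\<close>.\<close>

lemma is_kernel_transfer:
  assumes "is_kernel E g k" "g \<in> Hom E b c" "k \<in> Hom E z b" "monic E f" "f \<in> Hom E a b"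
    and "g \<cdot> f = Zer E a c" "w \<in> Hom E z a" "f \<cdot> w = k"
  shows "is_kernel E g f"
proof (rule is_kernelI[OF assms(2,5,6,4)])
  fix t h assume h: "h \<in> Hom E t b" "g \<cdot> h = Zer E t c"
  obtain u where u: "u \<in> Hom E t z" "k \<cdot> u = h"
    using is_kernel_lift[OF assms(1-3) h] by blast
  have "f \<cdot> (w \<cdot> u) = h" using Cmp_eq[OF assms(8) u(1) assms(7,5)] u(2) by simp
  then show "\<exists>u\<in>Hom E t a. f \<cdot> u = h"
    by (intro bexI[of _ "w \<cdot> u"]) (use u(1) assms(7) in simp_all)
qed

text \<open>The correction step of a chase: two elements with the same image differ by an element of
  the kernel.\<close>

lemma kernel_diff:
  assumes "is_kernel E g k" "g \<in> Hom E b c" "k \<in> Hom E z b" "x \<in> Hom E t b" "y \<in> Hom E t b"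
    and "g \<cdot> x = g \<cdot> y"
  shows "\<exists>u\<in>Hom E t z. x = y \<boxplus> k \<cdot> u"
proof -
  have d: "x \<boxplus> Neg y \<in> Hom E t b" "g \<cdot> (x \<boxplus> Neg y) = Zer E t c"
    using assms by simp_all
  obtain u where u: "u \<in> Hom E t z" "k \<cdot> u = x \<boxplus> Neg y"
    using is_kernel_lift[OF assms(1-3) d] by blast
  have "y \<boxplus> k \<cdot> u = x \<boxplus> Neg y \<boxplus> y"
    unfolding u(2) using assms(4,5) d(1) Pls_commute[of y "x \<boxplus> Neg y"] by (simp del: Pls_assoc)
  then have "x = y \<boxplus> k \<cdot> u" using assms(4,5) Hom_Obj[OF assms(4)] by simp
  then show ?thesis using u(1) by blast
qed

lemma biproductD:
  assumes "is_biproduct E a b s i j p q"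
  shows "i \<in> Hom E a s" "j \<in> Hom E b s" "p \<in> Hom E s a" "q \<in> Hom E s b"
    "p \<cdot> i = Idt E a" "q \<cdot> j = Idt E b" "q \<cdot> i = Zer E a b" "p \<cdot> j = Zer E b a"
    "i \<cdot> p \<boxplus> j \<cdot> q = Idt E s"
  using assms by (simp_all add: is_biproduct_def)

lemma biproduct_Obj:
  assumes "is_biproduct E a b s i j p q"
  shows "a \<in> Obj E" "b \<in> Obj E" "s \<in> Obj E"
  using biproductD(1,2)[OF assms] by (blast intro: Hom_Obj)+

lemma ex_biproduct:
  assumes "a \<in> Obj E" "b \<in> Obj E"
  obtains s i j p q where "is_biproduct E a b s i j p q"
  using ex_direct_sum[OF assms] unfolding is_direct_sum_def by blast

lemma is_biproduct_swap:
  assumes "is_biproduct E a b s i j p q"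
  shows "is_biproduct E b a s j i q p"
  using assms Pls_commute[of "i \<cdot> p" "j \<cdot> q"] by (simp add: is_biproduct_def)

lemma biproduct_decomp:
  assumes "is_biproduct E a b s i j p q" "x \<in> Hom E t s"
  shows "i \<cdot> (p \<cdot> x) \<boxplus> j \<cdot> (q \<cdot> x) = x"
proof -
  note b = biproductD[OF assms(1)]
  have "(i \<cdot> p \<boxplus> j \<cdot> q) \<cdot> x = i \<cdot> (p \<cdot> x) \<boxplus> j \<cdot> (q \<cdot> x)" using assms(2) b(1-4) by simp
  moreover have "(i \<cdot> p \<boxplus> j \<cdot> q) \<cdot> x = x" unfolding b(9) using assms(2) by simp
  ultimately show ?thesis by simp
qed

lemma biproduct_decomp':
  assumes "is_biproduct E a b s i j p q" "x \<in> Hom E s t"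
  shows "(x \<cdot> i) \<cdot> p \<boxplus> (x \<cdot> j) \<cdot> q = x"
proof -
  note b = biproductD[OF assms(1)]
  have "x \<cdot> (i \<cdot> p \<boxplus> j \<cdot> q) = (x \<cdot> i) \<cdot> p \<boxplus> (x \<cdot> j) \<cdot> q" using assms(2) b(1-4) by simp
  moreover have "x \<cdot> (i \<cdot> p \<boxplus> j \<cdot> q) = x" unfolding b(9) using assms(2) by simp
  ultimately show ?thesis by simp
qed

lemma biproduct_simps:
  assumes "is_biproduct E a b s i j p q"
  shows "x \<in> Hom E t a \<Longrightarrow> p \<cdot> (i \<cdot> x) = x" "x \<in> Hom E t b \<Longrightarrow> q \<cdot> (j \<cdot> x) = x"
    "x \<in> Hom E t a \<Longrightarrow> q \<cdot> (i \<cdot> x) = Zer E t b" "x \<in> Hom E t b \<Longrightarrow> p \<cdot> (j \<cdot> x) = Zer E t a"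
  using biproductD[OF assms] biproduct_Obj[OF assms]
  by (simp_all flip: Cmp_assoc_right)

text \<open>The equation survives every additive functor and can be checked componentwise, unlike
  the quantified definition.\<close>

lemma zero_object_iff:
  "is_zero_object E z \<longleftrightarrow> z \<in> Obj E \<and> Idt E z = Zer E z z"
proof
  assume z: "is_zero_object E z"
  then have "\<exists>!f. f \<in> Hom E z z" "z \<in> Obj E" by (auto simp: is_zero_object_def)
  then show "z \<in> Obj E \<and> Idt E z = Zer E z z" by (metis Hom_iff Idt_types Zer_types)
next
  assume z: "z \<in> Obj E \<and> Idt E z = Zer E z z"
  have "f = Zer E z a" if "f \<in> Hom E z a" for f a
  proof -
    have "f \<cdot> Idt E z = f" using that by simp
    then show ?thesis using that z by simp
  qed
  moreover have "f = Zer E a z" if "f \<in> Hom E a z" for f a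
  proof -
    have "Idt E z \<cdot> f = f" using that by simp
    then show ?thesis using that z by simp
  qed
  ultimately show "is_zero_object E z"
    unfolding is_zero_object_def using z by (metis Hom_iff Zer_types)
qed

lemma to_zero: "\<lbrakk>is_zero_object E z; f \<in> Hom E a z\<rbrakk> \<Longrightarrow> f = Zer E a z"
  unfolding is_zero_object_def by (metis Dom_Obj Hom_iff Zer_types)

lemma from_zero: "\<lbrakk>is_zero_object E z; f \<in> Hom E z a\<rbrakk> \<Longrightarrow> f = Zer E z a"
  unfolding is_zero_object_def by (metis Cod_Obj Hom_iff Zer_types)

end

section \<open>Abelian categories: images, pullbacks and exactness through generalized
  elements\<close>

context abelian_category
begin

lemma ex_kernel_Hom:
  assumes "f \<in> Hom E b c"
  shows "\<exists>a k. k \<in> Hom E a b \<and> is_kernel E f k \<and> f \<cdot> k = Zer E a c \<and> monic E k"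
proof -
  obtain k where k: "is_kernel E f k" using ex_kernel assms by auto
  show ?thesis using is_kernelD[OF k assms] is_kernel_monic[OF k] k by blast
qed

lemma ex_cokernel_Hom:
  assumes "f \<in> Hom E a b"
  shows "\<exists>d c. c \<in> Hom E b d \<and> is_cokernel E f c \<and> c \<cdot> f = Zer E a d \<and> epic E c"
proof -
  obtain k where k: "is_cokernel E f k" using ex_cokernel assms by auto
  show ?thesis using is_cokernelD[OF k assms] is_cokernel_epic[OF k] k by blast
qed

lemma is_kernel_types:
  assumes "is_kernel E f k" "k \<in> Hom E a b"
  shows "\<exists>c. f \<in> Hom E b c \<and> f \<cdot> k = Zer E a c"
  using assms by (auto simp: is_kernel_def)

lemma is_cokernel_types:
  assumes "is_cokernel E f c" "c \<in> Hom E b d"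
  shows "\<exists>a. f \<in> Hom E a b \<and> c \<cdot> f = Zer E a d"
  using assms by (auto simp: is_cokernel_def)

text \<open>Being monic, \<open>f\<close> is the kernel of some \<open>g\<close>, and
  \<open>g\<close> factors through the cokernel \<open>c\<close>. Hence everything killed by
  \<open>c\<close> is killed by \<open>g\<close> and lifts to \<open>f\<close>.\<close>

lemma is_kernel_of_cokernel:
  assumes "monic E f" "is_cokernel E f c" "f \<in> Hom E a b" "c \<in> Hom E b d"
  shows "is_kernel E c f"
proof (rule is_kernelI[OF assms(4,3)])
  obtain g where g: "is_kernel E g f" using monic_normal[OF assms(1)] by blast
  obtain x where x: "g \<in> Hom E b x" "g \<cdot> f = Zer E a x" using is_kernel_types[OF g assms(3)] by blast
  obtain v where v: "v \<in> Hom E d x" "v \<cdot> c = g" using is_cokernel_lift[OF assms(2-4) x] by blast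
  show "c \<cdot> f = Zer E a d" using is_cokernelD[OF assms(2,3)] assms(4) by simp
  fix t h assume h: "h \<in> Hom E t b" "c \<cdot> h = Zer E t d"
  have "g \<cdot> h = v \<cdot> (c \<cdot> h)" using Cmp_assoc[OF h(1) assms(4) v(1)] v(2) by simp
  then have "g \<cdot> h = Zer E t x" using h v(1) Hom_Obj[OF h(1)] by simp
  then show "\<exists>u\<in>Hom E t a. f \<cdot> u = h" using is_kernel_lift[OF g x(1) assms(3) h(1)] by blast
qed (use assms in simp_all)

lemma is_cokernel_of_kernel:
  assumes "epic E f" "is_kernel E f k" "f \<in> Hom E b c" "k \<in> Hom E a b"
  shows "is_cokernel E k f"
proof (rule is_cokernelI[OF assms(4,3)])
  obtain g where g: "is_cokernel E g f" using epic_normal[OF assms(1)] by blast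
  obtain x where x: "g \<in> Hom E x b" "f \<cdot> g = Zer E x c" using is_cokernel_types[OF g assms(3)] by blast
  obtain v where v: "v \<in> Hom E x a" "k \<cdot> v = g" using is_kernel_lift[OF assms(2-4) x] by blast
  show "f \<cdot> k = Zer E a c" using is_kernelD[OF assms(2,3)] assms(4) by simp
  fix t h assume h: "h \<in> Hom E b t" "h \<cdot> k = Zer E a t"
  have "h \<cdot> g = Zer E a t \<cdot> v" using Cmp_eq[OF h(2) v(1) assms(4) h(1)] v(2) by simp
  then have "h \<cdot> g = Zer E x t" using v(1) Hom_Obj[OF h(1)] by simp
  then show "\<exists>u\<in>Hom E c t. u \<cdot> f = h" using is_cokernel_lift[OF g x(1) assms(3) h(1)] by blast
qed (use assms in simp_all)

text \<open>For epicness of \<open>e\<close>, let \<open>g \<cdot> e\<close> vanish and let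
  \<open>k\<close> be the kernel of \<open>g\<close>. The monic \<open>m \<cdot> k\<close> is the
  kernel of some \<open>h\<close>, and \<open>h\<close> kills \<open>f\<close>, so \<open>h\<close>
  factors through \<open>c\<close> and kills \<open>m\<close>. Thus \<open>m\<close> factors through
  \<open>m \<cdot> k\<close>, which makes \<open>k\<close> a split epi and forces \<open>g\<close>
  to be zero.\<close>

lemma image_factor:
  assumes "is_cokernel E f c" "is_kernel E c m" "f \<in> Hom E a b" "m \<in> Hom E i b"
  shows "\<exists>e\<in>Hom E a i. epic E e \<and> m \<cdot> e = f"
proof -
  obtain d where c: "c \<in> Hom E b d" "c \<cdot> f = Zer E a d" using is_cokernelD[OF assms(1,3)] by blast
  obtain e where e: "e \<in> Hom E a i" "m \<cdot> e = f"
    using is_kernel_lift[OF assms(2) c(1) assms(4,3) c(2)] by blast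
  have "epic E e"
  proof (rule epicI[OF e(1)])
    fix t g assume g: "g \<in> Hom E i t" "g \<cdot> e = Zer E a t"
    obtain j k where k: "k \<in> Hom E j i" "is_kernel E g k" "g \<cdot> k = Zer E j t" "monic E k"
      using ex_kernel_Hom[OF g(1)] by blast
    have mk: "m \<cdot> k \<in> Hom E j b" using k(1) assms(4) by simp
    have "monic E (m \<cdot> k)"
      using monic_Cmp[OF k(4) is_kernel_monic[OF assms(2)] k(1) assms(4)] .
    then obtain h where h: "is_kernel E h (m \<cdot> k)" using monic_normal by blast
    obtain x where x: "h \<in> Hom E b x" "h \<cdot> (m \<cdot> k) = Zer E j x" using is_kernel_types[OF h mk] by blast
    obtain e' where e': "e' \<in> Hom E a j" "k \<cdot> e' = e"
      using is_kernel_lift[OF k(2) g(1) k(1) e(1) g(2)] by blast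
    have "h \<cdot> (m \<cdot> (k \<cdot> e')) = Zer E j x \<cdot> e'"
      using Cmp_eq[OF x(2) e'(1) mk x(1)] e'(1) k(1) assms(4) x(1) by simp
    then have hf: "h \<cdot> f = Zer E a x" using e'(2) e(2) e'(1) Hom_Obj[OF x(1)] by simp
    obtain h' where h': "h' \<in> Hom E d x" "h' \<cdot> c = h"
      using is_cokernel_lift[OF assms(1,3) c(1) x(1) hf] by blast
    have cm: "c \<cdot> m = Zer E i d" using is_kernelD[OF assms(2) c(1)] assms(4) by simp
    have "h \<cdot> m = h' \<cdot> (c \<cdot> m)" using Cmp_assoc[OF assms(4) c(1) h'(1)] h'(2) by simp
    then have "h \<cdot> m = Zer E i x" using cm h'(1) Hom_Obj[OF assms(4)] by simp
    then obtain u where u: "u \<in> Hom E i j" "(m \<cdot> k) \<cdot> u = m"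
      using is_kernel_lift[OF h x(1) mk assms(4)] by blast
    have o: "i \<in> Obj E" "t \<in> Obj E" using Hom_Obj[OF g(1)] .
    have "m \<cdot> (k \<cdot> u) = m \<cdot> Idt E i" using Cmp_assoc[OF u(1) k(1) assms(4)] u(2) assms(4) by simp
    then have ku: "k \<cdot> u = Idt E i"
      by (rule monic_cancel[OF is_kernel_monic[OF assms(2)] _ assms(4)])
        (use u(1) k(1) o in simp_all)
    have "g \<cdot> (k \<cdot> u) = Zer E j t \<cdot> u" using Cmp_eq[OF k(3) u(1) k(1) g(1)] .
    then show "g = Zer E i t" unfolding ku using u(1) g(1) o by simp
  qed
  with e show ?thesis by blast
qed

lemma factor:
  assumes "f \<in> Hom E a b"
  shows "\<exists>i m e. epic E e \<and> monic E m \<and> e \<in> Hom E a i \<and> m \<in> Hom E i b \<and> m \<cdot> e = f"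
proof -
  obtain d c where c: "c \<in> Hom E b d" "is_cokernel E f c" using ex_cokernel_Hom[OF assms] by blast
  obtain i k where k: "k \<in> Hom E i b" "is_kernel E c k" "monic E k" using ex_kernel_Hom[OF c(1)] by blast
  then show ?thesis using image_factor[OF c(2) k(2) assms k(1)] by blast
qed

lemma monic_epic_iso:
  assumes "monic E f" "epic E f" "f \<in> Hom E a b"
  shows "\<exists>g\<in>Hom E b a. g \<cdot> f = Idt E a \<and> f \<cdot> g = Idt E b"
proof -
  obtain h where h: "is_kernel E h f" using monic_normal[OF assms(1)] by blast
  obtain x where x: "h \<in> Hom E b x" "h \<cdot> f = Zer E a x" using is_kernel_types[OF h assms(3)] by blast
  have o: "a \<in> Obj E" "b \<in> Obj E" using Hom_Obj[OF assms(3)] .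
  have "h = Zer E b x" using epic_Zer[OF assms(2) x(2) assms(3) x(1)] .
  then have "h \<cdot> Idt E b = Zer E b x" using x(1) by simp
  then obtain u where u: "u \<in> Hom E b a" "f \<cdot> u = Idt E b"
    using is_kernel_lift[OF h x(1) assms(3) Idt_Hom[OF o(2)]] by blast
  have "f \<cdot> (u \<cdot> f) = f \<cdot> Idt E a" using Cmp_eq[OF u(2) assms(3) u(1) assms(3)] assms(3) by simp
  then have "u \<cdot> f = Idt E a"
    by (rule monic_cancel[OF assms(1) _ assms(3)]) (use u(1) assms(3) o in simp_all)
  then show ?thesis using u by blast
qed

text \<open>Uniqueness of the induced arrow is recorded only as joint monicity, in its zero test
  form; differences recover the usual statement.\<close>

definition is_pullback :: "'a \<Rightarrow> 'a \<Rightarrow> 'a \<Rightarrow> 'a \<Rightarrow> 'b \<Rightarrow> 'b \<Rightarrow> 'b \<Rightarrow> 'b \<Rightarrow> bool" where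
  "is_pullback z a b c f g u v \<longleftrightarrow> f \<in> Hom E a c \<and> g \<in> Hom E b c \<and> u \<in> Hom E z a \<and> v \<in> Hom E z b \<and>
     f \<cdot> u = g \<cdot> v \<and>
     (\<forall>t. \<forall>x\<in>Hom E t a. \<forall>y\<in>Hom E t b. f \<cdot> x = g \<cdot> y \<longrightarrow>
        (\<exists>w\<in>Hom E t z. u \<cdot> w = x \<and> v \<cdot> w = y)) \<and>
     (\<forall>t. \<forall>w\<in>Hom E t z. u \<cdot> w = Zer E t a \<longrightarrow> v \<cdot> w = Zer E t b \<longrightarrow> w = Zer E t z)"

lemma is_pullbackD:
  assumes "is_pullback z a b c f g u v"
  shows "f \<in> Hom E a c" "g \<in> Hom E b c" "u \<in> Hom E z a" "v \<in> Hom E z b" "f \<cdot> u = g \<cdot> v"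
    "\<lbrakk>x \<in> Hom E t a; y \<in> Hom E t b; f \<cdot> x = g \<cdot> y\<rbrakk> \<Longrightarrow> \<exists>w\<in>Hom E t z. u \<cdot> w = x \<and> v \<cdot> w = y"
    "\<lbrakk>w \<in> Hom E t z; u \<cdot> w = Zer E t a; v \<cdot> w = Zer E t b\<rbrakk> \<Longrightarrow> w = Zer E t z"
  using assms unfolding is_pullback_def by blast+

lemma is_pullback_swap: "is_pullback z a b c f g u v \<Longrightarrow> is_pullback z b a c g f v u"
  unfolding is_pullback_def by (elim conjE, intro conjI) (assumption | simp only: | metis)+

text \<open>The pullback is the kernel of the difference \<open>d\<close> of the two arrows on the
  direct sum \<open>s\<close>.\<close>

lemma ex_pullback:
  assumes "f \<in> Hom E a c" "g \<in> Hom E b c"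
  shows "\<exists>z u v. is_pullback z a b c f g u v \<and> (epic E f \<longrightarrow> epic E v)"
proof -
  have ab: "a \<in> Obj E" "b \<in> Obj E" "c \<in> Obj E" using Hom_Obj assms by blast+
  obtain s i j p q where s: "is_biproduct E a b s i j p q" using ex_biproduct[OF ab(1,2)] .
  note B = biproductD[OF s] and Bs = biproduct_simps[OF s]
  define d where "d = f \<cdot> p \<boxplus> Neg (g \<cdot> q)"
  have d: "d \<in> Hom E s c" unfolding d_def using assms B(1-4) by simp
  obtain z k where k: "k \<in> Hom E z s" "is_kernel E d k" "d \<cdot> k = Zer E z c" "monic E k"
    using ex_kernel_Hom[OF d] by blast
  have uv: "p \<cdot> k \<in> Hom E z a" "q \<cdot> k \<in> Hom E z b" using k(1) B(3,4) by simp_all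
  have dx: "d \<cdot> x = f \<cdot> (p \<cdot> x) \<boxplus> Neg (g \<cdot> (q \<cdot> x))" if "x \<in> Hom E t s" for t x
    unfolding d_def using assms B(1-4) that by simp
  have 1: "is_pullback z a b c f g (p \<cdot> k) (q \<cdot> k)"
    unfolding is_pullback_def
  proof (intro conjI allI ballI impI)
    have "f \<cdot> (p \<cdot> k) \<boxplus> Neg (g \<cdot> (q \<cdot> k)) = Zer E z c"
      using dx[OF k(1)] k(3) by simp
    then show "f \<cdot> (p \<cdot> k) = g \<cdot> (q \<cdot> k)"
      using eq_of_diff_Zer[of "f \<cdot> (p \<cdot> k)" "g \<cdot> (q \<cdot> k)"] assms uv by simp
  next
    fix t x y assume x: "x \<in> Hom E t a" and y: "y \<in> Hom E t b" and eq: "f \<cdot> x = g \<cdot> y"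
    define w where "w = i \<cdot> x \<boxplus> j \<cdot> y"
    have w: "w \<in> Hom E t s" unfolding w_def using x y B(1-4) by simp
    have pw: "p \<cdot> w = x" "q \<cdot> w = y" unfolding w_def using x y B(1-4) Bs by simp_all
    have "d \<cdot> w = Zer E t c" using dx[OF w] pw eq y assms(2) by simp
    then obtain w' where w': "w' \<in> Hom E t z" "k \<cdot> w' = w"
      using is_kernel_lift[OF k(2) d k(1) w] by blast
    show "\<exists>w\<in>Hom E t z. p \<cdot> k \<cdot> w = x \<and> q \<cdot> k \<cdot> w = y"
      by (rule bexI[of _ w']) (use w' pw k(1) B(3,4) in simp_all)
  next
    fix t w assume w: "w \<in> Hom E t z" "p \<cdot> k \<cdot> w = Zer E t a" "q \<cdot> k \<cdot> w = Zer E t b"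
    have kw: "k \<cdot> w \<in> Hom E t s" using w(1) k(1) by simp
    have w': "p \<cdot> (k \<cdot> w) = Zer E t a" "q \<cdot> (k \<cdot> w) = Zer E t b"
      using w k(1) B(3,4) by simp_all
    have "t \<in> Obj E" using Hom_Obj[OF w(1)] by blast
    then have "k \<cdot> w = Zer E t s"
      using biproduct_decomp[OF s kw] w' B(1,2) ab biproduct_Obj(3)[OF s] by simp
    then show "w = Zer E t z"
      using monic_Zer[OF k(4) _ k(1) w(1)] by blast
  qed (use assms uv in blast)+
  have 2: "epic E (q \<cdot> k)" if f: "epic E f"
  proof (rule epicI[OF uv(2)])
    \<comment> \<open>As \<open>d \<cdot> i = f\<close> is epic, so is \<open>d\<close>, which is
      therefore the cokernel of its kernel \<open>k\<close>. If \<open>h\<close> kills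
      \<open>q \<cdot> k\<close>, then \<open>h \<cdot> q\<close> factors as
      \<open>w \<cdot> d\<close>; restricting to the first summand yields
      \<open>w \<cdot> f = 0\<close>, so \<open>w\<close> and then \<open>h\<close> vanish.\<close>
    have di: "d \<cdot> i = f" unfolding d_def using assms B ab by simp
    then have "epic E d" using epic_left_factor[OF _ B(1) d] f by simp
    then have dk: "is_cokernel E k d" using is_cokernel_of_kernel[OF _ k(2) d k(1)] by blast
    fix t h assume h: "h \<in> Hom E b t" "h \<cdot> (q \<cdot> k) = Zer E z t"
    have to: "t \<in> Obj E" using Hom_Obj[OF h(1)] by blast
    have hq: "h \<cdot> q \<in> Hom E s t" "(h \<cdot> q) \<cdot> k = Zer E z t"
      using h k(1) B(4) by simp_all
    obtain w where w: "w \<in> Hom E c t" "w \<cdot> d = h \<cdot> q"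
      using is_cokernel_lift[OF dk k(1) d hq] by blast
    have "w \<cdot> (d \<cdot> i) = h \<cdot> (q \<cdot> i)"
      using Cmp_eq[OF w(2) B(1) d w(1)] h(1) B(1,4) by simp
    then have "w \<cdot> f = Zer E a t" unfolding di B(7) using h(1) ab by simp
    then have "w = Zer E c t" using epic_Zer[OF f _ assms(1) w(1)] by blast
    then have "h \<cdot> q = Zer E s t" using w(2) d to by simp
    then have "h \<cdot> (q \<cdot> j) = Zer E s t \<cdot> j"
      using Cmp_eq[OF _ B(2,4) h(1)] by blast
    then show "h = Zer E b t" unfolding B(6) using h(1) B(2) to by simp
  qed
  show ?thesis using 1 2 by blast
qed

text \<open>Arrows \<open>y : t \<rightarrow> b\<close> serve as generalized elements of \<open>b\<close> in diagram chases; lifting along an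
  epimorphism is possible after passing to a cover \<open>r\<close> of \<open>t\<close>.\<close>

lemma cover:
  assumes "epic E f" "f \<in> Hom E a b" "y \<in> Hom E t b"
  shows "\<exists>s r x. epic E r \<and> r \<in> Hom E s t \<and> x \<in> Hom E s a \<and> f \<cdot> x = y \<cdot> r"
proof -
  obtain z u v where uv: "is_pullback z a t b f y u v" "epic E v"
    using ex_pullback[OF assms(2,3)] assms(1) by blast
  then show ?thesis using is_pullbackD(3,4,5)[OF uv(1)] by blast
qed

text \<open>A cover \<open>r\<close> of \<open>b\<close> that lifts along \<open>f\<close> factors
  through \<open>z\<close>, so \<open>v\<close> is epic because \<open>v \<cdot> w = r\<close> is.
  In contrast to \<open>ex_pullback\<close>, this concerns an arbitrary pullback.\<close>

lemma pullback_epic: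
  assumes "is_pullback z a b c f g u v" "epic E f"
  shows "epic E v"
proof -
  note P = is_pullbackD[OF assms(1)]
  obtain s r x where r: "epic E r" "r \<in> Hom E s b" "x \<in> Hom E s a" "f \<cdot> x = g \<cdot> r"
    using cover[OF assms(2) P(1,2)] by blast
  then obtain w where "w \<in> Hom E s z" "v \<cdot> w = r" using P(6) by blast
  then show ?thesis using epic_left_factor[of v w s z b] r(1) P(4) by simp
qed

text \<open>With \<open>k\<close> the image of \<open>f\<close>, an element \<open>h\<close> killed
  by \<open>g\<close> lies in the image as soon as its composite with the cokernel \<open>q\<close>
  vanishes, and this may be tested after a cover \<open>r\<close>. Exactness can thus be proved by
  chasing.\<close>

lemma exactI:
  assumes "f \<in> Hom E a b" "g \<in> Hom E b c" "g \<cdot> f = Zer E a c"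
    and ch: "\<And>t y. \<lbrakk>y \<in> Hom E t b; g \<cdot> y = Zer E t c\<rbrakk> \<Longrightarrow>
      \<exists>s r x. epic E r \<and> r \<in> Hom E s t \<and> x \<in> Hom E s a \<and> f \<cdot> x = y \<cdot> r"
  shows "exact_at E f g"
proof -
  obtain d q where q: "q \<in> Hom E b d" "is_cokernel E f q" "q \<cdot> f = Zer E a d"
    using ex_cokernel_Hom[OF assms(1)] by blast
  obtain i k where k: "k \<in> Hom E i b" "is_kernel E q k" "monic E k"
    using ex_kernel_Hom[OF q(1)] by blast
  obtain e where e: "epic E e" "e \<in> Hom E a i" "k \<cdot> e = f"
    using image_factor[OF q(2) k(2) assms(1) k(1)] by blast
  have gk: "g \<cdot> k \<in> Hom E i c" "(g \<cdot> k) \<cdot> e = Zer E a c" using assms(2,3) e k(1) by simp_all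
  have "is_kernel E g k"
  proof (rule is_kernelI[OF assms(2) k(1) epic_Zer[OF e(1) gk(2) e(2) gk(1)] k(3)])
    fix t h assume h: "h \<in> Hom E t b" "g \<cdot> h = Zer E t c"
    obtain s r x where r: "epic E r" "r \<in> Hom E s t" "x \<in> Hom E s a" "f \<cdot> x = h \<cdot> r"
      using ch[OF h] by blast
    have "(q \<cdot> h) \<cdot> r = q \<cdot> (f \<cdot> x)" unfolding r(4) using r(2) h q by simp
    also have "\<dots> = Zer E a d \<cdot> x" using Cmp_eq[OF q(3) r(3) assms(1) q(1)] .
    also have "\<dots> = Zer E s d" using r(3) Hom_Obj[OF q(1)] by simp
    finally have "q \<cdot> h = Zer E t d"
      using epic_Zer[OF r(1) _ r(2), of "q \<cdot> h" d] q(1) h by simp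
    then show "\<exists>u\<in>Hom E t i. k \<cdot> u = h"
      using is_kernel_lift[OF k(2) q(1) k(1) h(1)] by blast
  qed
  then show ?thesis unfolding exact_at_def using q k assms(1,2) by auto
qed

lemma exactE:
  assumes "exact_at E f g" "f \<in> Hom E a b" "g \<in> Hom E b c"
  obtains d q i k e where "is_cokernel E f q" "is_kernel E q k" "is_kernel E g k" "q \<in> Hom E b d"
    "k \<in> Hom E i b" "g \<cdot> k = Zer E i c" "q \<cdot> f = Zer E a d" "monic E k" "epic E e" "e \<in> Hom E a i"
    "k \<cdot> e = f"
proof -
  obtain q k where q: "is_cokernel E f q" "is_kernel E q k" "is_kernel E g k"
    using assms(1) unfolding exact_at_def by blast
  note Q = is_cokernelD[OF q(1) assms(2)] and K = is_kernelD[OF q(3) assms(3)]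
  obtain e where "epic E e" "e \<in> Hom E a (Dom E k)" "k \<cdot> e = f"
    using image_factor[OF q(1,2) assms(2) K(1)] by blast
  then show ?thesis by (rule that[OF q Q(1) K Q(2) is_kernel_monic[OF q(2)]])
qed

lemma exactD:
  assumes "exact_at E f g" "f \<in> Hom E a b" "g \<in> Hom E b c" "y \<in> Hom E t b" "g \<cdot> y = Zer E t c"
  shows "\<exists>s r x. epic E r \<and> r \<in> Hom E s t \<and> x \<in> Hom E s a \<and> f \<cdot> x = y \<cdot> r"
proof -
  obtain d q i k e where c: "is_cokernel E f q" "is_kernel E q k" "is_kernel E g k" "q \<in> Hom E b d"
    "k \<in> Hom E i b" "g \<cdot> k = Zer E i c" "q \<cdot> f = Zer E a d" "monic E k" "epic E e" "e \<in> Hom E a i"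
    "k \<cdot> e = f" using exactE[OF assms(1-3)] .
  obtain u where u: "u \<in> Hom E t i" "k \<cdot> u = y"
    using is_kernel_lift[OF c(3) assms(3) c(5) assms(4,5)] by blast
  obtain s r x where r: "epic E r" "r \<in> Hom E s t" "x \<in> Hom E s a" "e \<cdot> x = u \<cdot> r"
    using cover[OF c(9,10) u(1)] by blast
  have "f \<cdot> x = k \<cdot> (e \<cdot> x)" using Cmp_eq[OF c(11) r(3) c(10,5)] by simp
  then have "f \<cdot> x = y \<cdot> r" unfolding r(4) using Cmp_eq[OF u(2) r(2) u(1) c(5)] by simp
  then show ?thesis using r(1-3) by blast
qed

lemma exact_zero:
  assumes "exact_at E f g" "f \<in> Hom E a b" "g \<in> Hom E b c"
  shows "g \<cdot> f = Zer E a c"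
proof -
  obtain d q i k e where c: "is_cokernel E f q" "is_kernel E q k" "is_kernel E g k" "q \<in> Hom E b d"
    "k \<in> Hom E i b" "g \<cdot> k = Zer E i c" "q \<cdot> f = Zer E a d" "monic E k" "epic E e" "e \<in> Hom E a i"
    "k \<cdot> e = f" using exactE[OF assms(1-3)] .
  have "g \<cdot> (k \<cdot> e) = Zer E i c \<cdot> e" using Cmp_eq[OF c(6,10,5) assms(3)] .
  then show ?thesis using c(10,11) Hom_Obj[OF assms(3)] by simp
qed

text \<open>A monic \<open>f\<close> is itself a kernel of its cokernel, so the image
  \<open>k\<close> factors through it and its kernel property transfers.\<close>

lemma kernel_of_exact_monic:
  assumes "exact_at E f g" "monic E f" "f \<in> Hom E a b" "g \<in> Hom E b c"
  shows "is_kernel E g f"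
proof -
  obtain d q i k e where c: "is_cokernel E f q" "is_kernel E q k" "is_kernel E g k" "q \<in> Hom E b d"
    "k \<in> Hom E i b" "g \<cdot> k = Zer E i c" "q \<cdot> f = Zer E a d" "monic E k" "epic E e" "e \<in> Hom E a i"
    "k \<cdot> e = f" using exactE[OF assms(1,3,4)] .
  have f: "is_kernel E q f" using is_kernel_of_cokernel[OF assms(2) c(1) assms(3) c(4)] .
  have "q \<cdot> k = Zer E i d" using is_kernelD[OF c(2,4)] c(5) by simp
  then obtain w where "w \<in> Hom E i a" "f \<cdot> w = k"
    using is_kernel_lift[OF f c(4) assms(3) c(5)] by blast
  then show ?thesis
    using is_kernel_transfer[OF c(3) assms(4) c(5) assms(2,3) exact_zero[OF assms(1,3,4)]] by blast
qed

lemma exact_of_kernel: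
  assumes "is_kernel E g f" "f \<in> Hom E a b" "g \<in> Hom E b c"
  shows "exact_at E f g"
proof -
  obtain d q where q: "q \<in> Hom E b d" "is_cokernel E f q" using ex_cokernel_Hom[OF assms(2)] by blast
  show ?thesis unfolding exact_at_def
    using is_kernel_of_cokernel[OF is_kernel_monic[OF assms(1)] q(2) assms(2) q(1)] q assms by auto
qed

lemma exact_of_cokernel:
  assumes "is_cokernel E f g" "f \<in> Hom E a b" "g \<in> Hom E b c"
  shows "exact_at E f g"
proof -
  obtain k where "is_kernel E g k" using ex_kernel_Hom[OF assms(3)] by blast
  then show ?thesis unfolding exact_at_def using assms by auto
qed

text \<open>The epic \<open>g\<close> is the cokernel of its kernel, which by exactness is the image
  \<open>k\<close> of \<open>f\<close>. Killing \<open>f\<close> means factoring through the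
  cokernel \<open>q\<close> of \<open>f\<close>, and \<open>q\<close> kills
  \<open>k\<close>.\<close>

lemma cokernel_of_exact_epic:
  assumes "exact_at E f g" "epic E g" "f \<in> Hom E a b" "g \<in> Hom E b c"
  shows "is_cokernel E f g"
proof (rule is_cokernelI[OF assms(3,4) exact_zero[OF assms(1,3,4)] assms(2)])
  obtain d q i k e where c: "is_cokernel E f q" "is_kernel E q k" "is_kernel E g k" "q \<in> Hom E b d"
    "k \<in> Hom E i b" "g \<cdot> k = Zer E i c" "q \<cdot> f = Zer E a d" "monic E k" "epic E e" "e \<in> Hom E a i"
    "k \<cdot> e = f" using exactE[OF assms(1,3,4)] .
  have gk: "is_cokernel E k g" using is_cokernel_of_kernel[OF assms(2) c(3) assms(4) c(5)] .
  have qk: "q \<cdot> k = Zer E i d" using is_kernelD[OF c(2,4)] c(5) by simp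
  fix t h assume h: "h \<in> Hom E b t" "h \<cdot> f = Zer E a t"
  obtain w where w: "w \<in> Hom E d t" "w \<cdot> q = h"
    using is_cokernel_lift[OF c(1) assms(3) c(4) h] by blast
  have "h \<cdot> k = w \<cdot> (q \<cdot> k)" using Cmp_eq[OF w(2) c(5,4) w(1)] by simp
  then have "h \<cdot> k = Zer E i t" unfolding qk using w(1) Hom_Obj[OF c(5)] by simp
  then show "\<exists>u\<in>Hom E c t. u \<cdot> g = h"
    using is_cokernel_lift[OF gk c(5) assms(4) h(1)] by blast
qed

lemma short_exactD:
  assumes "short_exact E a f b g c"
  shows "f \<in> Hom E a b" "g \<in> Hom E b c" "monic E f" "epic E g" "is_kernel E g f" "is_cokernel E f g"
    "g \<cdot> f = Zer E a c" "exact_at E f g" "a \<in> Obj E" "b \<in> Obj E" "c \<in> Obj E"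
proof -
  show 1: "f \<in> Hom E a b" "g \<in> Hom E b c" "monic E f" "epic E g" "exact_at E f g"
    using assms unfolding short_exact_def by blast+
  show "is_kernel E g f" using kernel_of_exact_monic[OF 1(5,3,1,2)] .
  show "is_cokernel E f g" using cokernel_of_exact_epic[OF 1(5,4,1,2)] .
  show "g \<cdot> f = Zer E a c" using exact_zero[OF 1(5,1,2)] .
  show "a \<in> Obj E" "b \<in> Obj E" "c \<in> Obj E" using Hom_Obj 1 by blast+
qed

lemma short_exact_of_kernel:
  "\<lbrakk>is_kernel E g f; epic E g; f \<in> Hom E a b; g \<in> Hom E b c\<rbrakk> \<Longrightarrow> short_exact E a f b g c"
  unfolding short_exact_def using is_kernel_monic exact_of_kernel by blast

lemma short_exact_of_cokernel:
  "\<lbrakk>is_cokernel E f g; monic E f; f \<in> Hom E a b; g \<in> Hom E b c\<rbrakk> \<Longrightarrow> short_exact E a f b g c"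
  unfolding short_exact_def using is_cokernel_epic exact_of_cokernel by blast

lemma short_exactI:
  assumes "f \<in> Hom E a b" "g \<in> Hom E b c" "monic E f" "epic E g" "g \<cdot> f = Zer E a c"
    and "\<And>t y. \<lbrakk>y \<in> Hom E t b; g \<cdot> y = Zer E t c\<rbrakk> \<Longrightarrow>
      \<exists>s r x. epic E r \<and> r \<in> Hom E s t \<and> x \<in> Hom E s a \<and> f \<cdot> x = y \<cdot> r"
  shows "short_exact E a f b g c"
  unfolding short_exact_def using exactI[OF assms(1,2,5,6)] assms(1-4) by blast

end

section \<open>Constructions with short exact sequences\<close>

context additive_category
begin

lemma biproduct_ext:
  assumes "is_biproduct E a b s i j p q" "x \<in> Hom E t s" "y \<in> Hom E t s"
    "p \<cdot> x = p \<cdot> y" "q \<cdot> x = q \<cdot> y"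
  shows "x = y"
  using biproduct_decomp[OF assms(1,2)] biproduct_decomp[OF assms(1,3)] assms(4,5) by metis

lemma biproduct_ext':
  assumes "is_biproduct E a b s i j p q" "x \<in> Hom E s t" "y \<in> Hom E s t"
    "x \<cdot> i = y \<cdot> i" "x \<cdot> j = y \<cdot> j"
  shows "x = y"
proof -
  note B = biproductD[OF assms(1)]
  have "(x \<cdot> i) \<cdot> p \<boxplus> (x \<cdot> j) \<cdot> q = x" using biproduct_decomp'[OF assms(1,2)] .
  moreover have "(y \<cdot> i) \<cdot> p \<boxplus> (y \<cdot> j) \<cdot> q = y" using biproduct_decomp'[OF assms(1,3)] .
  ultimately show ?thesis using assms(4,5) by metis
qed

lemma projective_lift:
  assumes "projective E p" "epic E g" "g \<in> Hom E a b" "f \<in> Hom E p b"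
  shows "\<exists>h\<in>Hom E p a. g \<cdot> h = f"
proof -
  have "f \<in> Hom E p (Cod E g)" "Dom E g = a" using assms by simp_all
  then show ?thesis using assms(1,2) unfolding projective_def by blast
qed

lemma projectiveI:
  assumes "p \<in> Obj E"
    and "\<And>a b g f. \<lbrakk>epic E g; g \<in> Hom E a b; f \<in> Hom E p b\<rbrakk> \<Longrightarrow> \<exists>h\<in>Hom E p a. g \<cdot> h = f"
  shows "projective E p"
  unfolding projective_def
proof (intro conjI allI impI)
  fix g f assume "epic E g \<and> f \<in> Hom E p (Cod E g)"
  then have g: "epic E g" "f \<in> Hom E p (Cod E g)" by blast+
  then have "g \<in> Hom E (Dom E g) (Cod E g)" by simp
  with g show "\<exists>h\<in>Hom E p (Dom E g). g \<cdot> h = f" using assms(2) by blast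
qed (rule assms(1))

lemma projective_sum:
  assumes "projective E a" "projective E b" "is_biproduct E a b s i j p q"
  shows "projective E s"
proof (rule projectiveI[OF biproduct_Obj(3)[OF assms(3)]])
  note B = biproductD[OF assms(3)]
  fix x y g f assume g: "epic E g" "g \<in> Hom E x y" and f: "f \<in> Hom E s y"
  have fi: "f \<cdot> i \<in> Hom E a y" "f \<cdot> j \<in> Hom E b y" using f B(1,2) by simp_all
  obtain h where h: "h \<in> Hom E a x" "g \<cdot> h = f \<cdot> i" using projective_lift[OF assms(1) g fi(1)] by blast
  obtain k where k: "k \<in> Hom E b x" "g \<cdot> k = f \<cdot> j" using projective_lift[OF assms(2) g fi(2)] by blast
  have w: "h \<cdot> p \<boxplus> k \<cdot> q \<in> Hom E s x" using h(1) k(1) B(3,4) by simp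
  have "g \<cdot> (h \<cdot> p \<boxplus> k \<cdot> q) = (g \<cdot> h) \<cdot> p \<boxplus> (g \<cdot> k) \<cdot> q"
    using g(2) h(1) k(1) B(3,4) by simp
  also have "\<dots> = f" unfolding h(2) k(2) using biproduct_decomp'[OF assms(3) f] .
  finally show "\<exists>h\<in>Hom E s x. g \<cdot> h = f" using w by blast
qed

end

context abelian_category
begin

lemma short_exact_kernel_lift:
  assumes "short_exact E a f b g c" "y \<in> Hom E t b" "g \<cdot> y = Zer E t c"
  shows "\<exists>x\<in>Hom E t a. f \<cdot> x = y"
  using is_kernel_lift[OF short_exactD(5,2,1)[OF assms(1)] assms(2,3)] .

lemma short_exact_cokernel_lift:
  assumes "short_exact E a f b g c" "y \<in> Hom E b t" "y \<cdot> f = Zer E a t"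
  shows "\<exists>x\<in>Hom E c t. x \<cdot> g = y"
  using is_cokernel_lift[OF short_exactD(6,1,2)[OF assms(1)] assms(2,3)] .

lemma short_exactI_kernel:
  assumes "f \<in> Hom E a b" "g \<in> Hom E b c" "monic E f" "epic E g" "g \<cdot> f = Zer E a c"
    and "\<And>t y. \<lbrakk>y \<in> Hom E t b; g \<cdot> y = Zer E t c\<rbrakk> \<Longrightarrow> \<exists>x\<in>Hom E t a. f \<cdot> x = y"
  shows "short_exact E a f b g c"
  using short_exact_of_kernel[OF is_kernelI[OF assms(2,1,5,3,6)] assms(4,1,2)] .

lemma short_exact_biproduct:
  assumes "is_biproduct E a b s i j p q"
  shows "short_exact E a i s q b"
proof -
  note B = biproductD[OF assms]
  show ?thesis
  proof (rule short_exactI_kernel[OF B(1,4) monic_split[OF B(5,1,3)] epic_split[OF B(6,4,2)] B(7)])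
    fix t y assume y: "y \<in> Hom E t s" "q \<cdot> y = Zer E t b"
    have "i \<cdot> (p \<cdot> y) = y" using biproduct_decomp[OF assms y(1)] y B(1-3) Hom_Obj[OF y(1)] by simp
    then show "\<exists>x\<in>Hom E t a. i \<cdot> x = y" by (intro bexI[of _ "p \<cdot> y"]) (use y(1) B(3) in simp_all)
  qed
qed

text \<open>A section \<open>s\<close> of \<open>g\<close> exists by projectivity, and the
  idempotent \<open>Idt E m - s \<cdot> g\<close> has values in the kernel, which provides the
  retraction \<open>r\<close>.\<close>

lemma short_exact_split:
  assumes "short_exact E k f m g p" "projective E p"
  shows "\<exists>s r. is_biproduct E k p m f s r g"
proof -
  note S = short_exactD[OF assms(1)]
  obtain s where s: "s \<in> Hom E p m" "g \<cdot> s = Idt E p"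
    using projective_lift[OF assms(2) S(4,2) Idt_Hom[OF S(11)]] by blast
  define x where "x = Idt E m \<boxplus> Neg (s \<cdot> g)"
  have gsg: "g \<cdot> (s \<cdot> g) = g" using Cmp_eq[OF s(2) S(2) s(1) S(2)] S(2) by simp
  have x: "x \<in> Hom E m m" "g \<cdot> x = Zer E m p"
    unfolding x_def using s(1) S(2,10) gsg by simp_all
  obtain r where r: "r \<in> Hom E m k" "f \<cdot> r = x" using short_exact_kernel_lift[OF assms(1) x] by blast
  have "f \<cdot> (r \<cdot> f) = f \<cdot> Idt E k"
  proof -
    have "f \<cdot> (r \<cdot> f) = x \<cdot> f" using Cmp_eq[OF r(2) S(1) r(1) S(1)] .
    also have "\<dots> = f" unfolding x_def using S(1,2,7,9,10,11) s(1) by simp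
    finally show ?thesis using S(1) by simp
  qed
  then have rf: "r \<cdot> f = Idt E k"
    using monic_cancel[OF S(3) _ S(1), of "r \<cdot> f" "Idt E k" k] r(1) S(1,9) by simp
  have "f \<cdot> (r \<cdot> s) = f \<cdot> Zer E p k"
  proof -
    have "f \<cdot> (r \<cdot> s) = x \<cdot> s" using Cmp_eq[OF r(2) s(1) r(1) S(1)] .
    also have "\<dots> = Zer E p m" unfolding x_def using S(2,10,11) s by simp
    finally show ?thesis using S(1,11) by simp
  qed
  then have rs: "r \<cdot> s = Zer E p k"
    using monic_cancel[OF S(3) _ S(1), of "r \<cdot> s" "Zer E p k" p] r(1) s(1) S(9,11) by simp
  have "f \<cdot> r \<boxplus> s \<cdot> g = Idt E m" unfolding r(2) x_def using s(1) S(2,10) by simp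
  then have "is_biproduct E k p m f s r g"
    unfolding is_biproduct_def using S(1,2,7) s r(1) rf rs by blast
  then show ?thesis by blast
qed

text \<open>With \<open>a\<close> regarded as a subobject of \<open>b\<close>, the object
  \<open>k'\<close> is its preimage under \<open>e\<close>. A cover of \<open>b\<close> thereby also
  presents \<open>c\<close>, and the two kernels \<open>k\<close> and \<open>k'\<close> differ by
  \<open>a\<close>.\<close>

lemma short_exact_preimage:
  assumes "short_exact E a f b g c" "short_exact E k i p e b"
  shows "\<exists>k' i' u v. short_exact E k' i' p (g \<cdot> e) c \<and> short_exact E k u k' v a \<and> i' \<cdot> u = i \<and> f \<cdot> v = e \<cdot> i'"
proof -
  note S = short_exactD[OF assms(1)] and T = short_exactD[OF assms(2)]
  have ge: "g \<cdot> e \<in> Hom E p c" using S(2) T(2) by simp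
  obtain k' i' where i': "i' \<in> Hom E k' p" "is_kernel E (g \<cdot> e) i'" "g \<cdot> e \<cdot> i' = Zer E k' c" "monic E i'"
    using ex_kernel_Hom[OF ge] by blast
  have ei: "e \<cdot> i' \<in> Hom E k' b" "g \<cdot> (e \<cdot> i') = Zer E k' c" using i'(1,3) T(2) S(2) by simp_all
  obtain v where v: "v \<in> Hom E k' a" "f \<cdot> v = e \<cdot> i'" using short_exact_kernel_lift[OF assms(1) ei] by blast
  have "g \<cdot> e \<cdot> i = g \<cdot> (e \<cdot> i)" using T(1,2) S(2) by simp
  then have "g \<cdot> e \<cdot> i = Zer E k c" unfolding T(7) using S(2) T(9) by simp
  then obtain u where u: "u \<in> Hom E k k'" "i' \<cdot> u = i"
    using is_kernel_lift[OF i'(2) ge i'(1) T(1)] by blast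
  have "monic E u" using monic_right_factor[OF _ u(1) i'(1)] T(3) u(2) by simp
  moreover have "epic E v"
  proof -
    obtain s r x where r: "epic E r" "r \<in> Hom E s a" "x \<in> Hom E s p" "e \<cdot> x = f \<cdot> r"
      using cover[OF T(4,2) S(1)] by blast
    have "g \<cdot> e \<cdot> x = (g \<cdot> f) \<cdot> r" using r S(1,2) T(2) by simp
    then have "g \<cdot> e \<cdot> x = Zer E s c" unfolding S(7) using r(2) S(11) by simp
    then obtain w where w: "w \<in> Hom E s k'" "i' \<cdot> w = x"
      using is_kernel_lift[OF i'(2) ge i'(1) r(3)] by blast
    have "f \<cdot> (v \<cdot> w) = e \<cdot> (i' \<cdot> w)" using Cmp_eq[OF v(2) w(1) v(1) S(1)] w(1) i'(1) T(2) by simp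
    then have "f \<cdot> (v \<cdot> w) = f \<cdot> r" using w(2) r(4) by simp
    then have "v \<cdot> w = r" using monic_cancel[OF S(3) _ S(1), of "v \<cdot> w" r s] v(1) w(1) r(2) by simp
    then show ?thesis using epic_left_factor[OF _ w(1) v(1)] r(1) by simp
  qed
  moreover have "v \<cdot> u = Zer E k a"
  proof -
    have "f \<cdot> (v \<cdot> u) = e \<cdot> (i' \<cdot> u)" using Cmp_eq[OF v(2) u(1) v(1) S(1)] u(1) i'(1) T(2) by simp
    then have "f \<cdot> (v \<cdot> u) = Zer E k b" using u(2) T(7) by simp
    then show ?thesis using monic_Zer[OF S(3) _ S(1), of "v \<cdot> u" k] u(1) v(1) by simp
  qed
  moreover have "\<exists>x\<in>Hom E t k. u \<cdot> x = y" if y: "y \<in> Hom E t k'" "v \<cdot> y = Zer E t a" for t y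
  proof -
    have iy: "i' \<cdot> y \<in> Hom E t p" using y i'(1) by simp
    have "e \<cdot> (i' \<cdot> y) = f \<cdot> (v \<cdot> y)" using Cmp_eq[OF v(2) y(1) v(1) S(1)] y(1) i'(1) T(2) by simp
    then have "e \<cdot> (i' \<cdot> y) = Zer E t b" using y S(1) Hom_Obj[OF y(1)] by simp
    then obtain x where x: "x \<in> Hom E t k" "i \<cdot> x = i' \<cdot> y"
      using short_exact_kernel_lift[OF assms(2) iy] by blast
    have "i' \<cdot> (u \<cdot> x) = i' \<cdot> y" using Cmp_eq[OF u(2) x(1) u(1) i'(1)] x(2) by simp
    then have "u \<cdot> x = y" using monic_cancel[OF i'(4) _ i'(1), of "u \<cdot> x" y t] u(1) x(1) y(1) by simp
    then show ?thesis using x(1) by blast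
  qed
  ultimately have "short_exact E k u k' v a"
    by (intro short_exactI_kernel[OF u(1) v(1)])
  moreover have "short_exact E k' i' p (g \<cdot> e) c"
    using short_exact_of_kernel[OF i'(2) epic_Cmp[OF T(4) S(4) T(2) S(2)] i'(1) ge] .
  ultimately show ?thesis using u(2) v(2) by blast
qed

text \<open>The third isomorphism theorem for \<open>a\<close> inside \<open>b\<close> inside
  \<open>e\<close>: here \<open>c\<close> is \<open>b/a\<close>, \<open>F\<close> is
  \<open>e/a\<close> and \<open>d\<close> is \<open>e/b\<close>.\<close>

lemma short_exact_quotient:
  assumes "short_exact E a f b g c" "short_exact E b h e l d"
  shows "\<exists>F \<pi> u v. short_exact E a (h \<cdot> f) e \<pi> F \<and> short_exact E c u F v d"
proof -
  note S = short_exactD[OF assms(1)] and T = short_exactD[OF assms(2)]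
  have hf: "h \<cdot> f \<in> Hom E a e" "monic E (h \<cdot> f)" using S(1) T(1) monic_Cmp[OF S(3) T(3) S(1) T(1)] by simp_all
  obtain F \<pi> where \<pi>: "\<pi> \<in> Hom E e F" "is_cokernel E (h \<cdot> f) \<pi>" "\<pi> \<cdot> (h \<cdot> f) = Zer E a F" "epic E \<pi>"
    using ex_cokernel_Hom[OF hf(1)] by blast
  have ses: "short_exact E a (h \<cdot> f) e \<pi> F" using short_exact_of_cokernel[OF \<pi>(2) hf(2,1) \<pi>(1)] .
  have ph: "\<pi> \<cdot> h \<in> Hom E b F" "\<pi> \<cdot> h \<cdot> f = Zer E a F" using \<pi>(1,3) T(1) S(1) by simp_all
  obtain u where u: "u \<in> Hom E c F" "u \<cdot> g = \<pi> \<cdot> h" using short_exact_cokernel_lift[OF assms(1) ph] by blast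
  have "l \<cdot> (h \<cdot> f) = Zer E b d \<cdot> f" using Cmp_eq[OF T(7) S(1) T(1,2)] .
  then have "l \<cdot> (h \<cdot> f) = Zer E a d" using S(1) T(11) by simp
  then obtain v where v: "v \<in> Hom E F d" "v \<cdot> \<pi> = l" using short_exact_cokernel_lift[OF ses T(2)] by blast
  have "short_exact E c u F v d"
  proof (rule short_exactI[OF u(1) v(1)])
    show "monic E u"
    proof (rule monicI[OF u(1)])
      fix t y assume y: "y \<in> Hom E t c" "u \<cdot> y = Zer E t F"
      obtain s r x where r: "epic E r" "r \<in> Hom E s t" "x \<in> Hom E s b" "g \<cdot> x = y \<cdot> r"
        using cover[OF S(4,2) y(1)] by blast
      have hx: "h \<cdot> x \<in> Hom E s e" using r(3) T(1) by simp
      have "\<pi> \<cdot> (h \<cdot> x) = u \<cdot> (g \<cdot> x)" using Cmp_eq[OF u(2) r(3) S(2) u(1)] \<pi>(1) T(1) r(3) by simp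
      also have "\<dots> = Zer E t F \<cdot> r" unfolding r(4) using Cmp_eq[OF y(2) r(2) y(1) u(1)] .
      also have "\<dots> = Zer E s F" using r(2) Hom_Obj[OF u(1)] by simp
      finally obtain z where z: "z \<in> Hom E s a" "h \<cdot> f \<cdot> z = h \<cdot> x"
        using short_exact_kernel_lift[OF ses hx] by blast
      have "h \<cdot> (f \<cdot> z) = h \<cdot> x" using z T(1) S(1) by simp
      then have "f \<cdot> z = x" using monic_cancel[OF T(3) _ T(1), of "f \<cdot> z" x s] z(1) S(1) r(3) by simp
      then have "y \<cdot> r = g \<cdot> (f \<cdot> z)" using r(4) by simp
      also have "\<dots> = Zer E a c \<cdot> z" using Cmp_eq[OF S(7) z(1) S(1,2)] .
      finally have "y \<cdot> r = Zer E s c" using z(1) S(11) by simp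
      then show "y = Zer E t c" using epic_Zer[OF r(1) _ r(2) y(1)] by blast
    qed
    show "epic E v" using epic_left_factor[OF _ \<pi>(1) v(1)] v(2) T(4) by simp
    have "(v \<cdot> u) \<cdot> g = (v \<cdot> \<pi>) \<cdot> h" using Cmp_eq[OF u(2) Idt_Hom[OF S(10)] S(2) u(1)] u v(1) \<pi>(1) T(1) S(2) by simp
    then have "(v \<cdot> u) \<cdot> g = Zer E b d" unfolding v(2) T(7) .
    then show "v \<cdot> u = Zer E c d" using epic_Zer[OF S(4) _ S(2), of "v \<cdot> u" d] u(1) v(1) by simp
    fix t y assume y: "y \<in> Hom E t F" "v \<cdot> y = Zer E t d"
    obtain s r x where r: "epic E r" "r \<in> Hom E s t" "x \<in> Hom E s e" "\<pi> \<cdot> x = y \<cdot> r"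
      using cover[OF \<pi>(4,1) y(1)] by blast
    have "l \<cdot> x = v \<cdot> (\<pi> \<cdot> x)" using Cmp_eq[OF v(2) r(3) \<pi>(1) v(1)] by simp
    also have "\<dots> = Zer E t d \<cdot> r" unfolding r(4) using Cmp_eq[OF y(2) r(2) y(1) v(1)] .
    finally have "l \<cdot> x = Zer E s d" using r(2) T(11) by simp
    then obtain z where z: "z \<in> Hom E s b" "h \<cdot> z = x" using short_exact_kernel_lift[OF assms(2) r(3)] by blast
    have "u \<cdot> (g \<cdot> z) = \<pi> \<cdot> (h \<cdot> z)" using Cmp_eq[OF u(2) z(1) S(2) u(1)] \<pi>(1) T(1) z(1) by simp
    then have "u \<cdot> (g \<cdot> z) = y \<cdot> r" using z(2) r(4) by simp
    then show "\<exists>s r x. epic E r \<and> r \<in> Hom E s t \<and> x \<in> Hom E s c \<and> u \<cdot> x = y \<cdot> r"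
      using r(1,2) z(1) S(2) by (intro exI[of _ s] exI[of _ r] exI[of _ "g \<cdot> z"]) simp
  qed
  then show ?thesis using ses by blast
qed

text \<open>Parallel sides of a pullback square have the same kernel: \<open>i'\<close> is induced
  by the pair of \<open>i\<close> and the zero arrow.\<close>

lemma short_exact_pullback:
  assumes "is_pullback z a b c f g u v" "short_exact E k i a f c"
  shows "\<exists>i'. short_exact E k i' z v b \<and> u \<cdot> i' = i"
proof -
  note P = is_pullbackD[OF assms(1)] and S = short_exactD[OF assms(2)]
  have b: "b \<in> Obj E" using Hom_Obj[OF P(2)] by blast
  have "f \<cdot> i = g \<cdot> Zer E k b" using S(7,9) P(2) b by simp
  then obtain i' where i': "i' \<in> Hom E k z" "u \<cdot> i' = i" "v \<cdot> i' = Zer E k b"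
    using P(6)[OF S(1)] b S(9) by (metis Hom_iff Zer_types)
  have "short_exact E k i' z v b"
  proof (rule short_exactI_kernel[OF i'(1) P(4) _ pullback_epic[OF assms(1) S(4)] i'(3)])
    show "monic E i'" using monic_right_factor[OF _ i'(1) P(3)] i'(2) S(3) by simp
    fix t y assume y: "y \<in> Hom E t z" "v \<cdot> y = Zer E t b"
    have to: "t \<in> Obj E" using Hom_Obj[OF y(1)] by blast
    have uy: "u \<cdot> y \<in> Hom E t a" using y P(3) by simp
    have "f \<cdot> (u \<cdot> y) = g \<cdot> (v \<cdot> y)" using Cmp_eq[OF P(5) y(1) P(3,1)] y(1) P(2,4) by simp
    then have "f \<cdot> (u \<cdot> y) = Zer E t c" using y(2) P(2) to by simp
    then obtain x where x: "x \<in> Hom E t k" "i \<cdot> x = u \<cdot> y"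
      using short_exact_kernel_lift[OF assms(2) uy] by blast
    have ix: "i' \<cdot> x \<in> Hom E t z" using i'(1) x(1) by simp
    have e1: "u \<cdot> (i' \<cdot> x) = u \<cdot> y" using Cmp_eq[OF i'(2) x(1) i'(1) P(3)] x(2) by simp
    have e2: "v \<cdot> (i' \<cdot> x) = Zer E t b" using Cmp_eq[OF i'(3) x(1) i'(1) P(4)] x(1) b by simp
    have "i' \<cdot> x \<boxplus> Neg y = Zer E t z"
    proof (rule P(7))
      show "i' \<cdot> x \<boxplus> Neg y \<in> Hom E t z" using ix y(1) by simp
      show "u \<cdot> (i' \<cdot> x \<boxplus> Neg y) = Zer E t a" using ix y(1) P(3) e1 by (simp del: Cmp_assoc_right)
      show "v \<cdot> (i' \<cdot> x \<boxplus> Neg y) = Zer E t b" using ix y P(4) e2 to b by (simp del: Cmp_assoc_right)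
    qed
    then have "i' \<cdot> x = y" using eq_of_diff_Zer[of "i' \<cdot> x" y] ix y(1) by simp
    then show "\<exists>x\<in>Hom E t k. i' \<cdot> x = y" using x(1) by blast
  qed
  then show ?thesis using i'(2) by blast
qed

text \<open>The new epi is the direct sum of \<open>g\<close> and the identity of \<open>q\<close>;
  the extra summand does not change the kernel.\<close>

lemma short_exact_add_summand:
  assumes "short_exact E k f m g a" "is_biproduct E a q s i j p r" "is_biproduct E m q T i' j' p' r'"
  shows "\<exists>g'. short_exact E k (i' \<cdot> f) T g' s"
proof -
  note S = short_exactD[OF assms(1)] and B = biproductD[OF assms(2)] and B' = biproductD[OF assms(3)]
  define g' where "g' = (i \<cdot> g) \<cdot> p' \<boxplus> j \<cdot> r'"
  have g': "g' \<in> Hom E T s" unfolding g'_def using S(2) B(1,2) B'(3,4) by simp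
  have if': "i' \<cdot> f \<in> Hom E k T" using S(1) B'(1) by simp
  have gy: "p \<cdot> (g' \<cdot> y) = g \<cdot> (p' \<cdot> y)" "r \<cdot> (g' \<cdot> y) = r' \<cdot> y" if "y \<in> Hom E t T" for t y
  proof -
    have "g' \<cdot> y = i \<cdot> (g \<cdot> (p' \<cdot> y)) \<boxplus> j \<cdot> (r' \<cdot> y)" unfolding g'_def using that S(2) B(1,2) B'(3,4) by simp
    then show "p \<cdot> (g' \<cdot> y) = g \<cdot> (p' \<cdot> y)" "r \<cdot> (g' \<cdot> y) = r' \<cdot> y"
      using biproduct_simps[OF assms(2)] that S(2) B(1-4) B'(3,4) by simp_all
  qed
  have gi: "g' \<cdot> i' = i \<cdot> g" "g' \<cdot> j' = j"
    unfolding g'_def using S(2,10,11) B(1,2) B' biproduct_Obj[OF assms(2)] biproduct_Obj[OF assms(3)] by simp_all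
  have "short_exact E k (i' \<cdot> f) T g' s"
  proof (rule short_exactI_kernel[OF if' g'])
    show "monic E (i' \<cdot> f)" using monic_Cmp[OF S(3) monic_split[OF B'(5,1,3)] S(1) B'(1)] .
    show "epic E g'"
    proof (rule epicI[OF g'])
      fix t h assume h: "h \<in> Hom E s t" "h \<cdot> g' = Zer E T t"
      have to: "t \<in> Obj E" using Hom_Obj[OF h(1)] by blast
      have "h \<cdot> (g' \<cdot> i') = Zer E T t \<cdot> i'" using Cmp_eq[OF h(2) B'(1) g' h(1)] .
      then have "(h \<cdot> i) \<cdot> g = Zer E m t" unfolding gi using h(1) B(1) B'(1) S(2) to by simp
      then have hi: "h \<cdot> i = Zer E a t" using epic_Zer[OF S(4) _ S(2), of "h \<cdot> i" t] h(1) B(1) by simp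
      have "h \<cdot> (g' \<cdot> j') = Zer E T t \<cdot> j'" using Cmp_eq[OF h(2) B'(2) g' h(1)] .
      then have hj: "h \<cdot> j = Zer E q t" unfolding gi using h(1) B(2) B'(2) to by simp
      show "h = Zer E s t"
        by (rule biproduct_ext'[OF assms(2) h(1)]) (use hi hj B(1,2) biproduct_Obj[OF assms(2)] to in simp_all)
    qed
    have "g' \<cdot> (i' \<cdot> f) = i \<cdot> (g \<cdot> f)" using Cmp_eq[OF gi(1) S(1) B'(1) g'] S(1,2) B(1) by simp
    then show "g' \<cdot> (i' \<cdot> f) = Zer E k s" using S(7,9) B(1) by simp
    fix t y assume y: "y \<in> Hom E t T" "g' \<cdot> y = Zer E t s"
    have to: "t \<in> Obj E" using Hom_Obj[OF y(1)] by blast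
    have py: "p' \<cdot> y \<in> Hom E t m" "r' \<cdot> y \<in> Hom E t q" using y(1) B'(3,4) by simp_all
    have "g \<cdot> (p' \<cdot> y) = Zer E t a" using gy(1)[OF y(1)] y(2) B(3) to by simp
    then obtain x where x: "x \<in> Hom E t k" "f \<cdot> x = p' \<cdot> y" using short_exact_kernel_lift[OF assms(1) py(1)] by blast
    have ry: "r' \<cdot> y = Zer E t q" using gy(2)[OF y(1)] y(2) B(4) to by simp
    have "i' \<cdot> f \<cdot> x = i' \<cdot> (p' \<cdot> y)" using Cmp_assoc[OF x(1) S(1) B'(1)] x(2) by simp
    also have "\<dots> = y" using biproduct_decomp[OF assms(3) y(1)] ry py B'(1,2) to biproduct_Obj[OF assms(3)] by simp
    finally show "\<exists>x\<in>Hom E t k. i' \<cdot> f \<cdot> x = y" using x(1) by blast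
  qed
  then show ?thesis by blast
qed

text \<open>The short exact sequence says that \<open>m\<close> is the pushout of \<open>k\<close>
  and \<open>P\<close> along \<open>K\<close>: each extension of \<open>a\<close> arises from a
  presentation of \<open>a\<close> that maps to it. The sign in the first arrow makes the composite
  vanish.\<close>

lemma short_exact_pushout:
  assumes "short_exact E K i P e a" "short_exact E k f m g a" "l \<in> Hom E P m" "g \<cdot> l = e"
    and "is_biproduct E k P s i1 i2 p1 p2"
  shows "\<exists>w\<in>Hom E K k. f \<cdot> w = l \<cdot> i \<and> short_exact E K (Neg (i1 \<cdot> w) \<boxplus> i2 \<cdot> i) s (f \<cdot> p1 \<boxplus> l \<cdot> p2) m"
proof -
  note S = short_exactD[OF assms(1)] and T = short_exactD[OF assms(2)] and B = biproductD[OF assms(5)]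
    and Bs = biproduct_simps[OF assms(5)]
  have li: "l \<cdot> i \<in> Hom E K m" using S(1) assms(3) by simp
  have "g \<cdot> (l \<cdot> i) = Zer E K a" using Cmp_eq[OF assms(4) S(1) assms(3) T(2)] S(7) by simp
  then obtain w where w: "w \<in> Hom E K k" "f \<cdot> w = l \<cdot> i" using short_exact_kernel_lift[OF assms(2) li] by blast
  define u where "u = Neg (i1 \<cdot> w) \<boxplus> i2 \<cdot> i"
  define v where "v = f \<cdot> p1 \<boxplus> l \<cdot> p2"
  have u: "u \<in> Hom E K s" and v: "v \<in> Hom E s m"
    unfolding u_def v_def using S(1) T(1) B(1-4) w(1) assms(3) by simp_all
  have vy: "v \<cdot> y = f \<cdot> (p1 \<cdot> y) \<boxplus> l \<cdot> (p2 \<cdot> y)" if "y \<in> Hom E t s" for t y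
    unfolding v_def using that T(1) B(3,4) assms(3) by simp
  have uy: "p1 \<cdot> (u \<cdot> y) = Neg (w \<cdot> y)" "p2 \<cdot> (u \<cdot> y) = i \<cdot> y" if "y \<in> Hom E t K" for t y
  proof -
    have ty: "t \<in> Obj E" "K \<in> Obj E" "k \<in> Obj E" "P \<in> Obj E" using Hom_Obj that w(1) S(1) by blast+
    have "u \<cdot> y = Neg (i1 \<cdot> (w \<cdot> y)) \<boxplus> i2 \<cdot> (i \<cdot> y)"
      unfolding u_def using that S(1) B(1,2) w(1) by simp
    then show "p1 \<cdot> (u \<cdot> y) = Neg (w \<cdot> y)" "p2 \<cdot> (u \<cdot> y) = i \<cdot> y"
      using Bs that w(1) S(1) B(1-4) ty by simp_all
  qed
  have "short_exact E K u s v m"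
  proof (rule short_exactI_kernel[OF u v])
    show "monic E u"
    proof (rule monicI[OF u])
      fix t y assume y: "y \<in> Hom E t K" "u \<cdot> y = Zer E t s"
      then have "i \<cdot> y = Zer E t P" using uy(2)[OF y(1)] B(4) Hom_Obj[OF y(1)] by simp
      then show "y = Zer E t K" using monic_Zer[OF S(3) _ S(1) y(1)] by blast
    qed
    show "epic E v"
    proof (rule epicI[OF v])
      fix t h assume h: "h \<in> Hom E m t" "h \<cdot> v = Zer E s t"
      have to: "t \<in> Obj E" using Hom_Obj[OF h(1)] by blast
      have vi: "v \<cdot> i1 = f" "v \<cdot> i2 = l" using vy[OF B(1)] vy[OF B(2)] B T(1) assms(3) biproduct_Obj[OF assms(5)] T(10) by simp_all
      have "h \<cdot> (v \<cdot> i1) = Zer E s t \<cdot> i1" using Cmp_eq[OF h(2) B(1) v h(1)] .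
      then have "h \<cdot> f = Zer E k t" unfolding vi using B(1) to by simp
      then obtain x where x: "x \<in> Hom E a t" "x \<cdot> g = h" using short_exact_cokernel_lift[OF assms(2) h(1)] by blast
      have "h \<cdot> (v \<cdot> i2) = Zer E s t \<cdot> i2" using Cmp_eq[OF h(2) B(2) v h(1)] .
      then have "h \<cdot> l = Zer E P t" unfolding vi using B(2) to by simp
      then have "x \<cdot> e = Zer E P t" using Cmp_eq[OF x(2) assms(3) T(2) x(1)] assms(4) by simp
      then have "x = Zer E a t" using epic_Zer[OF S(4) _ S(2) x(1)] by blast
      then show "h = Zer E m t" using x(2) T(2) to by simp
    qed
    have "v \<cdot> u = Neg (f \<cdot> w) \<boxplus> l \<cdot> i"
      using vy[OF u] uy[OF Idt_Hom[OF S(9)]] u w(1) S(1) T(1) assms(3) by simp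
    then show "v \<cdot> u = Zer E K m" unfolding w(2) using S(1) assms(3) by simp
    fix t y assume y: "y \<in> Hom E t s" "v \<cdot> y = Zer E t m"
    have to: "t \<in> Obj E" using Hom_Obj[OF y(1)] by blast
    have py: "p1 \<cdot> y \<in> Hom E t k" "p2 \<cdot> y \<in> Hom E t P" using y(1) B(3,4) by simp_all
    have eq: "f \<cdot> (p1 \<cdot> y) \<boxplus> l \<cdot> (p2 \<cdot> y) = Zer E t m" using vy[OF y(1)] y(2) by simp
    have gf: "g \<cdot> (f \<cdot> (p1 \<cdot> y)) = Zer E t a" using Cmp_eq[OF T(7) py(1) T(1,2)] py(1) T(11) by simp
    have "g \<cdot> (f \<cdot> (p1 \<cdot> y) \<boxplus> l \<cdot> (p2 \<cdot> y)) = g \<cdot> (f \<cdot> (p1 \<cdot> y)) \<boxplus> g \<cdot> (l \<cdot> (p2 \<cdot> y))"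
      using T(1,2) assms(3) py by (simp del: Cmp_assoc_right)
    then have "Zer E t a = e \<cdot> (p2 \<cdot> y)" unfolding eq gf
      using Cmp_eq[OF assms(4) py(2) assms(3) T(2)] py(2) S(2) T(2) to T(10) by simp
    then obtain x where x: "x \<in> Hom E t K" "i \<cdot> x = p2 \<cdot> y"
      using short_exact_kernel_lift[OF assms(1) py(2)] by metis
    have "f \<cdot> (w \<cdot> x) = l \<cdot> (p2 \<cdot> y)"
      using Cmp_eq[OF w(2) x(1) w(1) T(1)] x S(1) assms(3) by simp
    then have "f \<cdot> (p1 \<cdot> y) \<boxplus> f \<cdot> (w \<cdot> x) = Zer E t m" using eq by simp
    then have "f \<cdot> (p1 \<cdot> y \<boxplus> w \<cdot> x) = Zer E t m" using py(1) w(1) x(1) T(1) by simp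
    then have z: "p1 \<cdot> y \<boxplus> w \<cdot> x = Zer E t k" using monic_Zer[OF T(3) _ T(1), of "p1 \<cdot> y \<boxplus> w \<cdot> x" t] py(1) w(1) x(1) by simp
    have "w \<cdot> x = Neg (p1 \<cdot> y)" by (rule Neg_unique) (use z py(1) w(1) x(1) in simp_all)
    then have "p1 \<cdot> (u \<cdot> x) = p1 \<cdot> y" using uy(1)[OF x(1)] py(1) by simp
    moreover have "p2 \<cdot> (u \<cdot> x) = p2 \<cdot> y" using uy(2)[OF x(1)] x(2) by simp
    ultimately have "u \<cdot> x = y"
      using biproduct_ext[OF assms(5) _ y(1)] u x(1) by simp
    then show "\<exists>x\<in>Hom E t K. u \<cdot> x = y" using x(1) by blast
  qed
  then show ?thesis using w unfolding u_def v_def by blast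
qed

end

section \<open>Dimension shifting\<close>

text \<open>\<open>syz E \<Phi> j a\<close> says that \<open>\<Phi>\<close> holds for a \<open>j\<close>-th syzygy of \<open>a\<close>. For \<open>\<Phi>\<close> the vanishing of
  \<open>Ext\<^sup>1(-, b)\<close>, respectively of \<open>L\<^sub>1 G\<close>, this is the vanishing of \<open>Ext\<close>, respectively of the derived
  functor, in degree \<open>j + 1\<close>.\<close>

primrec syz :: "('o, 'm) cat \<Rightarrow> ('o \<Rightarrow> bool) \<Rightarrow> nat \<Rightarrow> 'o \<Rightarrow> bool" where
  "syz E \<Phi> 0 a \<longleftrightarrow> \<Phi> a"
| "syz E \<Phi> (Suc j) a \<longleftrightarrow> (\<exists>k f p g. short_exact E k f p g a \<and> projective E p \<and> syz E \<Phi> j k)"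

text \<open>Syzygies are unique only up to projective summands, so a property that ignores such
  summands has a well-defined meaning on them.\<close>

definition stable_under_projectives :: "('o, 'm) cat \<Rightarrow> ('o \<Rightarrow> bool) \<Rightarrow> bool" where
  "stable_under_projectives E \<Phi> \<longleftrightarrow>
     (\<forall>a q s i j p r. is_biproduct E a q s i j p r \<and> projective E q \<longrightarrow> \<Phi> a = \<Phi> s)"

text \<open>\<open>Ext\<^sup>1(a, b) = 0\<close> means that every arrow into \<open>b\<close> extends along every monomorphism with cokernel
  \<open>a\<close>, and \<open>L\<^sub>1 G(a) = 0\<close> that \<open>G\<close> preserves all these monomorphisms. Both are instances of the
  following resolution-free notion.\<close>

definition ses_into :: "('o, 'm) cat \<Rightarrow> ('m \<Rightarrow> bool) \<Rightarrow> 'o \<Rightarrow> bool" where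
  "ses_into E \<Psi> a \<longleftrightarrow> (\<forall>k f m g. short_exact E k f m g a \<longrightarrow> \<Psi> f)"

text \<open>Changing the middle term of a sequence by a projective summand composes its monomorphism
  with a split one; this condition makes \<open>ses_into\<close> insensitive to that.\<close>

definition stable_under_split :: "('o, 'm) cat \<Rightarrow> ('m \<Rightarrow> bool) \<Rightarrow> bool" where
  "stable_under_split E \<Psi> \<longleftrightarrow>
     (\<forall>k m n f i r. f \<in> Hom E k m \<and> i \<in> Hom E m n \<and> r \<in> Hom E n m \<and> r \<cdot>\<^bsub>E\<^esub> i = Idt E m \<longrightarrow>
        \<Psi> (i \<cdot>\<^bsub>E\<^esub> f) = \<Psi> f)"

definition extends_along :: "('o, 'm) cat \<Rightarrow> 'o \<Rightarrow> 'm \<Rightarrow> bool" where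
  "extends_along E b f \<longleftrightarrow> (\<forall>\<phi>\<in>Hom E (Dom E f) b. \<exists>\<psi>\<in>Hom E (Cod E f) b. \<psi> \<cdot>\<^bsub>E\<^esub> f = \<phi>)"

lemma extends_along_iff:
  assumes "f \<in> Hom E k m"
  shows "extends_along E b f \<longleftrightarrow> (\<forall>\<phi>\<in>Hom E k b. \<exists>\<psi>\<in>Hom E m b. \<psi> \<cdot>\<^bsub>E\<^esub> f = \<phi>)"
proof -
  have "Dom E f = k" "Cod E f = m" using assms by simp_all
  then show ?thesis unfolding extends_along_def by blast
qed

context abelian_category
begin

text \<open>Given an extension of the sum \<open>s\<close>, the preimage \<open>k'\<close> of
  \<open>a\<close> is a direct summand of the middle term, because the quotient \<open>q\<close> is
  projective. Conversely, an extension of \<open>a\<close> becomes one of \<open>s\<close> by adding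
  \<open>q\<close> to its middle term.\<close>

lemma stable_ses_into:
  assumes "stable_under_split E \<Psi>"
  shows "stable_under_projectives E (ses_into E \<Psi>)"
  unfolding stable_under_projectives_def
proof (intro allI impI iffI; elim conjE)
  fix a q s i j p r
  assume s: "is_biproduct E a q s i j p r" and q: "projective E q"
  note B = biproductD[OF s]
  {
    assume a: "ses_into E \<Psi> a"
    show "ses_into E \<Psi> s"
      unfolding ses_into_def
    proof (intro allI impI)
      fix k f m g assume ses: "short_exact E k f m g s"
      obtain k' i' u v where k': "short_exact E k' i' m (r \<cdot> g) q" "short_exact E k u k' v a" "i' \<cdot> u = f"
        using short_exact_preimage[OF short_exact_biproduct[OF s] ses] by blast
      obtain x y where "is_biproduct E k' q m i' x y (r \<cdot> g)" using short_exact_split[OF k'(1) q] by blast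
      note B' = biproductD[OF this]
      have "\<Psi> u" using a k'(2) unfolding ses_into_def by blast
      then show "\<Psi> f"
        using assms B'(1,3,5) short_exactD(1)[OF k'(2)] k'(3) unfolding stable_under_split_def by blast
    qed
  next
    assume a: "ses_into E \<Psi> s"
    show "ses_into E \<Psi> a"
      unfolding ses_into_def
    proof (intro allI impI)
      fix k f m g assume ses: "short_exact E k f m g a"
      obtain T i' j' p' r' where T: "is_biproduct E m q T i' j' p' r'"
        using ex_biproduct[OF short_exactD(10)[OF ses] biproduct_Obj(2)[OF s]] .
      note B' = biproductD[OF T]
      obtain g' where "short_exact E k (i' \<cdot> f) T g' s" using short_exact_add_summand[OF ses s T] by blast
      then have "\<Psi> (i' \<cdot> f)" using a unfolding ses_into_def by blast
      then show "\<Psi> f"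
        using assms B'(1,3,5) short_exactD(1)[OF ses] unfolding stable_under_split_def by blast
    qed
  }
qed

lemma stable_syz:
  assumes "stable_under_projectives E \<Phi>"
  shows "stable_under_projectives E (syz E \<Phi> j)"
proof (induction j)
  case 0
  then show ?case using assms unfolding stable_under_projectives_def by simp
next
  case (Suc n)
  show ?case
    unfolding stable_under_projectives_def
  proof (intro allI impI iffI; elim conjE)
    fix a q s i j p r
    assume s: "is_biproduct E a q s i j p r" and q: "projective E q"
    {
      assume "syz E \<Phi> (Suc n) a"
      then obtain k f m g where ses: "short_exact E k f m g a" "projective E m" "syz E \<Phi> n k" by auto
      obtain T i' j' p' r' where T: "is_biproduct E m q T i' j' p' r'"
        using ex_biproduct[OF short_exactD(10)[OF ses(1)] biproduct_Obj(2)[OF s]] .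
      obtain g' where "short_exact E k (i' \<cdot> f) T g' s" using short_exact_add_summand[OF ses(1) s T] by blast
      then show "syz E \<Phi> (Suc n) s" using projective_sum[OF ses(2) q T] ses(3) by auto
    next
      assume "syz E \<Phi> (Suc n) s"
      then obtain k f m g where ses: "short_exact E k f m g s" "projective E m" "syz E \<Phi> n k" by auto
      obtain k' i' u v where k': "short_exact E k' i' m (p \<cdot> g) a" "short_exact E k u k' v q"
        using short_exact_preimage[OF short_exact_biproduct[OF is_biproduct_swap[OF s]] ses(1)] by blast
      \<comment> \<open>The kernel \<open>k'\<close> of \<open>m \<rightarrow> a\<close> is an
        extension of the projective \<open>q\<close> by \<open>k\<close>, hence \<open>k\<close>
        plus a projective summand, which the induction hypothesis ignores.\<close>
      obtain x y where "is_biproduct E k q k' u x y v" using short_exact_split[OF k'(2) q] by blast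
      then have "syz E \<Phi> n k'" using Suc ses(3) q unfolding stable_under_projectives_def by blast
      then show "syz E \<Phi> (Suc n) a" using k'(1) ses(2) by auto
    }
  qed
qed

text \<open>Schanuel's argument: the pullback of two projective presentations is the direct sum of either
  syzygy with a projective object.\<close>

lemma syz_any_presentation:
  assumes "stable_under_projectives E \<Phi>" "syz E \<Phi> (Suc j) a" "short_exact E k f p g a" "projective E p"
  shows "syz E \<Phi> j k"
proof -
  obtain k' f' p' g' where ses: "short_exact E k' f' p' g' a" "projective E p'" "syz E \<Phi> j k'"
    using assms(2) by auto
  obtain z u v where P: "is_pullback z p p' a g g' u v"
    using ex_pullback[OF short_exactD(2)[OF assms(3)] short_exactD(2)[OF ses(1)]] by blast
  obtain i where i: "short_exact E k i z v p'" using short_exact_pullback[OF P assms(3)] by blast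
  obtain i' where i': "short_exact E k' i' z u p" using short_exact_pullback[OF is_pullback_swap[OF P] ses(1)] by blast
  obtain x y where 1: "is_biproduct E k p' z i x y v" using short_exact_split[OF i ses(2)] by blast
  obtain x' y' where 2: "is_biproduct E k' p z i' x' y' u" using short_exact_split[OF i' assms(4)] by blast
  show ?thesis using stable_syz[OF assms(1), of j] ses(2,3) assms(4) 1 2
    unfolding stable_under_projectives_def by blast
qed

lemma stable_extends_along: "stable_under_split E (extends_along E b)"
  unfolding stable_under_split_def
proof (intro allI impI iffI; elim conjE)
  fix k m n f i r
  assume f: "f \<in> Hom E k m" and i: "i \<in> Hom E m n" and r: "r \<in> Hom E n m" and ri: "r \<cdot> i = Idt E m"
  have if': "i \<cdot> f \<in> Hom E k n" using f i by simp
  {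
    assume e: "extends_along E b (i \<cdot> f)"
    show "extends_along E b f" unfolding extends_along_iff[OF f]
    proof
      fix \<phi> assume "\<phi> \<in> Hom E k b"
      then obtain \<psi> where \<psi>: "\<psi> \<in> Hom E n b" "\<psi> \<cdot> (i \<cdot> f) = \<phi>"
        using e unfolding extends_along_iff[OF if'] by blast
      then show "\<exists>\<psi>\<in>Hom E m b. \<psi> \<cdot> f = \<phi>" using f i by (intro bexI[of _ "\<psi> \<cdot> i"]) simp_all
    qed
  next
    assume e: "extends_along E b f"
    show "extends_along E b (i \<cdot> f)" unfolding extends_along_iff[OF if']
    proof
      fix \<phi> assume "\<phi> \<in> Hom E k b"
      then obtain \<psi> where \<psi>: "\<psi> \<in> Hom E m b" "\<psi> \<cdot> f = \<phi>"
        using e unfolding extends_along_iff[OF f] by blast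
      have "r \<cdot> (i \<cdot> f) = f" using Cmp_eq[OF ri f i r] f by simp
      then have "(\<psi> \<cdot> r) \<cdot> (i \<cdot> f) = \<phi>" using \<psi> r i f by simp
      then show "\<exists>\<psi>\<in>Hom E n b. \<psi> \<cdot> (i \<cdot> f) = \<phi>"
        using \<psi>(1) r by (intro bexI[of _ "\<psi> \<cdot> r"]) simp_all
    qed
  }
qed

abbreviation ext1_zero :: "'a \<Rightarrow> 'a \<Rightarrow> bool" where
  "ext1_zero b \<equiv> ses_into E (extends_along E b)"

lemma ext1_zero_stable: "stable_under_projectives E (ext1_zero b)"
  using stable_ses_into[OF stable_extends_along] .

lemma ext1_zeroD:
  assumes "ext1_zero b a" "short_exact E k f m g a" "\<phi> \<in> Hom E k b"
  shows "\<exists>\<psi>\<in>Hom E m b. \<psi> \<cdot> f = \<phi>"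
proof -
  have "extends_along E b f" using assms unfolding ses_into_def by blast
  moreover have "Dom E f = k" "Cod E f = m" using short_exactD(1)[OF assms(2)] by simp_all
  ultimately show ?thesis using assms(3) unfolding extends_along_def by blast
qed

text \<open>By \<open>short_exact_pushout\<close> the middle term \<open>m\<close> is glued from
  \<open>k\<close> and \<open>P\<close> along \<open>K\<close>. An arrow on \<open>k\<close> is
  restricted to \<open>K\<close> and extended over \<open>P\<close>; both then glue to an arrow on
  \<open>m\<close>. One projective presentation thus decides about all extensions.\<close>

lemma ext1_zero_of_presentation:
  assumes "short_exact E K i P e a" "projective E P"
    and ext: "\<And>\<phi>. \<phi> \<in> Hom E K b \<Longrightarrow> \<exists>\<psi>\<in>Hom E P b. \<psi> \<cdot> i = \<phi>"
  shows "ext1_zero b a"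
  unfolding ses_into_def extends_along_def
proof (intro allI impI ballI)
  fix k f m g \<phi> assume ses: "short_exact E k f m g a" and "\<phi> \<in> Hom E (Dom E f) b"
  note S = short_exactD[OF ses] and T = short_exactD[OF assms(1)]
  have \<phi>: "\<phi> \<in> Hom E k b" using \<open>\<phi> \<in> Hom E (Dom E f) b\<close> S(1) by simp
  obtain l where l: "l \<in> Hom E P m" "g \<cdot> l = e" using projective_lift[OF assms(2) S(4,2) T(2)] by blast
  obtain s i1 i2 p1 p2 where s: "is_biproduct E k P s i1 i2 p1 p2" using ex_biproduct[OF S(9) T(10)] .
  note B = biproductD[OF s]
  obtain w where w: "w \<in> Hom E K k"
    "short_exact E K (Neg (i1 \<cdot> w) \<boxplus> i2 \<cdot> i) s (f \<cdot> p1 \<boxplus> l \<cdot> p2) m"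
    using short_exact_pushout[OF assms(1) ses l s] by blast
  have "\<phi> \<cdot> w \<in> Hom E K b" using \<phi> w(1) by simp
  then obtain \<psi> where \<psi>: "\<psi> \<in> Hom E P b" "\<psi> \<cdot> i = \<phi> \<cdot> w" using ext by blast
  have o: "k \<in> Obj E" "P \<in> Obj E" "b \<in> Obj E" "K \<in> Obj E" using S(9) T(9,10) Hom_Obj[OF \<phi>] by simp_all
  have y: "\<phi> \<cdot> p1 \<boxplus> \<psi> \<cdot> p2 \<in> Hom E s b" using \<phi> \<psi>(1) B(3,4) by simp
  have yx: "(\<phi> \<cdot> p1 \<boxplus> \<psi> \<cdot> p2) \<cdot> x = \<phi> \<cdot> (p1 \<cdot> x) \<boxplus> \<psi> \<cdot> (p2 \<cdot> x)" if "x \<in> Hom E t s" for x t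
    using that \<phi> \<psi>(1) B(3,4) by simp
  have u: "Neg (i1 \<cdot> w) \<boxplus> i2 \<cdot> i \<in> Hom E K s" using short_exactD(1)[OF w(2)] .
  have p1u: "p1 \<cdot> (Neg (i1 \<cdot> w) \<boxplus> i2 \<cdot> i) = Neg w"
    using biproduct_simps[OF s] w(1) T(1) B(1-4) o by simp
  have p2u: "p2 \<cdot> (Neg (i1 \<cdot> w) \<boxplus> i2 \<cdot> i) = i"
    using biproduct_simps[OF s] w(1) T(1) B(1-4) o by simp
  have "(\<phi> \<cdot> p1 \<boxplus> \<psi> \<cdot> p2) \<cdot> (Neg (i1 \<cdot> w) \<boxplus> i2 \<cdot> i) = Zer E K b"
    unfolding yx[OF u] p1u p2u using \<psi>(2) \<phi> w(1) by simp
  then obtain h where h: "h \<in> Hom E m b" "h \<cdot> (f \<cdot> p1 \<boxplus> l \<cdot> p2) = \<phi> \<cdot> p1 \<boxplus> \<psi> \<cdot> p2"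
    using short_exact_cokernel_lift[OF w(2) y] by blast
  have "(f \<cdot> p1 \<boxplus> l \<cdot> p2) \<cdot> i1 = f" using B S(1,10) l(1) o by simp
  then have "h \<cdot> f = (\<phi> \<cdot> p1 \<boxplus> \<psi> \<cdot> p2) \<cdot> i1"
    using Cmp_eq[OF h(2) B(1) short_exactD(2)[OF w(2)] h(1)] by simp
  then have "h \<cdot> f = \<phi>" using B \<phi> \<psi>(1) o by simp
  then show "\<exists>\<psi>\<in>Hom E (Cod E f) b. \<psi> \<cdot> f = \<phi>" using h(1) S(1) by auto
qed

text \<open>The cokernel end of the snake lemma; it is left exact because the kernel of
  \<open>\<gamma>\<close> is trivial. The upper row is only assumed right exact since it will be the
  image under \<open>G\<close> of a short exact sequence.\<close>

lemma snake_cokernel: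
  assumes "exact_at E f g" "epic E g" "f \<in> Hom E a b" "g \<in> Hom E b c"
    and "short_exact E a' f' b' g' c'"
    and "\<alpha> \<in> Hom E a a'" "\<beta> \<in> Hom E b b'" "\<gamma> \<in> Hom E c c'" "monic E \<gamma>"
    and "f' \<cdot> \<alpha> = \<beta> \<cdot> f" "g' \<cdot> \<beta> = \<gamma> \<cdot> g"
    and "is_cokernel E \<alpha> p" "is_cokernel E \<beta> q" "is_cokernel E \<gamma> r"
    and "p \<in> Hom E a' a''" "q \<in> Hom E b' b''" "r \<in> Hom E c' c''"
  shows "\<exists>u v. short_exact E a'' u b'' v c''"
proof -
  note S = short_exactD[OF assms(5)] and ep = is_cokernel_epic[OF assms(12)] is_cokernel_epic[OF assms(13)] is_cokernel_epic[OF assms(14)]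
  have z: "p \<cdot> \<alpha> = Zer E a a''" "q \<cdot> \<beta> = Zer E b b''" "r \<cdot> \<gamma> = Zer E c c''"
    using is_cokernelD(2)[OF assms(12,6)] is_cokernelD(2)[OF assms(13,7)] is_cokernelD(2)[OF assms(14,8)]
      assms(15-17) by simp_all
  have o: "a'' \<in> Obj E" "b'' \<in> Obj E" "c'' \<in> Obj E" "a \<in> Obj E" "b \<in> Obj E" "c \<in> Obj E"
    using Hom_Obj assms(3,4,15-17) by blast+
  have qf: "q \<cdot> f' \<in> Hom E a' b''" using assms(16) S(1) by simp
  have "q \<cdot> f' \<cdot> \<alpha> = (q \<cdot> \<beta>) \<cdot> f" using assms(3,6,7,10,16) S(1) by simp
  then have "q \<cdot> f' \<cdot> \<alpha> = Zer E a b''" unfolding z using assms(3) o by simp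
  then obtain u where u: "u \<in> Hom E a'' b''" "u \<cdot> p = q \<cdot> f'"
    using is_cokernel_lift[OF assms(12,6,15) qf] by blast
  have rg: "r \<cdot> g' \<in> Hom E b' c''" using assms(17) S(2) by simp
  have "r \<cdot> g' \<cdot> \<beta> = (r \<cdot> \<gamma>) \<cdot> g" using assms(4,7,8,11,17) S(2) by simp
  then have "r \<cdot> g' \<cdot> \<beta> = Zer E b c''" unfolding z using assms(4) o by simp
  then obtain v where v: "v \<in> Hom E b'' c''" "v \<cdot> q = r \<cdot> g'"
    using is_cokernel_lift[OF assms(13,7,16) rg] by blast
  \<comment> \<open>An element killed by a cokernel of \<open>h\<close> comes from \<open>h\<close>
    after a cover.\<close>
  have imQ: "\<exists>s t' w. epic E s \<and> s \<in> Hom E t' t \<and> w \<in> Hom E t' x \<and> h \<cdot> w = y \<cdot> s"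
    if "is_cokernel E h e" "h \<in> Hom E x x'" "e \<in> Hom E x' x''" "y \<in> Hom E t x'" "e \<cdot> y = Zer E t x''"
    for h e x x' x'' y t
    using exactD[OF exact_of_cokernel[OF that(1-3)] that(2-5)] by blast
  have "short_exact E a'' u b'' v c''"
  proof (rule short_exactI[OF u(1) v(1)])
    show "monic E u"
    proof (rule monicI[OF u(1)])
      fix t y assume y: "y \<in> Hom E t a''" "u \<cdot> y = Zer E t b''"
      have to: "t \<in> Obj E" using Hom_Obj[OF y(1)] by blast
      obtain s1 r1 x where 1: "epic E r1" "r1 \<in> Hom E s1 t" "x \<in> Hom E s1 a'" "p \<cdot> x = y \<cdot> r1"
        using cover[OF ep(1) assms(15) y(1)] by blast
      have fx: "f' \<cdot> x \<in> Hom E s1 b'" using S(1) 1(3) by simp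
      have "q \<cdot> (f' \<cdot> x) = u \<cdot> (p \<cdot> x)" using Cmp_eq[OF u(2) 1(3) assms(15) u(1)] assms(16) S(1) 1(3) by simp
      also have "\<dots> = Zer E t b'' \<cdot> r1" unfolding 1(4) using Cmp_eq[OF y(2) 1(2) y(1) u(1)] .
      finally have "q \<cdot> (f' \<cdot> x) = Zer E s1 b''" using 1(2) o by simp
      then obtain s2 r2 w where 2: "epic E r2" "r2 \<in> Hom E s2 s1" "w \<in> Hom E s2 b" "\<beta> \<cdot> w = f' \<cdot> x \<cdot> r2"
        using imQ[OF assms(13,7,16) fx] by blast
      \<comment> \<open>As \<open>\<gamma>\<close> is monic, \<open>w\<close> dies in
        \<open>c\<close> and so comes from an element \<open>v'\<close> of \<open>a\<close>. Then
        \<open>x\<close> equals \<open>\<alpha> \<cdot> v'\<close> up to covers, which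
        \<open>p\<close> kills.\<close>
      have "\<gamma> \<cdot> (g \<cdot> w) = g' \<cdot> (\<beta> \<cdot> w)" using Cmp_eq[OF assms(11) 2(3) assms(7) S(2)] assms(4,8) 2(3) by simp
      also have "\<dots> = (g' \<cdot> f') \<cdot> (x \<cdot> r2)" unfolding 2(4) using S(1,2) 1(3) 2(2) by simp
      also have "\<dots> = Zer E s2 c'" unfolding S(7) using 1(3) 2(2) S(11) by simp
      finally have "g \<cdot> w = Zer E s2 c" using monic_Zer[OF assms(9) _ assms(8), of "g \<cdot> w" s2] assms(4) 2(3) by simp
      then obtain s3 r3 v' where 3: "epic E r3" "r3 \<in> Hom E s3 s2" "v' \<in> Hom E s3 a" "f \<cdot> v' = w \<cdot> r3"
        using exactD[OF assms(1,3,4) 2(3)] by blast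
      have "f' \<cdot> (\<alpha> \<cdot> v') = \<beta> \<cdot> (f \<cdot> v')" using Cmp_eq[OF assms(10) 3(3) assms(6) S(1)] 3(3) assms(3,7) by simp
      also have "\<dots> = (\<beta> \<cdot> w) \<cdot> r3" unfolding 3(4) using assms(7) 2(3) 3(2) by simp
      also have "\<dots> = f' \<cdot> (x \<cdot> r2 \<cdot> r3)" unfolding 2(4) using S(1) 1(3) 2(2) 3(2) by simp
      finally have e: "\<alpha> \<cdot> v' = x \<cdot> r2 \<cdot> r3"
        using monic_cancel[OF S(3) _ S(1), of "\<alpha> \<cdot> v'" "x \<cdot> r2 \<cdot> r3" s3] assms(6) 3(2,3) 1(3) 2(2) by simp
      have "y \<cdot> (r1 \<cdot> (r2 \<cdot> r3)) = (y \<cdot> r1) \<cdot> (r2 \<cdot> r3)" using y(1) 1(2) 2(2) 3(2) by simp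
      also have "\<dots> = p \<cdot> (x \<cdot> r2 \<cdot> r3)" unfolding 1(4)[symmetric] using assms(15) 1(3) 2(2) 3(2) by simp
      also have "\<dots> = Zer E a a'' \<cdot> v'" unfolding e[symmetric] using Cmp_eq[OF z(1) 3(3) assms(6,15)] .
      also have "\<dots> = Zer E s3 a''" using 3(3) o by simp
      finally have f1: "y \<cdot> (r1 \<cdot> (r2 \<cdot> r3)) = Zer E s3 a''" .
      have "r2 \<cdot> r3 \<in> Hom E s3 s1" "epic E (r2 \<cdot> r3)" using 2(2) 3(2) epic_Cmp[OF 3(1) 2(1) 3(2) 2(2)] by simp_all
      then have "epic E (r1 \<cdot> (r2 \<cdot> r3))" "r1 \<cdot> (r2 \<cdot> r3) \<in> Hom E s3 t" using epic_Cmp[OF _ 1(1) _ 1(2)] 1(2) by simp_all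
      then show "y = Zer E t a''" using epic_Zer[OF _ f1 _ y(1)] by blast
    qed
    show "epic E v" using epic_left_factor[OF _ assms(16) v(1)] v(2) epic_Cmp[OF S(4) ep(3) S(2) assms(17)] by simp
    have "(v \<cdot> u) \<cdot> p = v \<cdot> (q \<cdot> f')" using u v(1) assms(15,16) by simp
    also have "\<dots> = (r \<cdot> g') \<cdot> f'" using Cmp_eq[OF v(2) S(1) assms(16) v(1)] .
    also have "\<dots> = Zer E a' c''" using S(1,2,7,9) assms(17) by simp
    finally show "v \<cdot> u = Zer E a'' c''" using epic_Zer[OF ep(1) _ assms(15), of "v \<cdot> u" c''] u(1) v(1) by simp
    fix t y assume y: "y \<in> Hom E t b''" "v \<cdot> y = Zer E t c''"
    have to: "t \<in> Obj E" using Hom_Obj[OF y(1)] by blast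
    obtain s1 r1 x where 1: "epic E r1" "r1 \<in> Hom E s1 t" "x \<in> Hom E s1 b'" "q \<cdot> x = y \<cdot> r1"
      using cover[OF ep(2) assms(16) y(1)] by blast
    have gx: "g' \<cdot> x \<in> Hom E s1 c'" using S(2) 1(3) by simp
    have "r \<cdot> (g' \<cdot> x) = v \<cdot> (q \<cdot> x)" using Cmp_eq[OF v(2) 1(3) assms(16) v(1)] assms(17) S(2) 1(3) by simp
    also have "\<dots> = Zer E t c'' \<cdot> r1" unfolding 1(4) using Cmp_eq[OF y(2) 1(2) y(1) v(1)] .
    finally have "r \<cdot> (g' \<cdot> x) = Zer E s1 c''" using 1(2) o by simp
    then obtain s2 r2 w where 2: "epic E r2" "r2 \<in> Hom E s2 s1" "w \<in> Hom E s2 c" "\<gamma> \<cdot> w = g' \<cdot> x \<cdot> r2"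
      using imQ[OF assms(14,8,17) gx] by blast
    obtain s3 r3 w' where 3: "epic E r3" "r3 \<in> Hom E s3 s2" "w' \<in> Hom E s3 b" "g \<cdot> w' = w \<cdot> r3"
      using cover[OF assms(2,4) 2(3)] by blast
    \<comment> \<open>The elements \<open>x\<close> and \<open>\<beta> \<cdot> w'\<close> agree in
      \<open>c'\<close>, so they differ by some \<open>n\<close> from \<open>a'\<close>. Since
      \<open>q\<close> kills \<open>\<beta> \<cdot> w'\<close>, the class of \<open>n\<close> is the
      preimage sought.\<close>
    have "g' \<cdot> (\<beta> \<cdot> w') = \<gamma> \<cdot> (g \<cdot> w')" using Cmp_eq[OF assms(11) 3(3) assms(7) S(2)] 3(3) assms(4,8) by simp
    also have "\<dots> = (\<gamma> \<cdot> w) \<cdot> r3" unfolding 3(4) using assms(8) 2(3) 3(2) by simp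
    also have "\<dots> = g' \<cdot> (x \<cdot> r2 \<cdot> r3)" unfolding 2(4) using S(2) 1(3) 2(2) 3(2) by simp
    finally have "g' \<cdot> (x \<cdot> r2 \<cdot> r3) = g' \<cdot> (\<beta> \<cdot> w')" by simp
    moreover have bw: "\<beta> \<cdot> w' \<in> Hom E s3 b'" "x \<cdot> r2 \<cdot> r3 \<in> Hom E s3 b'" using assms(7) 3(2,3) 1(3) 2(2) by simp_all
    ultimately obtain n where n: "n \<in> Hom E s3 a'" "x \<cdot> r2 \<cdot> r3 = \<beta> \<cdot> w' \<boxplus> f' \<cdot> n"
      using kernel_diff[OF S(5,2,1)] by blast
    have "y \<cdot> (r1 \<cdot> (r2 \<cdot> r3)) = (y \<cdot> r1) \<cdot> (r2 \<cdot> r3)" using y(1) 1(2) 2(2) 3(2) by simp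
    also have "\<dots> = q \<cdot> (x \<cdot> r2 \<cdot> r3)" unfolding 1(4)[symmetric] using assms(16) 1(3) 2(2) 3(2) by simp
    also have "\<dots> = q \<cdot> (\<beta> \<cdot> w') \<boxplus> q \<cdot> (f' \<cdot> n)" unfolding n(2) using assms(16) bw(1) S(1) n(1) by (simp del: Cmp_assoc_right)
    also have "q \<cdot> (\<beta> \<cdot> w') = Zer E s3 b''" using Cmp_eq[OF z(2) 3(3) assms(7,16)] 3(3) o by simp
    also have "q \<cdot> (f' \<cdot> n) = u \<cdot> (p \<cdot> n)" using Cmp_eq[OF u(2) n(1) assms(15) u(1)] assms(16) S(1) n(1) by simp
    finally have e: "u \<cdot> (p \<cdot> n) = y \<cdot> (r1 \<cdot> (r2 \<cdot> r3))" using u(1) assms(15) n(1) by simp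
    have "r2 \<cdot> r3 \<in> Hom E s3 s1" "epic E (r2 \<cdot> r3)" using 2(2) 3(2) epic_Cmp[OF 3(1) 2(1) 3(2) 2(2)] by simp_all
    then have "epic E (r1 \<cdot> (r2 \<cdot> r3))" "r1 \<cdot> (r2 \<cdot> r3) \<in> Hom E s3 t" using epic_Cmp[OF _ 1(1) _ 1(2)] 1(2) by simp_all
    then show "\<exists>s r x. epic E r \<and> r \<in> Hom E s t \<and> x \<in> Hom E s a'' \<and> u \<cdot> x = y \<cdot> r"
      using e n(1) assms(15) by (intro exI[of _ s3] exI[of _ "r1 \<cdot> (r2 \<cdot> r3)"] exI[of _ "p \<cdot> n"]) simp
  qed
  then show ?thesis by blast
qed

end

section \<open>Projective resolutions and Ext\<close>

lemma (in comm_group) trivial_factor_iff: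
  assumes "subgroup B G"
  shows "trivial_group (G Mod B) \<longleftrightarrow> B = carrier G"
proof
  interpret subgroup B G by fact
  assume "trivial_group (G Mod B)"
  then have B: "rcosets B = {B}" unfolding trivial_group_def FactGroup_def by simp
  have "x \<in> B" if "x \<in> carrier G" for x
  proof -
    have "B #> x \<in> rcosets B" using that unfolding RCOSETS_def by blast
    then show ?thesis using B coset_join1[OF _ that assms] by blast
  qed
  then show "B = carrier G" using subset by blast
next
  assume B: "B = carrier G"
  interpret normal B G using normal_iff_subgroup assms by blast
  have "rcosets B = {B}"
    unfolding RCOSETS_def using coset_join2[OF _ assms] one_closed B by auto
  then show "trivial_group (G Mod B)"
    using factorgroup_is_group unfolding trivial_group_def by (simp add: FactGroup_def)
qed

context additive_category
begin

lemma Hom_group_subgroup: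
  assumes "Z \<subseteq> Hom E a b" "Zer E a b \<in> Z" "\<And>f g. \<lbrakk>f \<in> Z; g \<in> Z\<rbrakk> \<Longrightarrow> f \<boxplus> g \<in> Z"
    "\<And>f. f \<in> Z \<Longrightarrow> Neg f \<in> Z" "a \<in> Obj E" "b \<in> Obj E"
  shows "subgroup Z (Hom_group E a b)"
proof -
  interpret comm_group "Hom_group E a b" using Hom_comm_group[OF assms(5,6)] .
  have inv: "inv\<^bsub>Hom_group E a b\<^esub> f = Neg f" if "f \<in> Z" for f
  proof -
    have "Dom E f = a" "Cod E f = b" using that assms(1) by auto
    then show ?thesis unfolding Neg_def by simp
  qed
  show ?thesis
    by (rule subgroupI) (use assms inv in \<open>auto simp: Hom_group_def\<close>)
qed

end

context abelian_category
begin

text \<open>Exactness depends only on the image of the first arrow and the kernel of the second.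
  With \<open>exact_at_monic_iff\<close> this cuts long exact sequences into short ones and splices
  them back.\<close>

lemma exact_at_epic_iff:
  assumes "epic E e" "e \<in> Hom E z a" "f \<in> Hom E a b" "g \<in> Hom E b c"
  shows "exact_at E (f \<cdot> e) g \<longleftrightarrow> exact_at E f g"
proof
  have fe: "f \<cdot> e \<in> Hom E z b" using assms by simp
  {
    assume ex: "exact_at E (f \<cdot> e) g"
    show "exact_at E f g"
    proof (rule exactI[OF assms(3,4)])
      have "(g \<cdot> f) \<cdot> e = Zer E z c" using exact_zero[OF ex fe assms(4)] assms by simp
      then show "g \<cdot> f = Zer E a c" using epic_Zer[OF assms(1) _ assms(2), of "g \<cdot> f" c] assms by simp
      fix t y assume "y \<in> Hom E t b" "g \<cdot> y = Zer E t c"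
      then obtain s r x where "epic E r" "r \<in> Hom E s t" "x \<in> Hom E s z" "f \<cdot> e \<cdot> x = y \<cdot> r"
        using exactD[OF ex fe assms(4)] by blast
      then show "\<exists>s r x. epic E r \<and> r \<in> Hom E s t \<and> x \<in> Hom E s a \<and> f \<cdot> x = y \<cdot> r"
        using assms by (intro exI[of _ s] exI[of _ r] exI[of _ "e \<cdot> x"]) simp
    qed
  next
    assume ex: "exact_at E f g"
    show "exact_at E (f \<cdot> e) g"
    proof (rule exactI[OF fe assms(4)])
      show "g \<cdot> (f \<cdot> e) = Zer E z c"
        using Cmp_eq[OF exact_zero[OF ex assms(3,4)] assms(2-4)] assms(2) Hom_Obj[OF assms(4)] by simp
      fix t y assume "y \<in> Hom E t b" "g \<cdot> y = Zer E t c"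
      then obtain s r x where r: "epic E r" "r \<in> Hom E s t" "x \<in> Hom E s a" "f \<cdot> x = y \<cdot> r" "y \<in> Hom E t b"
        using exactD[OF ex assms(3,4)] by blast
      obtain s' r' x' where r': "epic E r'" "r' \<in> Hom E s' s" "x' \<in> Hom E s' z" "e \<cdot> x' = x \<cdot> r'"
        using cover[OF assms(1,2) r(3)] by blast
      have "f \<cdot> e \<cdot> x' = f \<cdot> (x \<cdot> r')" using assms r' by simp
      also have "\<dots> = y \<cdot> (r \<cdot> r')" using Cmp_eq[OF r(4) r'(2) r(3) assms(3)] r r' by simp
      finally show "\<exists>s r x. epic E r \<and> r \<in> Hom E s t \<and> x \<in> Hom E s z \<and> f \<cdot> e \<cdot> x = y \<cdot> r"
        using epic_Cmp[OF r'(1) r(1) r'(2) r(2)] r' r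
        by (intro exI[of _ s'] exI[of _ "r \<cdot> r'"] exI[of _ x']) simp
    qed
  }
qed

lemma exact_at_monic_iff:
  assumes "monic E m" "m \<in> Hom E c d" "f \<in> Hom E a b" "g \<in> Hom E b c"
  shows "exact_at E f (m \<cdot> g) \<longleftrightarrow> exact_at E f g"
proof -
  have mg: "m \<cdot> g \<in> Hom E b d" using assms by simp
  have z: "g \<cdot> y = Zer E t c \<longleftrightarrow> m \<cdot> g \<cdot> y = Zer E t d" if y: "y \<in> Hom E t b" for t y
    using monic_Zer[OF assms(1) _ assms(2), of "g \<cdot> y" t] y assms(2,4) Hom_Obj[OF y] by auto
  show ?thesis
  proof
    assume ex: "exact_at E f (m \<cdot> g)"
    show "exact_at E f g"
      using exactI[OF assms(3,4) z[OF assms(3), THEN iffD2, OF exact_zero[OF ex assms(3) mg]]]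
        exactD[OF ex assms(3) mg] z by blast
  next
    assume ex: "exact_at E f g"
    show "exact_at E f (m \<cdot> g)"
      using exactI[OF assms(3) mg z[OF assms(3), THEN iffD1, OF exact_zero[OF ex assms(3,4)]]]
        exactD[OF ex assms(3,4)] z by blast
  qed
qed

lemma short_exact_of_exact_monic:
  assumes "exact_at E f g" "monic E f" "epic E g" "f \<in> Hom E a b" "g \<in> Hom E b c"
  shows "short_exact E a f b g c"
  using assms by (simp add: short_exact_def)

lemma ex_projective_presentation:
  assumes "enough_projectives E" "a \<in> Obj E"
  shows "\<exists>k f p g. short_exact E k f p g a \<and> projective E p"
proof -
  obtain p g where p: "projective E p" "g \<in> Hom E p a" "epic E g"
    using assms unfolding enough_projectives_def by blast
  then obtain k f where "f \<in> Hom E k p" "is_kernel E g f" using ex_kernel_Hom by blast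
  then show ?thesis using short_exact_of_kernel p by blast
qed

lemma ex_proj_resolution:
  assumes "enough_projectives E" "a \<in> Obj E"
  shows "\<exists>P d e. proj_resolution E a P d e"
proof -
  have "\<forall>b. \<exists>k f p g. b \<in> Obj E \<longrightarrow> short_exact E k f p g b \<and> projective E p"
    using ex_projective_presentation[OF assms(1)] by blast
  then obtain k f p g where ses: "\<And>b. b \<in> Obj E \<Longrightarrow> short_exact E (k b) (f b) (p b) (g b) b \<and> projective E (p b)"
    by metis
  \<comment> \<open>\<open>K n\<close> is the \<open>n\<close>-th syzygy of \<open>a\<close>;
    splicing its presentations gives the resolution.\<close>
  define K where "K n = (k ^^ n) a" for n
  have K: "K 0 = a" "K (Suc n) = k (K n)" for n unfolding K_def by simp_all
  have KO: "K n \<in> Obj E" for n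
  proof (induction n)
    case (Suc n)
    then show ?case using short_exactD(9) ses K(2) by metis
  qed (simp add: K(1) assms(2))
  have S: "short_exact E (K (Suc n)) (f (K n)) (p (K n)) (g (K n)) (K n)" "projective E (p (K n))" for n
    using ses[OF KO[of n]] K(2)[of n] by simp_all
  define d where "d n = f (K n) \<cdot> g (K (Suc n))" for n
  have d: "d n \<in> Hom E (p (K (Suc n))) (p (K n))" for n
    unfolding d_def using short_exactD(1)[OF S(1)[of n]] short_exactD(2)[OF S(1)[of "Suc n"]] by simp
  have ex: "exact_at E (d n) (g (K n))" for n
    unfolding d_def
    using exact_at_epic_iff[OF short_exactD(4,2)[OF S(1)[of "Suc n"]] short_exactD(1,2)[OF S(1)[of n]]]
      short_exactD(8)[OF S(1)[of n]] by blast
  have ex': "exact_at E (d (Suc n)) (d n)" for n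
    unfolding d_def[of n]
    using exact_at_monic_iff[OF short_exactD(3,1)[OF S(1)[of n]] d[of "Suc n"] short_exactD(2)[OF S(1)[of "Suc n"]]]
      ex[of "Suc n"] by blast
  have "proj_resolution E a (\<lambda>n. p (K n)) d (g (K 0))"
    unfolding proj_resolution_def using S(2) d ex[of 0] ex' short_exactD(2,4)[OF S(1)[of 0]] K(1) by simp
  then show ?thesis by blast
qed

lemma chosen_resolution:
  assumes "enough_projectives E" "a \<in> Obj E"
  shows "\<exists>P d e. chosen_resolution E a = (P, d, e) \<and> proj_resolution E a P d e"
proof -
  have "\<exists>x. case x of (P, d, e) \<Rightarrow> proj_resolution E a P d e"
    using ex_proj_resolution[OF assms] by auto
  then have "case chosen_resolution E a of (P, d, e) \<Rightarrow> proj_resolution E a P d e"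
    unfolding chosen_resolution_def by (rule someI_ex)
  then show ?thesis by (cases "chosen_resolution E a") auto
qed

text \<open>The syzygies are the images of the differentials, obtained by factoring each
  \<open>d n\<close> into an epi followed by a mono.\<close>

lemma proj_resolution_syzygies:
  assumes "proj_resolution E a P d e"
  shows "\<exists>K i q. K 0 = a \<and> (\<forall>n. short_exact E (K (Suc n)) (i n) (P n) (q n) (K n)) \<and>
    (\<forall>n. d n = i n \<cdot> q (Suc n)) \<and> (\<forall>n. projective E (P n))"
proof -
  have R: "\<And>n. projective E (P n)" "\<And>n. d n \<in> Hom E (P (Suc n)) (P n)" "e \<in> Hom E (P 0) a" "epic E e"
    "exact_at E (d 0) e" "\<And>n. exact_at E (d (Suc n)) (d n)"
    using assms unfolding proj_resolution_def by blast+
  have "\<forall>n. \<exists>I m h. epic E h \<and> monic E m \<and> h \<in> Hom E (P (Suc n)) I \<and> m \<in> Hom E I (P n) \<and> m \<cdot> h = d n"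
    using factor[OF R(2)] by blast
  then obtain I m h where f: "\<And>n. epic E (h n)" "\<And>n. monic E (m n)" "\<And>n. h n \<in> Hom E (P (Suc n)) (I n)"
    "\<And>n. m n \<in> Hom E (I n) (P n)" "\<And>n. m n \<cdot> h n = d n" by metis
  have 0: "short_exact E (I 0) (m 0) (P 0) e a"
    using short_exact_of_exact_monic[OF _ f(2) R(4) f(4) R(3)] exact_at_epic_iff[OF f(1,3,4) R(3)] R(5) f(5)
    by metis
  have 1: "short_exact E (I (Suc n)) (m (Suc n)) (P (Suc n)) (h n) (I n)" for n
  proof -
    have "exact_at E (m (Suc n) \<cdot> h (Suc n)) (m n \<cdot> h n)" using R(6) f(5) by simp
    then have "exact_at E (m (Suc n) \<cdot> h (Suc n)) (h n)"
      using exact_at_monic_iff[OF f(2,4) _ f(3)] R(2) f(5) by metis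
    then have "exact_at E (m (Suc n)) (h n)" using exact_at_epic_iff[OF f(1,3,4,3)] by blast
    then show ?thesis using short_exact_of_exact_monic[OF _ f(2,1,4,3)] by blast
  qed
  show ?thesis
    \<comment> \<open>The index shifts by one: the image \<open>I n\<close> of \<open>d n\<close> is
      the syzygy number \<open>n + 1\<close>, while number \<open>0\<close> is \<open>a\<close> with
      the augmentation \<open>e\<close> as its cover.\<close>
    by (rule exI[of _ "case_nat a I"], rule exI[of _ m], rule exI[of _ "case_nat e h"])
      (use 0 1 f(5) R(1) in \<open>auto split: nat.splits\<close>)
qed

lemma syz_iff_syzygies:
  assumes "stable_under_projectives E \<Phi>"
    and S: "\<And>n. short_exact E (K (Suc n)) (i n) (P n) (q n) (K n)" "\<And>n. projective E (P n)"
  shows "syz E \<Phi> j (K n) \<longleftrightarrow> \<Phi> (K (n + j))"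
proof (induction j arbitrary: n)
  case (Suc j)
  have "syz E \<Phi> (Suc j) (K n) \<longleftrightarrow> syz E \<Phi> j (K (Suc n))"
  proof
    show "syz E \<Phi> j (K (Suc n))" if "syz E \<Phi> (Suc j) (K n)"
      using syz_any_presentation[OF assms(1) that S(1)[of n] S(2)[of n]] .
    show "syz E \<Phi> (Suc j) (K n)" if "syz E \<Phi> j (K (Suc n))"
      using that S(1)[of n] S(2)[of n] unfolding syz.simps by blast
  qed
  then show ?case using Suc[of "Suc n"] by simp
qed simp

text \<open>A cocycle in degree \<open>Suc j\<close> is an arrow on \<open>P (Suc j)\<close> that
  factors through the epi onto the syzygy \<open>K (Suc j)\<close>; it is a coboundary exactly when
  the factored arrow extends along \<open>i j\<close>.\<close>

lemma Ext_trivial_iff: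
  assumes "chosen_resolution E a = (P, d, e)" "b \<in> Obj E"
    and S: "\<And>n. short_exact E (K (Suc n)) (i n) (P n) (q n) (K n)" and dn: "\<And>n. d n = i n \<cdot> q (Suc n)"
  shows "trivial_group (Ext E (Suc j) a b) \<longleftrightarrow> (\<forall>\<phi>\<in>Hom E (K (Suc j)) b. \<exists>\<psi>\<in>Hom E (P j) b. \<psi> \<cdot> i j = \<phi>)"
proof -
  note Sd = short_exactD[OF S]
  define Z where "Z = Hom_cocycles E P d (Suc j) b"
  define B where "B = Hom_coboundaries E P d (Suc j) b"
  have Po: "P n \<in> Obj E" for n using Sd(10) .
  have d: "d n \<in> Hom E (P (Suc n)) (P n)" for n unfolding dn using Sd(1)[of n] Sd(2)[of "Suc n"] by simp
  have Zm: "h \<in> Z \<longleftrightarrow> h \<in> Hom E (P (Suc j)) b \<and> h \<cdot> d (Suc j) = Zer E (P (Suc (Suc j))) b" for h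
    unfolding Z_def Hom_cocycles_def by simp
  have Bm: "h \<in> B \<longleftrightarrow> (\<exists>k\<in>Hom E (P j) b. h = k \<cdot> d j)" for h
    unfolding B_def Hom_coboundaries_def by auto
  have BZ: "B \<subseteq> Z"
  proof
    fix h assume "h \<in> B"
    then obtain k where k: "k \<in> Hom E (P j) b" "h = k \<cdot> d j" using Bm by blast
    have "d j \<cdot> d (Suc j) = i j \<cdot> (q (Suc j) \<cdot> i (Suc j)) \<cdot> q (Suc (Suc j))"
      unfolding dn using Sd(1)[of j] Sd(1)[of "Suc j"] Sd(2)[of "Suc j"] Sd(2)[of "Suc (Suc j)"] by simp
    also have "\<dots> = Zer E (P (Suc (Suc j))) (P j)"
      unfolding Sd(7) using Sd(1)[of j] Sd(2)[of "Suc (Suc j)"] Sd(9)[of "Suc j"] Po by simp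
    finally have "d j \<cdot> d (Suc j) = Zer E (P (Suc (Suc j))) (P j)" .
    then show "h \<in> Z" unfolding Zm k(2) using k(1) d[of j] d[of "Suc j"] Po by simp
  qed
  interpret G: comm_group "Hom_group E (P (Suc j)) b" using Hom_comm_group[OF Po assms(2)] .
  have subZ: "subgroup Z (Hom_group E (P (Suc j)) b)"
    by (rule Hom_group_subgroup[OF _ _ _ _ Po assms(2)])
      (use Zm d[of "Suc j"] Po assms(2) in auto)
  have subB: "subgroup B (Hom_group E (P (Suc j)) b)"
  proof (rule Hom_group_subgroup[OF _ _ _ _ Po assms(2)])
    show "B \<subseteq> Hom E (P (Suc j)) b" using BZ Zm by blast
    show "Zer E (P (Suc j)) b \<in> B" unfolding Bm
      by (rule bexI[of _ "Zer E (P j) b"]) (use d[of j] Po assms(2) in simp_all)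
    fix f assume "f \<in> B"
    then obtain k where k: "k \<in> Hom E (P j) b" "f = k \<cdot> d j" using Bm by blast
    show "Neg f \<in> B" unfolding Bm k(2) by (rule bexI[of _ "Neg k"]) (use k(1) d[of j] in simp_all)
    fix g assume "g \<in> B"
    then obtain l where l: "l \<in> Hom E (P j) b" "g = l \<cdot> d j" using Bm by blast
    show "f \<boxplus> g \<in> B" unfolding Bm k(2) l(2) by (rule bexI[of _ "k \<boxplus> l"]) (use k(1) l(1) d[of j] in simp_all)
  qed
  let ?H = "(Hom_group E (P (Suc j)) b)\<lparr>carrier := Z\<rparr>"
  have H: "comm_group ?H"
    by (rule group.group_comm_groupI[OF subgroup.subgroup_is_group[OF subZ G.group_axioms]])
      (use G.m_comm subgroup.subset[OF subZ] in auto)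
  have "subgroup B ?H" using G.subgroup_incl[OF subB subZ BZ] .
  then have "trivial_group (?H Mod B) \<longleftrightarrow> B = Z" using comm_group.trivial_factor_iff[OF H] by simp
  then have 1: "trivial_group (Ext E (Suc j) a b) \<longleftrightarrow> Z \<subseteq> B"
    unfolding Ext_def assms(1) Z_def B_def using BZ[unfolded Z_def B_def] by auto
  have q0: "q (Suc j) \<cdot> d (Suc j) = Zer E (P (Suc (Suc j))) (K (Suc j))"
    unfolding dn using Cmp_eq[OF Sd(7)[of "Suc j"] Sd(2)[of "Suc (Suc j)"] Sd(1)[of "Suc j"] Sd(2)[of "Suc j"]] Sd(2)[of "Suc (Suc j)"] Sd(9)[of j] by simp
  show ?thesis
    unfolding 1
  proof (intro iffI ballI subsetI)
    fix \<phi> assume ZB: "Z \<subseteq> B" and \<phi>: "\<phi> \<in> Hom E (K (Suc j)) b"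
    have "\<phi> \<cdot> q (Suc j) \<in> Z"
      unfolding Zm using q0 \<phi> Sd(2)[of "Suc j"] d[of "Suc j"] Po by simp
    then obtain k where k: "k \<in> Hom E (P j) b" "\<phi> \<cdot> q (Suc j) = k \<cdot> d j" using ZB Bm by blast
    have "(k \<cdot> i j) \<cdot> q (Suc j) = \<phi> \<cdot> q (Suc j)"
      unfolding k(2) dn using k(1) Sd(1)[of j] Sd(2)[of "Suc j"] by simp
    then have "k \<cdot> i j = \<phi>"
      using epic_cancel[OF Sd(4)[of "Suc j"] _ Sd(2)[of "Suc j"], of "k \<cdot> i j" \<phi> b] k(1) Sd(1)[of j] \<phi> by simp
    then show "\<exists>\<psi>\<in>Hom E (P j) b. \<psi> \<cdot> i j = \<phi>" using k(1) by blast
  next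
    fix h assume ext: "\<forall>\<phi>\<in>Hom E (K (Suc j)) b. \<exists>\<psi>\<in>Hom E (P j) b. \<psi> \<cdot> i j = \<phi>" and "h \<in> Z"
    then have h: "h \<in> Hom E (P (Suc j)) b" "h \<cdot> d (Suc j) = Zer E (P (Suc (Suc j))) b" using Zm by auto
    have "(h \<cdot> i (Suc j)) \<cdot> q (Suc (Suc j)) = Zer E (P (Suc (Suc j))) b"
      using h Sd(1)[of "Suc j"] Sd(2)[of "Suc (Suc j)"] unfolding dn by simp
    then have "h \<cdot> i (Suc j) = Zer E (K (Suc (Suc j))) b"
      using epic_Zer[OF Sd(4)[of "Suc (Suc j)"] _ Sd(2)[of "Suc (Suc j)"], of "h \<cdot> i (Suc j)" b] h(1) Sd(1)[of "Suc j"] by simp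
    then obtain \<phi> where \<phi>: "\<phi> \<in> Hom E (K (Suc j)) b" "\<phi> \<cdot> q (Suc j) = h"
      using short_exact_cokernel_lift[OF S h(1)] by blast
    then obtain \<psi> where \<psi>: "\<psi> \<in> Hom E (P j) b" "\<psi> \<cdot> i j = \<phi>" using ext by blast
    have "\<psi> \<cdot> d j = h"
      unfolding dn using Cmp_eq[OF \<psi>(2) Sd(2)[of "Suc j"] Sd(1) \<psi>(1)] \<phi>(2) by simp
    then show "h \<in> B" unfolding Bm using \<psi>(1) by blast
  qed
qed

lemma Ext_trivial_iff_syzygy:
  assumes "enough_projectives E" "a \<in> Obj E" "b \<in> Obj E"
  shows "\<exists>P d e K i q. chosen_resolution E a = (P, d, e) \<and> K 0 = a \<and>
    (\<forall>n. short_exact E (K (Suc n)) (i n) (P n) (q n) (K n)) \<and>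
    (\<forall>n. d n = i n \<cdot> q (Suc n)) \<and> (\<forall>n. projective E (P n)) \<and>
    (\<forall>j. trivial_group (Ext E (Suc j) a b) \<longleftrightarrow> ext1_zero b (K j))"
proof -
  obtain P d e where R: "chosen_resolution E a = (P, d, e)" "proj_resolution E a P d e"
    using chosen_resolution[OF assms(1,2)] by blast
  obtain K i q where S: "K 0 = a" "\<And>n. short_exact E (K (Suc n)) (i n) (P n) (q n) (K n)"
    "\<And>n. d n = i n \<cdot> q (Suc n)" "\<And>n. projective E (P n)"
    using proj_resolution_syzygies[OF R(2)] by blast
  have "trivial_group (Ext E (Suc j) a b) \<longleftrightarrow> ext1_zero b (K j)" for j
    unfolding Ext_trivial_iff[OF R(1) assms(3) S(2,3)]
    using ext1_zeroD[OF _ S(2)[of j]] ext1_zero_of_presentation[OF S(2)[of j] S(4)] by blast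
  then show ?thesis using R S by blast
qed

text \<open>The chosen resolution disappears here: from now on degree \<open>Suc j\<close> is
  handled as the first degree on an arbitrary \<open>j\<close>-th syzygy.\<close>

lemma syz_ext1_zero_iff:
  assumes "enough_projectives E" "a \<in> Obj E" "b \<in> Obj E"
  shows "trivial_group (Ext E (Suc j) a b) \<longleftrightarrow> syz E (ext1_zero b) j a"
proof -
  obtain P d e K i q where S: "K 0 = a" "\<And>n. short_exact E (K (Suc n)) (i n) (P n) (q n) (K n)"
    "\<And>n. projective E (P n)" "\<And>j. trivial_group (Ext E (Suc j) a b) \<longleftrightarrow> ext1_zero b (K j)"
    using Ext_trivial_iff_syzygy[OF assms] by blast
  show ?thesis using syz_iff_syzygies[of "ext1_zero b" K i P q j 0, OF ext1_zero_stable S(2,3)] S(1,4) by simp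
qed

end

section \<open>Finite coresolutions\<close>

lemma additive_subcategoryD:
  assumes "additive_subcategory E M"
  shows "M \<subseteq> Obj E" "\<lbrakk>a \<in> M; b \<in> Obj E; isomorphic_objects E a b\<rbrakk> \<Longrightarrow> b \<in> M"
    "\<lbrakk>a \<in> M; b \<in> M; s \<in> Obj E; is_direct_sum E a b s\<rbrakk> \<Longrightarrow> s \<in> M"
  using assms unfolding additive_subcategory_def by blast+

context abelian_category
begin

lemma monic_of_exact_zero:
  assumes "exact_at E f g" "f \<in> Hom E z a" "g \<in> Hom E a b" "is_zero_object E z"
  shows "monic E g"
proof (rule monicI[OF assms(3)])
  have f: "f = Zer E z a" using from_zero[OF assms(4,2)] .
  fix t y assume y: "y \<in> Hom E t a" "g \<cdot> y = Zer E t b"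
  obtain s r x where r: "epic E r" "r \<in> Hom E s t" "x \<in> Hom E s z" "f \<cdot> x = y \<cdot> r"
    using exactD[OF assms(1-3) y] by blast
  have "y \<cdot> r = Zer E s a" using r(3) Hom_Obj[OF assms(3)] unfolding r(4)[symmetric] f by simp
  then show "y = Zer E t a" using epic_Zer[OF r(1) _ r(2) y(1)] by blast
qed

lemma epic_of_exact_zero:
  assumes "exact_at E f g" "f \<in> Hom E a b" "g \<in> Hom E b z" "is_zero_object E z"
  shows "epic E f"
proof -
  have b: "b \<in> Obj E" using Hom_Obj[OF assms(2)] by blast
  have "g = Zer E b z" using to_zero[OF assms(4,3)] .
  then have "g \<cdot> Idt E b = Zer E b z" using assms(3) by simp
  then obtain s r x where r: "epic E r" "r \<in> Hom E s b" "x \<in> Hom E s a" "f \<cdot> x = Idt E b \<cdot> r"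
    using exactD[OF assms(1-3) Idt_Hom[OF b]] by blast
  then have "epic E (f \<cdot> x)" by simp
  then show ?thesis using epic_left_factor[OF _ r(3) assms(2)] by blast
qed

lemma exact_zero_of_monic:
  assumes "monic E g" "g \<in> Hom E a b" "z \<in> Obj E"
  shows "exact_at E (Zer E z a) g"
proof -
  have a: "a \<in> Obj E" using Hom_Obj[OF assms(2)] by blast
  show ?thesis
  proof (rule exactI[OF _ assms(2)])
    show "Zer E z a \<in> Hom E z a" "g \<cdot> Zer E z a = Zer E z b" using assms a by simp_all
    fix t y assume y: "y \<in> Hom E t a" "g \<cdot> y = Zer E t b"
    have t: "t \<in> Obj E" using Hom_Obj[OF y(1)] by blast
    have "y = Zer E t a" using monic_Zer[OF assms(1) y(2) assms(2) y(1)] .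
    then show "\<exists>s r x. epic E r \<and> r \<in> Hom E s t \<and> x \<in> Hom E s z \<and> Zer E z a \<cdot> x = y \<cdot> r"
      using t a assms(3) epic_Idt[OF t]
      by (intro exI[of _ t] exI[of _ "Idt E t"] exI[of _ "Zer E t z"]) simp
  qed
qed

lemma exact_zero_of_epic:
  assumes "epic E f" "f \<in> Hom E a b" "z \<in> Obj E"
  shows "exact_at E f (Zer E b z)"
proof -
  have a: "b \<in> Obj E" "a \<in> Obj E" using Hom_Obj[OF assms(2)] by blast+
  show ?thesis
  proof (rule exactI[OF assms(2)])
    show "Zer E b z \<in> Hom E b z" "Zer E b z \<cdot> f = Zer E a z" using assms a by simp_all
    fix t y assume y: "y \<in> Hom E t b"
    show "\<exists>s r x. epic E r \<and> r \<in> Hom E s t \<and> x \<in> Hom E s a \<and> f \<cdot> x = y \<cdot> r"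
      using cover[OF assms(1,2) y] .
  qed
qed

text \<open>A sequence with a single term is an isomorphism from \<open>N\<close> to that term, and
  the class is closed under isomorphisms.\<close>

lemma finite_coresolved_0:
  assumes "additive_subcategory E M"
  shows "finite_coresolved E 0 M = M"
proof (intro equalityI subsetI)
  fix N assume "N \<in> finite_coresolved E 0 M"
  then obtain X f where X': "is_zero_object E (X (0::nat))" "X 1 = N" "\<And>j. j \<le> 0 \<Longrightarrow> X (j + 2) \<in> M"
      "is_zero_object E (X (0 + 3))"
    and f: "\<And>j. j \<le> 0 + 2 \<Longrightarrow> f j \<in> Hom E (X j) (X (j + 1))"
      "\<And>j. j \<le> 0 + 1 \<Longrightarrow> exact_at E (f j) (f (j + 1))"
    unfolding finite_coresolved_def by blast
  have X: "is_zero_object E (X 0)" "X 1 = N" "X 2 \<in> M" "is_zero_object E (X 3)"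
    using X'(1,2,4) X'(3)[of 0] by (simp_all add: numeral_eq_Suc)
  have h: "f 0 \<in> Hom E (X 0) (X 1)" "f 1 \<in> Hom E (X 1) (X 2)" "f 2 \<in> Hom E (X 2) (X 3)"
    using f(1)[of 0] f(1)[of 1] f(1)[of 2] by (simp_all add: numeral_eq_Suc)
  have e: "exact_at E (f 0) (f 1)" "exact_at E (f 1) (f 2)"
    using f(2)[of 0] f(2)[of 1] by (simp_all add: numeral_eq_Suc)
  have 1: "monic E (f 1)" using monic_of_exact_zero[OF e(1) h(1,2) X(1)] .
  have 2: "epic E (f 1)" using epic_of_exact_zero[OF e(2) h(2,3) X(4)] .
  obtain g where "g \<in> Hom E (X 2) (X 1)" "g \<cdot> f 1 = Idt E (X 1)" "f 1 \<cdot> g = Idt E (X 2)"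
    using monic_epic_iso[OF 1 2 h(2)] by blast
  then have "isomorphic_objects E (X 2) (X 1)" unfolding isomorphic_objects_def using h(2) by blast
  then show "N \<in> M" using additive_subcategoryD(2)[OF assms X(3)] Hom_Obj[OF h(2)] X(2) by blast
next
  fix N assume N: "N \<in> M"
  then have NO: "N \<in> Obj E" using additive_subcategoryD(1)[OF assms] by blast
  obtain z where z: "is_zero_object E z" using ex_zero_object by blast
  then have zO: "z \<in> Obj E" by (simp add: is_zero_object_def)
  define X where "X n = (if n = 1 \<or> n = 2 then N else z)" for n :: nat
  define f where "f n = (if n = 0 then Zer E z N else if n = 1 then Idt E N else Zer E N z)" for n :: nat
  show "N \<in> finite_coresolved E 0 M"
    unfolding finite_coresolved_def
  proof (intro CollectI exI conjI allI impI)
    show "is_zero_object E (X 0)" "X 1 = N" "is_zero_object E (X (0 + 3))" using z unfolding X_def by simp_all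
    fix j :: nat
    show "j \<le> 0 \<Longrightarrow> X (j + 2) \<in> M" using N unfolding X_def by simp
    {
      assume "j \<le> 0 + 2"
      then consider "j = 0" | "j = 1" | "j = 2" by linarith
      then show "f j \<in> Hom E (X j) (X (j + 1))" by cases (use zO NO in \<open>simp_all add: f_def X_def\<close>)
    }
    assume "j \<le> 0 + 1"
    then consider "j = 0" | "j = 1" by linarith
    then show "exact_at E (f j) (f (j + 1))"
      by cases (use exact_zero_of_monic[OF monic_Idt Idt_Hom zO] exact_zero_of_epic[OF epic_Idt Idt_Hom zO] NO
        in \<open>simp_all add: f_def\<close>)
  qed
qed

text \<open>The indexed sequence becomes a recursion by cutting at the image of the arrow from the
  first to the second term of the coresolution. Later inductions use only this form.\<close>

lemma finite_coresolved_Suc: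
  "N \<in> finite_coresolved E (Suc m) M \<longleftrightarrow>
    (\<exists>f K g N'. short_exact E N f K g N' \<and> K \<in> M \<and> N' \<in> finite_coresolved E m M)"
proof
  assume "N \<in> finite_coresolved E (Suc m) M"
  then obtain X f where X: "is_zero_object E (X (0::nat))" "X 1 = N" "\<And>j. j \<le> Suc m \<Longrightarrow> X (j + 2) \<in> M"
      "is_zero_object E (X (Suc m + 3))"
    and f: "\<And>j. j \<le> Suc m + 2 \<Longrightarrow> f j \<in> Hom E (X j) (X (j + 1))"
      "\<And>j. j \<le> Suc m + 1 \<Longrightarrow> exact_at E (f j) (f (j + 1))"
    unfolding finite_coresolved_def by blast
  have h: "f 0 \<in> Hom E (X 0) (X 1)" "f 1 \<in> Hom E (X 1) (X 2)" "f 2 \<in> Hom E (X 2) (X 3)" "f 3 \<in> Hom E (X 3) (X 4)"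
    using f(1)[of 0] f(1)[of 1] f(1)[of 2] f(1)[of 3] by (simp_all add: numeral_eq_Suc)
  have e: "exact_at E (f 0) (f 1)" "exact_at E (f 1) (f 2)" "exact_at E (f 2) (f 3)"
    using f(2)[of 0] f(2)[of 1] f(2)[of 2] by (simp_all add: numeral_eq_Suc)
  obtain I \<mu> c where mc: "epic E c" "monic E \<mu>" "c \<in> Hom E (X 2) I" "\<mu> \<in> Hom E I (X 3)" "\<mu> \<cdot> c = f 2"
    using factor[OF h(3)] by blast
  have "monic E (f 1)" using monic_of_exact_zero[OF e(1) h(1,2) X(1)] .
  moreover have "exact_at E (f 1) c" using exact_at_monic_iff[OF mc(2,4) h(2) mc(3)] e(2) mc(5) by simp
  ultimately have ses: "short_exact E N (f 1) (X 2) c I"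
    using short_exact_of_exact_monic[OF _ _ mc(1) h(2) mc(3)] X(2) by simp
  have \<mu>: "exact_at E \<mu> (f 3)" using exact_at_epic_iff[OF mc(1,3,4) h(4)] e(3) mc(5) by simp
  \<comment> \<open>The first term \<open>X 2\<close> is dropped and the image \<open>I\<close>
    takes the place of \<open>N\<close>; later entries move down by one.\<close>
  define Y where "Y n = (if n = 0 then X 0 else if n = 1 then I else X (n + 1))" for n
  define g where "g n = (if n = 0 then Zer E (X 0) I else if n = 1 then \<mu> else f (n + 1))" for n
  have o: "X 0 \<in> Obj E" "I \<in> Obj E" using Hom_Obj[OF h(1)] Hom_Obj[OF mc(3)] by blast+
  have "I \<in> finite_coresolved E m M"
    unfolding finite_coresolved_def
  proof (intro CollectI exI conjI allI impI)
    show "is_zero_object E (Y 0)" "Y 1 = I" using X unfolding Y_def by simp_all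
    show "is_zero_object E (Y (m + 3))" using X(4) unfolding Y_def by (simp add: numeral_eq_Suc)
    fix j :: nat
    show "j \<le> m \<Longrightarrow> Y (j + 2) \<in> M" using X(3)[of "Suc j"] unfolding Y_def by (simp add: numeral_eq_Suc)
    {
      assume j: "j \<le> m + 2"
      consider "j = 0" | "j = 1" | "j \<ge> 2" by linarith
      then show "g j \<in> Hom E (Y j) (Y (j + 1))"
      proof cases
        case 3
        then show ?thesis using f(1)[of "Suc j"] j unfolding g_def Y_def by simp
      qed (use o mc(4) in \<open>simp_all add: g_def Y_def numeral_eq_Suc\<close>)
    }
    assume j: "j \<le> m + 1"
    consider "j = 0" | "j = 1" | "j \<ge> 2" by linarith
    then show "exact_at E (g j) (g (j + 1))"
    proof cases
      case 3
      then show ?thesis using f(2)[of "Suc j"] j unfolding g_def by simp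
    qed (use exact_zero_of_monic[OF mc(2,4) o(1)] \<mu> in \<open>simp_all add: g_def numeral_eq_Suc\<close>)
  qed
  then show "\<exists>f K g N'. short_exact E N f K g N' \<and> K \<in> M \<and> N' \<in> finite_coresolved E m M"
    using ses X(3)[of 0] by (auto simp: numeral_eq_Suc)
next
  assume "\<exists>f K g N'. short_exact E N f K g N' \<and> K \<in> M \<and> N' \<in> finite_coresolved E m M"
  then obtain a K b N' where ses: "short_exact E N a K b N'" and K: "K \<in> M" and "N' \<in> finite_coresolved E m M"
    by blast
  then obtain X f where X: "is_zero_object E (X (0::nat))" "X 1 = N'" "\<And>j. j \<le> m \<Longrightarrow> X (j + 2) \<in> M"
      "is_zero_object E (X (m + 3))"
    and f: "\<And>j. j \<le> m + 2 \<Longrightarrow> f j \<in> Hom E (X j) (X (j + 1))"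
      "\<And>j. j \<le> m + 1 \<Longrightarrow> exact_at E (f j) (f (j + 1))"
    unfolding finite_coresolved_def by blast
  note S = short_exactD[OF ses]
  have h: "f 0 \<in> Hom E (X 0) N'" "f 1 \<in> Hom E N' (X 2)" "f 2 \<in> Hom E (X 2) (X 3)"
    using f(1)[of 0] f(1)[of 1] f(1)[of 2] X(2) by (simp_all add: numeral_eq_Suc)
  have e: "exact_at E (f 0) (f 1)" "exact_at E (f 1) (f 2)"
    using f(2)[of 0] f(2)[of 1] by (simp_all add: numeral_eq_Suc)
  have m: "monic E (f 1)" using monic_of_exact_zero[OF e(1) h(1,2) X(1)] .
  have e1: "exact_at E a (f 1 \<cdot> b)" using exact_at_monic_iff[OF m h(2) S(1,2)] S(8) by blast
  have e2: "exact_at E (f 1 \<cdot> b) (f 2)" using exact_at_epic_iff[OF S(4,2) h(2,3)] e(2) by blast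
  have o: "X 0 \<in> Obj E" using Hom_Obj[OF h(1)] by blast
  have e0: "exact_at E (Zer E (X 0) N) a" using exact_zero_of_monic[OF S(3,1) o] .
  \<comment> \<open>Conversely \<open>K\<close> is inserted behind \<open>N\<close>, and
    \<open>N'\<close> survives only as the image of the spliced arrow
    \<open>f 1 \<cdot> b\<close>.\<close>
  define Y where "Y n = (if n = 0 then X 0 else if n = 1 then N else if n = 2 then K else X (n - 1))" for n
  define g where "g n = (if n = 0 then Zer E (X 0) N else if n = 1 then a else if n = 2 then f 1 \<cdot> b else f (n - 1))" for n
  show "N \<in> finite_coresolved E (Suc m) M"
    unfolding finite_coresolved_def
  proof (intro CollectI exI conjI allI impI)
    show "is_zero_object E (Y 0)" "Y 1 = N" using X unfolding Y_def by simp_all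
    show "is_zero_object E (Y (Suc m + 3))" using X(4) unfolding Y_def by (simp add: numeral_eq_Suc)
    fix j :: nat
    have cases4: "j = 0 \<or> j = 1 \<or> j = 2 \<or> (\<exists>i. j = i + 3)" by presburger
    show "Y (j + 2) \<in> M" if j: "j \<le> Suc m"
    proof (cases j)
      case 0
      then show ?thesis using K unfolding Y_def by simp
    next
      case (Suc i)
      then show ?thesis using X(3)[of i] j unfolding Y_def by (simp add: numeral_eq_Suc)
    qed
    {
      assume j: "j \<le> Suc m + 2"
      consider "j = 0" | "j = 1" | "j = 2" | i where "j = i + 3" using cases4 by blast
      then show "g j \<in> Hom E (Y j) (Y (j + 1))"
      proof cases
        case (4 i)
        then show ?thesis using f(1)[of "i + 2"] j unfolding g_def Y_def by (simp add: numeral_eq_Suc)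
      qed (use o S(1,2,9) h(2) in \<open>simp_all add: g_def Y_def numeral_eq_Suc\<close>)
    }
    assume j: "j \<le> Suc m + 1"
    consider "j = 0" | "j = 1" | "j = 2" | i where "j = i + 3" using cases4 by blast
    then show "exact_at E (g j) (g (j + 1))"
    proof cases
      case (4 i)
      then show ?thesis using f(2)[of "i + 2"] j unfolding g_def by (simp add: numeral_eq_Suc)
    qed (use e0 e1 e2 in \<open>simp_all add: g_def numeral_eq_Suc\<close>)
  qed
qed

end

section \<open>Left derived functors\<close>

locale right_exact_abelian = right_exact_functor C D G + C: abelian_category C + D: abelian_category D
  for C :: "('o1, 'm1) cat" and D :: "('o2, 'm2) cat" and G :: "('o1, 'm1, 'o2, 'm2) functor_data"
begin

abbreviation comp_D :: "'m2 \<Rightarrow> 'm2 \<Rightarrow> 'm2" (infixl \<open>\<bullet>\<close> 70) where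
  "g \<bullet> f \<equiv> g \<cdot>\<^bsub>D\<^esub> f"

abbreviation plus_D :: "'m2 \<Rightarrow> 'm2 \<Rightarrow> 'm2" (infixl \<open>\<uplus>\<close> 65) where
  "f \<uplus> g \<equiv> f \<boxplus>\<^bsub>D\<^esub> g"

lemma FArr_types [simp]:
  assumes "f \<in> Arr C"
  shows "FArr G f \<in> Arr D" "Dom D (FArr G f) = FObj G (Dom C f)" "Cod D (FArr G f) = FObj G (Cod C f)"
  using FArr_Hom[of f "Dom C f" "Cod C f"] assms by simp_all

declare FObj_Obj [simp] FArr_Idt [simp]

lemma FArr_Cmp' [simp]:
  assumes "f \<in> Arr C" "g \<in> Arr C" "Dom C g = Cod C f"
  shows "FArr G (g \<cdot>\<^bsub>C\<^esub> f) = FArr G g \<bullet> FArr G f"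
  using FArr_Cmp[of f "Dom C f" "Cod C f" g "Cod C g"] assms by simp

lemma FArr_Pls' [simp]:
  assumes "f \<in> Arr C" "g \<in> Arr C" "Dom C g = Dom C f" "Cod C g = Cod C f"
  shows "FArr G (f \<boxplus>\<^bsub>C\<^esub> g) = FArr G f \<uplus> FArr G g"
  using FArr_Pls[of f "Dom C f" "Cod C f" g] assms by simp

lemma FArr_Zer [simp]:
  assumes "a \<in> Obj C" "b \<in> Obj C"
  shows "FArr G (Zer C a b) = Zer D (FObj G a) (FObj G b)"
proof (rule D.idempotent_Zer)
  have "Zer C a b \<boxplus>\<^bsub>C\<^esub> Zer C a b = Zer C a b" using assms by simp
  then have "FArr G (Zer C a b \<boxplus>\<^bsub>C\<^esub> Zer C a b) = FArr G (Zer C a b)" by simp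
  then show "FArr G (Zer C a b) \<uplus> FArr G (Zer C a b) = FArr G (Zer C a b)"
    using assms by (simp del: C.Zer_Pls)
qed (use assms in simp_all)

lemma FArr_Neg [simp]:
  assumes "f \<in> Arr C"
  shows "FArr G (C.Neg f) = D.Neg (FArr G f)"
proof (rule D.Neg_unique)
  have "FArr G (f \<boxplus>\<^bsub>C\<^esub> C.Neg f) = Zer D (FObj G (Dom C f)) (FObj G (Cod C f))"
    using assms by (simp del: FArr_Pls' add: C.Dom_Obj C.Cod_Obj)
  then show "FArr G f \<uplus> FArr G (C.Neg f) = Zer D (Dom D (FArr G f)) (Cod D (FArr G f))"
    using assms by (simp del: C.Pls_Neg)
qed (use assms in simp_all)

lemma FObj_zero: "is_zero_object C z \<Longrightarrow> is_zero_object D (FObj G z)"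
  unfolding C.zero_object_iff D.zero_object_iff by (metis FArr_Idt FArr_Zer FObj_Obj)

lemma FArr_epic:
  assumes "epic C e" "e \<in> Hom C a b"
  shows "epic D (FArr G e)"
proof -
  obtain z k where k: "k \<in> Hom C z a" "is_kernel C e k" using C.ex_kernel_Hom[OF assms(2)] by blast
  show ?thesis using right_exact[OF C.short_exact_of_kernel[OF k(2) assms(1) k(1) assms(2)]] by blast
qed

lemma FArr_short_exact:
  assumes "short_exact C a f b g c"
  shows "FArr G f \<in> Hom D (FObj G a) (FObj G b)" "FArr G g \<in> Hom D (FObj G b) (FObj G c)"
    "exact_at D (FArr G f) (FArr G g)" "epic D (FArr G g)"
    "FArr G g \<bullet> FArr G f = Zer D (FObj G a) (FObj G c)"
proof -
  note S = C.short_exactD[OF assms]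
  show 1: "FArr G f \<in> Hom D (FObj G a) (FObj G b)" "FArr G g \<in> Hom D (FObj G b) (FObj G c)"
    using FArr_Hom S(1,2) by blast+
  show 2: "exact_at D (FArr G f) (FArr G g)" "epic D (FArr G g)" using right_exact[OF assms] by blast+
  show "FArr G g \<bullet> FArr G f = Zer D (FObj G a) (FObj G c)" using D.exact_zero[OF 2(1) 1] .
qed

text \<open>Right exactness is given for short exact sequences only. Replacing \<open>f\<close> by
  the inclusion \<open>m\<close> of its image is harmless, because \<open>FArr G\<close> of the epi
  part is epic.\<close>

lemma FArr_cokernel:
  assumes "is_cokernel C f c" "f \<in> Hom C a b" "c \<in> Hom C b d"
  shows "is_cokernel D (FArr G f) (FArr G c)"
proof -
  obtain i m e where e: "epic C e" "monic C m" "e \<in> Hom C a i" "m \<in> Hom C i b" "m \<cdot>\<^bsub>C\<^esub> e = f"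
    using C.factor[OF assms(2)] by blast
  have "exact_at C m c"
    using C.exact_at_epic_iff[OF e(1,3,4) assms(3)] C.exact_of_cokernel[OF assms] e(5) by simp
  then have "short_exact C i m b c d"
    using C.short_exact_of_exact_monic[OF _ e(2) C.is_cokernel_epic[OF assms(1)] e(4) assms(3)] by blast
  note S = FArr_short_exact[OF this]
  have "exact_at D (FArr G m \<bullet> FArr G e) (FArr G c)"
    using D.exact_at_epic_iff[OF FArr_epic[OF e(1,3)] FArr_Hom[OF e(3)] S(1,2)] S(3) by blast
  then have "exact_at D (FArr G f) (FArr G c)" using FArr_Cmp[OF e(3,4)] e(5) by simp
  then show ?thesis
    using D.cokernel_of_exact_epic[OF _ S(4) FArr_Hom[OF assms(2)] FArr_Hom[OF assms(3)]] by blast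
qed

abbreviation tor1_zero :: "'o1 \<Rightarrow> bool" where
  "tor1_zero \<equiv> ses_into C (\<lambda>f. monic D (FArr G f))"

text \<open>The index is shifted: \<open>tor_zero i\<close> stands for the vanishing of
  \<open>L\<^sub>(i+1) G\<close>.\<close>

abbreviation tor_zero :: "nat \<Rightarrow> 'o1 \<Rightarrow> bool" where
  "tor_zero \<equiv> syz C tor1_zero"

lemma tor1_zeroD: "\<lbrakk>tor1_zero a; short_exact C k f m g a\<rbrakk> \<Longrightarrow> monic D (FArr G f)"
  unfolding ses_into_def by blast

lemma tor1_zero_stable: "stable_under_projectives C tor1_zero"
proof (rule C.stable_ses_into)
  show "stable_under_split C (\<lambda>f. monic D (FArr G f))"
    unfolding stable_under_split_def
  proof (intro allI impI iffI; elim conjE)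
    fix k m n f i r
    assume f: "f \<in> Hom C k m" and i: "i \<in> Hom C m n" and r: "r \<in> Hom C n m" and ri: "r \<cdot>\<^bsub>C\<^esub> i = Idt C m"
    have eq: "FArr G (i \<cdot>\<^bsub>C\<^esub> f) = FArr G i \<bullet> FArr G f" using FArr_Cmp[OF f i] .
    show "monic D (FArr G f)" if "monic D (FArr G (i \<cdot>\<^bsub>C\<^esub> f))"
      using D.monic_right_factor[OF _ FArr_Hom[OF f] FArr_Hom[OF i]] that eq by simp
    have "FArr G r \<bullet> FArr G i = Idt D (FObj G m)"
      using FArr_Cmp[OF i r] ri C.Hom_Obj[OF f] by simp
    then have "monic D (FArr G i)" using D.monic_split[OF _ FArr_Hom[OF i] FArr_Hom[OF r]] by blast
    then show "monic D (FArr G (i \<cdot>\<^bsub>C\<^esub> f))" if "monic D (FArr G f)"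
      using D.monic_Cmp[OF that _ FArr_Hom[OF f] FArr_Hom[OF i]] eq by simp
  qed
qed

text \<open>Apply \<open>G\<close> to the pushout sequence of \<open>short_exact_pushout\<close>. If
  \<open>FArr G f\<close> kills \<open>x\<close>, then \<open>x\<close>, placed in the first
  summand, comes from some \<open>z\<close> over \<open>FObj G K\<close>. Its second coordinate is
  \<open>FArr G i\<close> applied to \<open>z\<close> and vanishes, so \<open>z\<close> and
  \<open>x\<close> vanish.\<close>

lemma tor1_zero_of_presentation:
  assumes "short_exact C K i P e a" "projective C P" "monic D (FArr G i)"
  shows "tor1_zero a"
  unfolding ses_into_def
proof (intro allI impI)
  fix k f m g assume ses: "short_exact C k f m g a"
  note S = C.short_exactD[OF ses] and T = C.short_exactD[OF assms(1)]
  obtain l where l: "l \<in> Hom C P m" "g \<cdot>\<^bsub>C\<^esub> l = e" using C.projective_lift[OF assms(2) S(4,2) T(2)] by blast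
  obtain s i1 i2 p1 p2 where s: "is_biproduct C k P s i1 i2 p1 p2" using C.ex_biproduct[OF S(9) T(10)] .
  note B = C.biproductD[OF s]
  define u where "u w = C.Neg (i1 \<cdot>\<^bsub>C\<^esub> w) \<boxplus>\<^bsub>C\<^esub> i2 \<cdot>\<^bsub>C\<^esub> i" for w
  define v where "v = f \<cdot>\<^bsub>C\<^esub> p1 \<boxplus>\<^bsub>C\<^esub> l \<cdot>\<^bsub>C\<^esub> p2"
  obtain w where w: "w \<in> Hom C K k" "short_exact C K (u w) s v m"
    using C.short_exact_pushout[OF assms(1) ses l s] unfolding u_def v_def by blast
  note U = C.short_exactD[OF w(2)] and GU = FArr_short_exact[OF w(2)]
  have o: "k \<in> Obj C" "P \<in> Obj C" "K \<in> Obj C" using S(9) T(9,10) by simp_all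
  have p2u: "p2 \<cdot>\<^bsub>C\<^esub> u w = i" unfolding u_def
    using C.biproduct_simps[OF s] w(1) T(1) B(1-4) o by simp
  have vi: "v \<cdot>\<^bsub>C\<^esub> i1 = f" unfolding v_def using B S(1,10) l(1) o by simp
  show "monic D (FArr G f)"
  proof (rule D.monicI[OF FArr_Hom[OF S(1)]])
    fix t x assume x: "x \<in> Hom D t (FObj G k)" "FArr G f \<bullet> x = Zer D t (FObj G m)"
    have ix: "FArr G i1 \<bullet> x \<in> Hom D t (FObj G s)" using B(1) x(1) by simp
    have to: "t \<in> Obj D" using D.Hom_Obj[OF x(1)] by blast
    have "FArr G v \<bullet> FArr G i1 = FArr G f" using FArr_Cmp[OF B(1) U(2)] vi by simp
    then have "FArr G v \<bullet> (FArr G i1 \<bullet> x) = Zer D t (FObj G m)"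
      using D.Cmp_eq[OF _ x(1) FArr_Hom[OF B(1)] GU(2)] x(2) by simp
    then obtain s' r z where r: "epic D r" "r \<in> Hom D s' t" "z \<in> Hom D s' (FObj G K)"
      "FArr G (u w) \<bullet> z = FArr G i1 \<bullet> x \<bullet> r"
      using D.exactD[OF GU(3,1,2) ix] by blast
    have xr: "x \<bullet> r \<in> Hom D s' (FObj G k)" using x(1) r(2) by simp
    have eq: "FArr G (u w) \<bullet> z = FArr G i1 \<bullet> (x \<bullet> r)" unfolding r(4) using x(1) r(2) B(1) by simp
    have "FArr G p2 \<bullet> FArr G (u w) = FArr G i" using FArr_Cmp[OF U(1) B(4)] p2u by simp
    then have "FArr G i \<bullet> z = FArr G p2 \<bullet> (FArr G (u w) \<bullet> z)"
      using D.Cmp_eq[OF _ r(3) GU(1) FArr_Hom[OF B(4)]] by simp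
    also have "\<dots> = (FArr G p2 \<bullet> FArr G i1) \<bullet> (x \<bullet> r)"
      unfolding eq using D.Cmp_assoc[OF xr FArr_Hom[OF B(1)] FArr_Hom[OF B(4)]] .
    also have "\<dots> = Zer D s' (FObj G P)"
      unfolding FArr_Cmp[OF B(1,4), symmetric] B(7) using xr o by simp
    finally have "z = Zer D s' (FObj G K)" using D.monic_Zer[OF assms(3) _ FArr_Hom[OF T(1)] r(3)] by blast
    then have z: "FArr G i1 \<bullet> (x \<bullet> r) = Zer D s' (FObj G s)" unfolding eq[symmetric] using GU(1) D.Hom_Obj[OF xr] by simp
    have "FArr G p1 \<bullet> FArr G i1 = Idt D (FObj G k)" using FArr_Cmp[OF B(1,3)] B(5) o by simp
    then have "monic D (FArr G i1)" using D.monic_split[OF _ FArr_Hom[OF B(1)] FArr_Hom[OF B(3)]] by blast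
    then have "x \<bullet> r = Zer D s' (FObj G k)" using D.monic_Zer[OF _ z FArr_Hom[OF B(1)] xr] by blast
    then show "x = Zer D t (FObj G k)" using D.epic_Zer[OF r(1) _ r(2) x(1)] by blast
  qed
qed

text \<open>The piece \<open>L\<^sub>1 G(b) \<rightarrow> L\<^sub>1 G(c) \<rightarrow> G a
  \<rightarrow> G b\<close> of the long exact sequence. The pullback of an extension of
  \<open>c\<close> to \<open>b\<close> has the same kernel \<open>k\<close>, where monicity is
  known, and kernel \<open>a\<close> over \<open>m\<close>.\<close>

lemma tor1_zero_quotient:
  assumes "short_exact C a f b g c" "monic D (FArr G f)" "tor1_zero b"
  shows "tor1_zero c"
  unfolding ses_into_def
proof (intro allI impI)
  fix k h m l assume ses: "short_exact C k h m l c"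
  note S = C.short_exactD[OF ses] and T = C.short_exactD[OF assms(1)]
  obtain z u v where P: "C.is_pullback z m b c l g u v" using C.ex_pullback[OF S(2) T(2)] by blast
  note PD = C.is_pullbackD[OF P]
  obtain i where i: "short_exact C k i z v b" "u \<cdot>\<^bsub>C\<^esub> i = h" using C.short_exact_pullback[OF P ses] by blast
  obtain j where j: "short_exact C a j z u m" "v \<cdot>\<^bsub>C\<^esub> j = f"
    using C.short_exact_pullback[OF C.is_pullback_swap[OF P] assms(1)] by blast
  note I = C.short_exactD[OF i(1)] and J = C.short_exactD[OF j(1)]
  note GI = FArr_short_exact[OF i(1)] and GJ = FArr_short_exact[OF j(1)]
  have mi: "monic D (FArr G i)" using tor1_zeroD[OF assms(3) i(1)] .
  have e: "FArr G u \<bullet> FArr G i = FArr G h" "FArr G v \<bullet> FArr G j = FArr G f"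
    using FArr_Cmp[OF I(1) J(2)] FArr_Cmp[OF J(1) I(2)] i(2) j(2) by simp_all
  show "monic D (FArr G h)"
  proof (rule D.monicI[OF FArr_Hom[OF S(1)]])
    fix t x assume x: "x \<in> Hom D t (FObj G k)" "FArr G h \<bullet> x = Zer D t (FObj G m)"
    have ix: "FArr G i \<bullet> x \<in> Hom D t (FObj G z)" using GI(1) x(1) by simp
    have "FArr G u \<bullet> (FArr G i \<bullet> x) = Zer D t (FObj G m)"
      using D.Cmp_eq[OF e(1) x(1) GI(1) GJ(2)] x(2) by simp
    then obtain s r y where r: "epic D r" "r \<in> Hom D s t" "y \<in> Hom D s (FObj G a)"
      "FArr G j \<bullet> y = FArr G i \<bullet> x \<bullet> r"
      using D.exactD[OF GJ(3,1,2) ix] by blast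
    have xr: "x \<bullet> r \<in> Hom D s (FObj G k)" using x(1) r(2) by simp
    have eq: "FArr G j \<bullet> y = FArr G i \<bullet> (x \<bullet> r)" unfolding r(4) using x(1) r(2) GI(1) by simp
    have "FArr G f \<bullet> y = FArr G v \<bullet> (FArr G j \<bullet> y)"
      using D.Cmp_eq[OF e(2) r(3) GJ(1) GI(2)] by simp
    also have "\<dots> = Zer D (FObj G k) (FObj G b) \<bullet> (x \<bullet> r)"
      unfolding eq using D.Cmp_eq[OF GI(5) xr GI(1,2)] .
    finally have "FArr G f \<bullet> y = Zer D s (FObj G b)" using xr D.Hom_Obj[OF GI(2)] by simp
    then have "y = Zer D s (FObj G a)" using D.monic_Zer[OF assms(2) _ FArr_Hom[OF T(1)] r(3)] by blast
    then have "FArr G i \<bullet> (x \<bullet> r) = Zer D s (FObj G z)" unfolding eq[symmetric] using GJ(1) D.Hom_Obj[OF xr] by simp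
    then have "x \<bullet> r = Zer D s (FObj G k)" using D.monic_Zer[OF mi _ GI(1) xr] by blast
    then show "x = Zer D t (FObj G k)" using D.epic_Zer[OF r(1) _ r(2) x(1)] by blast
  qed
qed

lemma tor_zero_any:
  "\<lbrakk>tor_zero (Suc j) a; short_exact C k f p g a; projective C p\<rbrakk> \<Longrightarrow> tor_zero j k"
  using C.syz_any_presentation[OF tor1_zero_stable] .

text \<open>Two pieces of the long exact sequence. A projective \<open>p\<close> mapping onto \<open>b\<close> also maps onto \<open>c\<close>,
  and the two kernels form an exact sequence \<open>0 \<rightarrow> \<Omega>b \<rightarrow> \<Omega>c \<rightarrow> a \<rightarrow> 0\<close>; passing to it once or twice
  lowers the degree in each piece.\<close>

lemma tor_zero_long_exact:
  assumes "enough_projectives C" "short_exact C a f b g c"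
  shows "(tor_zero j b \<longrightarrow> tor_zero (Suc j) c \<longrightarrow> tor_zero j a) \<and>
    (tor_zero j a \<longrightarrow> tor_zero j c \<longrightarrow> tor_zero j b)"
  using assms(2)
\<comment> \<open>The two pieces are proved together because each is reduced to the other: the
  first, in the next degree, uses the second on the sequence of \<open>l\<close>, \<open>l'\<close>
  and \<open>k\<close>; the second uses the first on that of \<open>k\<close>, \<open>k'\<close> and
  \<open>a\<close>.\<close>
proof (induction j arbitrary: a f b g c)
  case 0
  note T = C.short_exactD[OF 0]
  show ?case
  proof (intro conjI impI)
    assume b: "tor_zero 0 b" and c: "tor_zero (Suc 0) c"
    obtain k i p e where p: "short_exact C k i p e b" "projective C p"
      using C.ex_projective_presentation[OF assms(1) T(10)] by blast
    obtain k' i' u v where k': "short_exact C k' i' p (g \<cdot>\<^bsub>C\<^esub> e) c" "short_exact C k u k' v a" "i' \<cdot>\<^bsub>C\<^esub> u = i"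
      using C.short_exact_preimage[OF 0 p(1)] by blast
    have 1: "tor1_zero k'" using tor_zero_any[OF c k'(1) p(2)] by simp
    have "monic D (FArr G i)" using tor1_zeroD[OF _ p(1)] b by simp
    then have "monic D (FArr G i' \<bullet> FArr G u)"
      using FArr_Cmp[OF C.short_exactD(1)[OF k'(2)] C.short_exactD(1)[OF k'(1)]] k'(3) by simp
    then have "monic D (FArr G u)"
      using D.monic_right_factor[OF _ FArr_short_exact(1)[OF k'(2)] FArr_short_exact(1)[OF k'(1)]] by blast
    then show "tor_zero 0 a" using tor1_zero_quotient[OF k'(2) _ 1] by simp
  next
    assume a: "tor_zero 0 a" and c: "tor_zero 0 c"
    have "tor1_zero b"
      unfolding ses_into_def
    proof (intro allI impI)
      fix k i p e assume p: "short_exact C k i p e b"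
      obtain k' i' u v where k': "short_exact C k' i' p (g \<cdot>\<^bsub>C\<^esub> e) c" "short_exact C k u k' v a" "i' \<cdot>\<^bsub>C\<^esub> u = i"
        using C.short_exact_preimage[OF 0 p] by blast
      have "monic D (FArr G u)" using tor1_zeroD[OF _ k'(2)] a by simp
      moreover have "monic D (FArr G i')" using tor1_zeroD[OF _ k'(1)] c by simp
      ultimately have "monic D (FArr G i' \<bullet> FArr G u)"
        using D.monic_Cmp[OF _ _ FArr_short_exact(1)[OF k'(2)] FArr_short_exact(1)[OF k'(1)]] by blast
      then show "monic D (FArr G i)"
        using FArr_Cmp[OF C.short_exactD(1)[OF k'(2)] C.short_exactD(1)[OF k'(1)]] k'(3) by simp
    qed
    then show "tor_zero 0 b" by simp
  qed
next
  case (Suc j)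
  note T = C.short_exactD[OF Suc.prems]
  obtain k i p e where p: "short_exact C k i p e b" "projective C p"
    using C.ex_projective_presentation[OF assms(1) T(10)] by blast
  obtain k' i' u v where k': "short_exact C k' i' p (g \<cdot>\<^bsub>C\<^esub> e) c" "short_exact C k u k' v a"
    using C.short_exact_preimage[OF Suc.prems p(1)] by blast
  obtain l x q y where l: "short_exact C l x q y k'" "projective C q"
    using C.ex_projective_presentation[OF assms(1) C.short_exactD(9)[OF k'(1)]] by blast
  obtain l' x' w z where l': "short_exact C l' x' q (v \<cdot>\<^bsub>C\<^esub> y) a" "short_exact C l w l' z k"
    using C.short_exact_preimage[OF k'(2) l(1)] by blast
  show ?case
  proof (intro conjI impI)
    assume b: "tor_zero (Suc j) b" and c: "tor_zero (Suc (Suc j)) c"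
    have "tor_zero j k" using tor_zero_any[OF b p] .
    moreover have "tor_zero j l" using tor_zero_any[OF tor_zero_any[OF c k'(1) p(2)] l] .
    ultimately have "tor_zero j l'" using Suc.IH[OF l'(2)] by blast
    then show "tor_zero (Suc j) a" unfolding syz.simps using l'(1) l(2) by blast
  next
    assume a: "tor_zero (Suc j) a" and c: "tor_zero (Suc j) c"
    have "tor_zero j k" using Suc.IH[OF k'(2)] tor_zero_any[OF c k'(1) p(2)] a by blast
    then show "tor_zero (Suc j) b" unfolding syz.simps using p by blast
  qed
qed

text \<open>An element killed by \<open>FArr G (i j)\<close> lifts, after a cover, to a cycle over
  \<open>P (Suc j)\<close>. Zero homology makes the cycle a boundary, and boundaries die in
  \<open>FObj G (K (Suc j))\<close>. So \<open>FArr G (i j)\<close> is monic, which decides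
  \<open>L\<^sub>1 G\<close> on the \<open>j\<close>-th syzygy.\<close>

lemma tor_zero_left_derived:
  assumes "enough_projectives C" "a \<in> Obj C" "is_zero_object D (left_derived_obj C D G (Suc j) a)"
  shows "tor_zero j a"
proof -
  obtain P d e where R: "chosen_resolution C a = (P, d, e)" "proj_resolution C a P d e"
    using C.chosen_resolution[OF assms(1,2)] by blast
  obtain K i q where S: "K 0 = a" "\<And>n. short_exact C (K (Suc n)) (i n) (P n) (q n) (K n)"
    "\<And>n. d n = i n \<cdot>\<^bsub>C\<^esub> q (Suc n)" "\<And>n. projective C (P n)"
    using C.proj_resolution_syzygies[OF R(2)] by blast
  note Sd = C.short_exactD[OF S(2)] and GS = FArr_short_exact[OF S(2)]
  have d: "d n \<in> Hom C (P (Suc n)) (P n)" for n unfolding S(3) using Sd(1)[of n] Sd(2)[of "Suc n"] by simp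
  have Gd: "FArr G (d n) = FArr G (i n) \<bullet> FArr G (q (Suc n))" for n
    unfolding S(3) using FArr_Cmp[OF Sd(2)[of "Suc n"] Sd(1)[of n]] .
  have dd: "FArr G (d j) \<bullet> FArr G (d (Suc j)) = Zer D (FObj G (P (Suc (Suc j)))) (FObj G (P j))"
  proof -
    have "FArr G (d j) \<bullet> FArr G (d (Suc j)) =
        FArr G (i j) \<bullet> (FArr G (q (Suc j)) \<bullet> FArr G (i (Suc j))) \<bullet> FArr G (q (Suc (Suc j)))"
      unfolding Gd using GS(1)[of j] GS(1)[of "Suc j"] GS(2)[of "Suc j"] GS(2)[of "Suc (Suc j)"] by simp
    also have "\<dots> = Zer D (FObj G (P (Suc (Suc j)))) (FObj G (P j))"
      unfolding GS(5) using GS(1)[of j] GS(2)[of "Suc (Suc j)"] Sd(9) Sd(10) by simp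
    finally show ?thesis .
  qed
  have "is_homology D (FArr G (d (Suc j))) (FArr G (d j)) (left_derived_obj C D G (Suc j) a)"
  proof -
    obtain z k where k: "k \<in> Hom D z (FObj G (P (Suc j)))" "is_kernel D (FArr G (d j)) k"
      using D.ex_kernel_Hom[OF FArr_Hom[OF d]] by blast
    obtain f' where f': "f' \<in> Hom D (FObj G (P (Suc (Suc j)))) z" "k \<bullet> f' = FArr G (d (Suc j))"
      using D.is_kernel_lift[OF k(2) FArr_Hom[OF d] k(1) FArr_Hom[OF d] dd] by blast
    obtain c where c: "is_cokernel D f' c" using D.ex_cokernel_Hom[OF f'(1)] by blast
    have "is_homology D (FArr G (d (Suc j))) (FArr G (d j)) (Cod D c)"
      unfolding is_homology_def
      by (intro exI[of _ k] exI[of _ f'] exI[of _ c]) (use k f' c d[of "Suc j"] in simp)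
    then show ?thesis unfolding left_derived_obj_def R(1) by (simp add: someI_ex[of "is_homology D _ _"] exI)
  qed
  then obtain k f' c where k: "is_kernel D (FArr G (d j)) k"
    and f': "f' \<in> Hom D (Dom D (FArr G (d (Suc j)))) (Dom D k)" "k \<bullet> f' = FArr G (d (Suc j))"
    and c: "is_cokernel D f' c" "Cod D c = left_derived_obj C D G (Suc j) a"
    unfolding is_homology_def by blast
  define z where "z = Dom D k"
  have kz: "k \<in> Hom D z (FObj G (P (Suc j)))" unfolding z_def using D.is_kernelD(1)[OF k FArr_Hom[OF d]] .
  have f'z: "f' \<in> Hom D (FObj G (P (Suc (Suc j)))) z" unfolding z_def using f'(1) d[of "Suc j"] by simp
  have cz: "c \<in> Hom D z (left_derived_obj C D G (Suc j) a)" using D.is_cokernelD(1)[OF c(1) f'z] c(2) by simp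
  \<comment> \<open>The zero cokernel of \<open>f'\<close> says that the boundaries fill the whole
    kernel.\<close>
  have epi: "epic D f'"
    using D.epic_of_exact_zero[OF D.exact_of_cokernel[OF c(1) f'z cz] f'z cz assms(3)] .
  have "monic D (FArr G (i j))"
  proof (rule D.monicI[OF GS(1)])
    fix t x assume x: "x \<in> Hom D t (FObj G (K (Suc j)))" "FArr G (i j) \<bullet> x = Zer D t (FObj G (P j))"
    obtain s r y where r: "epic D r" "r \<in> Hom D s t" "y \<in> Hom D s (FObj G (P (Suc j)))"
      "FArr G (q (Suc j)) \<bullet> y = x \<bullet> r"
      using D.cover[OF GS(4,2) x(1)] by blast
    have "FArr G (d j) \<bullet> y = FArr G (i j) \<bullet> (x \<bullet> r)"
      unfolding Gd r(4)[symmetric] using GS(1)[of j] GS(2)[of "Suc j"] r(3) by simp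
    also have "\<dots> = Zer D t (FObj G (P j)) \<bullet> r" using D.Cmp_eq[OF x(2) r(2) x(1) GS(1)] .
    finally have "FArr G (d j) \<bullet> y = Zer D s (FObj G (P j))" using r(2) Sd(10) by simp
    then obtain w where w: "w \<in> Hom D s z" "k \<bullet> w = y"
      using D.is_kernel_lift[OF k FArr_Hom[OF d] kz r(3)] by blast
    obtain s' r' v where r': "epic D r'" "r' \<in> Hom D s' s" "v \<in> Hom D s' (FObj G (P (Suc (Suc j))))"
      "f' \<bullet> v = w \<bullet> r'"
      using D.cover[OF epi f'z w(1)] by blast
    have "y \<bullet> r' = k \<bullet> (f' \<bullet> v)" unfolding r'(4) w(2)[symmetric] using w(1) kz r'(2) by simp
    also have "\<dots> = FArr G (d (Suc j)) \<bullet> v" using D.Cmp_eq[OF f'(2) r'(3) f'z kz] .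
    also have "\<dots> = FArr G (i (Suc j)) \<bullet> (FArr G (q (Suc (Suc j))) \<bullet> v)"
      unfolding Gd using GS(1)[of "Suc j"] GS(2)[of "Suc (Suc j)"] r'(3) by simp
    finally have yr: "y \<bullet> r' = FArr G (i (Suc j)) \<bullet> (FArr G (q (Suc (Suc j))) \<bullet> v)" .
    have qv: "FArr G (q (Suc (Suc j))) \<bullet> v \<in> Hom D s' (FObj G (K (Suc (Suc j))))"
      using GS(2)[of "Suc (Suc j)"] r'(3) by simp
    have "x \<bullet> (r \<bullet> r') = FArr G (q (Suc j)) \<bullet> (y \<bullet> r')"
      using D.Cmp_eq[OF r(4) r'(2) r(3) GS(2)] x(1) r(2) r'(2) by simp
    also have "\<dots> = Zer D (FObj G (K (Suc (Suc j)))) (FObj G (K (Suc j))) \<bullet> (FArr G (q (Suc (Suc j))) \<bullet> v)"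
      unfolding yr using D.Cmp_eq[OF GS(5)[of "Suc j"] qv GS(1)[of "Suc j"] GS(2)[of "Suc j"]] .
    also have "\<dots> = Zer D s' (FObj G (K (Suc j)))" using qv Sd(9) by simp
    finally have "x \<bullet> (r \<bullet> r') = Zer D s' (FObj G (K (Suc j)))" .
    moreover have "r \<bullet> r' \<in> Hom D s' t" using r(2) r'(2) by simp
    ultimately show "x = Zer D t (FObj G (K (Suc j)))"
      using D.epic_Zer[OF D.epic_Cmp[OF r'(1) r(1) r'(2) r(2)] _ _ x(1)] by blast
  qed
  then have "tor1_zero (K j)" using tor1_zero_of_presentation[OF S(2) S(4)] by blast
  then show ?thesis
    using C.syz_iff_syzygies[of tor1_zero K i P q j 0, OF tor1_zero_stable S(2,4)] S(1) by simp
qed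

text \<open>In \<open>0 \<rightarrow> N \<rightarrow> K \<rightarrow> N' \<rightarrow> 0\<close> the
  vanishing for \<open>N\<close> needs one degree more for \<open>N'\<close>. The budget
  \<open>j + m\<close> is thus constant along the coresolution.\<close>

lemma tor_zero_finite_coresolved:
  assumes "enough_projectives C" "N \<in> finite_coresolved C m M" "j + m \<le> n"
    and "additive_subcategory C M" and "\<And>i u. \<lbrakk>i \<le> n; u \<in> M\<rbrakk> \<Longrightarrow> tor_zero i u"
  shows "tor_zero j N"
  using assms(2,3)
proof (induction m arbitrary: j N)
  case 0
  then show ?case using C.finite_coresolved_0[OF assms(4)] assms(5) by simp
next
  case (Suc m)
  then obtain f K g N' where K: "short_exact C N f K g N'" "K \<in> M" "N' \<in> finite_coresolved C m M"
    using C.finite_coresolved_Suc by blast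
  have "tor_zero (Suc j) N'" using Suc.IH[OF K(3), of "Suc j"] Suc.prems(2) by simp
  moreover have "tor_zero j K" using assms(5)[OF _ K(2)] Suc.prems(2) by simp
  ultimately show ?case using tor_zero_long_exact[OF assms(1) K(1)] by blast
qed

section \<open>The comma category is abelian\<close>

abbreviation E :: "(('o1, 'o2, 'm2) comma_obj, ('o1, 'm1, 'o2, 'm2) comma_arr) cat" where
  "E \<equiv> comma C D G"

lemma comma_Obj [simp]: "(c, d, \<alpha>) \<in> Obj E \<longleftrightarrow> c \<in> Obj C \<and> d \<in> Obj D \<and> \<alpha> \<in> Hom D (FObj G c) d"
  by (simp add: comma_def comma_objs_def)

lemma comma_Arr [simp]:
  "((c, d, \<alpha>), (f, g), (c', d', \<alpha>')) \<in> Arr E \<longleftrightarrow>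
     (c, d, \<alpha>) \<in> Obj E \<and> (c', d', \<alpha>') \<in> Obj E \<and> f \<in> Hom C c c' \<and> g \<in> Hom D d d' \<and>
     g \<bullet> \<alpha> = \<alpha>' \<bullet> FArr G f"
  by (simp add: comma_def comma_arrs_def comma_objs_def)

lemma comma_simps [simp]:
  "Dom E (s, h, t) = s" "Cod E (s, h, t) = t"
  "Idt E (c, d, \<alpha>) = ((c, d, \<alpha>), (Idt C c, Idt D d), (c, d, \<alpha>))"
  "Cmp E (s', (f', g'), t') (s, (f, g), t) = (s, (f' \<cdot>\<^bsub>C\<^esub> f, g' \<bullet> g), t')"
  "Pls E (s, (f, g), t) (s', (f', g'), t') = (s, (f \<boxplus>\<^bsub>C\<^esub> f', g \<uplus> g'), t)"
  "Zer E (c, d, \<alpha>) (c', d', \<alpha>') = ((c, d, \<alpha>), (Zer C c c', Zer D d d'), (c', d', \<alpha>'))"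
  by (simp_all add: comma_def)

lemma comma_HomI:
  assumes "(c, d, \<alpha>) \<in> Obj E" "(c', d', \<alpha>') \<in> Obj E" "f \<in> Hom C c c'" "g \<in> Hom D d d'"
    "g \<bullet> \<alpha> = \<alpha>' \<bullet> FArr G f"
  shows "((c, d, \<alpha>), (f, g), (c', d', \<alpha>')) \<in> Hom E (c, d, \<alpha>) (c', d', \<alpha>')"
  using assms by simp

lemma comma_Arr_cases:
  assumes "x \<in> Arr E"
  obtains c d \<alpha> f g c' d' \<alpha>' where "x = ((c, d, \<alpha>), (f, g), (c', d', \<alpha>'))"
  by (metis prod.exhaust_sel)

lemma comma_HomD:
  assumes "((c, d, \<alpha>), (f, g), (c', d', \<alpha>')) \<in> Hom E s t"
  shows "s = (c, d, \<alpha>)" "t = (c', d', \<alpha>')" "c \<in> Obj C" "d \<in> Obj D" "\<alpha> \<in> Hom D (FObj G c) d"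
    "c' \<in> Obj C" "d' \<in> Obj D" "\<alpha>' \<in> Hom D (FObj G c') d'"
    "f \<in> Hom C c c'" "g \<in> Hom D d d'" "g \<bullet> \<alpha> = \<alpha>' \<bullet> FArr G f"
  using assms by simp_all

lemma comma_HomE:
  assumes "x \<in> Hom E (c, d, \<alpha>) (c', d', \<alpha>')"
  obtains f g where "x = ((c, d, \<alpha>), (f, g), (c', d', \<alpha>'))" "f \<in> Hom C c c'" "g \<in> Hom D d d'"
    "g \<bullet> \<alpha> = \<alpha>' \<bullet> FArr G f"
proof -
  obtain s f g t where x: "x = (s, (f, g), t)" by (metis prod.exhaust_sel)
  have st: "s = (c, d, \<alpha>)" "t = (c', d', \<alpha>')" using assms unfolding x by simp_all
  show ?thesis
    by (rule that[OF x[unfolded st]]) (use comma_HomD(9-11)[OF assms[unfolded x st]] in blast)+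
qed

lemma comma_category: "category E"
proof (unfold_locales)
  fix f assume f: "f \<in> Arr E"
  then obtain c d \<alpha> g h c' d' \<alpha>' where x: "f = ((c, d, \<alpha>), (g, h), (c', d', \<alpha>'))" by (rule comma_Arr_cases)
  show "Dom E f \<in> Obj E" "Cod E f \<in> Obj E" using f unfolding x by simp_all
next
  fix a assume a: "a \<in> Obj E"
  obtain c d \<alpha> where x: "a = (c, d, \<alpha>)" by (metis prod.exhaust_sel)
  show "Idt E a \<in> Hom E a a" using a unfolding x by simp
next
  fix f a b assume f: "f \<in> Hom E a b"
  obtain c d \<alpha> c' d' \<alpha>' where x: "a = (c, d, \<alpha>)" "b = (c', d', \<alpha>')" by (metis prod.exhaust_sel)
  obtain g h where g: "f = ((c, d, \<alpha>), (g, h), (c', d', \<alpha>'))" using f unfolding x by (rule comma_HomE)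
  show "f \<cdot>\<^bsub>E\<^esub> Idt E a = f" "Idt E b \<cdot>\<^bsub>E\<^esub> f = f" using f unfolding x g by simp_all
next
  fix f a b g a'
  assume f: "f \<in> Hom E a b" and g: "g \<in> Hom E b a'"
  obtain c1 d1 \<alpha>1 c2 d2 \<alpha>2 c3 d3 \<alpha>3 where x: "a = (c1, d1, \<alpha>1)" "b = (c2, d2, \<alpha>2)" "a' = (c3, d3, \<alpha>3)"
    by (metis prod.exhaust_sel)
  obtain f1 f2 where f': "f = (a, (f1, f2), b)" "f1 \<in> Hom C c1 c2" "f2 \<in> Hom D d1 d2"
    "f2 \<bullet> \<alpha>1 = \<alpha>2 \<bullet> FArr G f1" using f unfolding x by (rule comma_HomE)
  obtain g1 g2 where g': "g = (b, (g1, g2), a')" "g1 \<in> Hom C c2 c3" "g2 \<in> Hom D d2 d3"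
    "g2 \<bullet> \<alpha>2 = \<alpha>3 \<bullet> FArr G g1" using g unfolding x by (rule comma_HomE)
  have o: "a \<in> Obj E" "b \<in> Obj E" "a' \<in> Obj E" using f g unfolding f'(1) g'(1) x by simp_all
  have A: "\<alpha>1 \<in> Hom D (FObj G c1) d1" "\<alpha>2 \<in> Hom D (FObj G c2) d2" "\<alpha>3 \<in> Hom D (FObj G c3) d3"
    using o unfolding x by simp_all
  have "g2 \<bullet> (f2 \<bullet> \<alpha>1) = (\<alpha>3 \<bullet> FArr G g1) \<bullet> FArr G f1"
    unfolding f'(4) using D.Cmp_eq[OF g'(4) FArr_Hom[OF f'(2)] A(2) g'(3)] .
  then have "(g2 \<bullet> f2) \<bullet> \<alpha>1 = \<alpha>3 \<bullet> FArr G (g1 \<cdot>\<^bsub>C\<^esub> f1)"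
    using f'(2,3) g'(2,3) A by simp
  then show "g \<cdot>\<^bsub>E\<^esub> f \<in> Hom E a a'" unfolding f'(1) g'(1) using o f'(2,3) g'(2,3) unfolding x by simp
next
  fix f a b g a' h b'
  assume f: "f \<in> Hom E a b" and g: "g \<in> Hom E b a'" and h: "h \<in> Hom E a' b'"
  obtain c1 d1 \<alpha>1 c2 d2 \<alpha>2 c3 d3 \<alpha>3 c4 d4 \<alpha>4 where x: "a = (c1, d1, \<alpha>1)" "b = (c2, d2, \<alpha>2)"
    "a' = (c3, d3, \<alpha>3)" "b' = (c4, d4, \<alpha>4)"
    by (metis prod.exhaust_sel)
  obtain f1 f2 where f': "f = (a, (f1, f2), b)" "f1 \<in> Hom C c1 c2" "f2 \<in> Hom D d1 d2"
    using f unfolding x by (rule comma_HomE)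
  obtain g1 g2 where g': "g = (b, (g1, g2), a')" "g1 \<in> Hom C c2 c3" "g2 \<in> Hom D d2 d3"
    using g unfolding x by (rule comma_HomE)
  obtain h1 h2 where h': "h = (a', (h1, h2), b')" "h1 \<in> Hom C c3 c4" "h2 \<in> Hom D d3 d4"
    using h unfolding x by (rule comma_HomE)
  show "h \<cdot>\<^bsub>E\<^esub> (g \<cdot>\<^bsub>E\<^esub> f) = (h \<cdot>\<^bsub>E\<^esub> g) \<cdot>\<^bsub>E\<^esub> f"
    unfolding f'(1) g'(1) h'(1) using f'(2,3) g'(2,3) h'(2,3) by simp
qed

lemma comma_Pls_Hom:
  assumes "((c, d, \<alpha>), (f, g), (c', d', \<alpha>')) \<in> Hom E s t" "((c, d, \<alpha>), (f', g'), (c', d', \<alpha>')) \<in> Hom E s t"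
  shows "((c, d, \<alpha>), (f \<boxplus>\<^bsub>C\<^esub> f', g \<uplus> g'), (c', d', \<alpha>')) \<in> Hom E s t"
proof -
  note F = comma_HomD[OF assms(1)] and G = comma_HomD[OF assms(2)]
  have "(g \<uplus> g') \<bullet> \<alpha> = \<alpha>' \<bullet> FArr G (f \<boxplus>\<^bsub>C\<^esub> f')"
    using F(5,8-11) G(9-11) by simp
  then show ?thesis using F G(9,10) by simp
qed

text \<open>Compatibility with the two injections already forces the structure arrow, since
  \<open>G\<close> preserves the decomposition of the identity of \<open>c\<close>.\<close>

lemma comma_biproduct:
  assumes "is_biproduct C c1 c2 c i j p q" "is_biproduct D d1 d2 d i' j' p' q'"
    and "\<alpha>1 \<in> Hom D (FObj G c1) d1" "\<alpha>2 \<in> Hom D (FObj G c2) d2"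
  shows "\<exists>\<alpha>. is_biproduct E (c1, d1, \<alpha>1) (c2, d2, \<alpha>2) (c, d, \<alpha>) ((c1, d1, \<alpha>1), (i, i'), (c, d, \<alpha>))
    ((c2, d2, \<alpha>2), (j, j'), (c, d, \<alpha>)) ((c, d, \<alpha>), (p, p'), (c1, d1, \<alpha>1)) ((c, d, \<alpha>), (q, q'), (c2, d2, \<alpha>2))"
proof -
  note B = C.biproductD[OF assms(1)] and B' = D.biproductD[OF assms(2)]
  have o: "c1 \<in> Obj C" "c2 \<in> Obj C" "c \<in> Obj C" "d1 \<in> Obj D" "d2 \<in> Obj D" "d \<in> Obj D"
    using C.biproduct_Obj[OF assms(1)] D.biproduct_Obj[OF assms(2)] by blast+
  define \<alpha> where "\<alpha> = (i' \<bullet> \<alpha>1) \<bullet> FArr G p \<uplus> (j' \<bullet> \<alpha>2) \<bullet> FArr G q"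
  have \<alpha>: "\<alpha> \<in> Hom D (FObj G c) d" unfolding \<alpha>_def using B(3,4) B'(1,2) assms(3,4) by simp
  have Gpi: "FArr G p \<bullet> FArr G i = Idt D (FObj G c1)" "FArr G q \<bullet> FArr G i = Zer D (FObj G c1) (FObj G c2)"
    "FArr G p \<bullet> FArr G j = Zer D (FObj G c2) (FObj G c1)" "FArr G q \<bullet> FArr G j = Idt D (FObj G c2)"
    using FArr_Cmp[OF B(1,3)] FArr_Cmp[OF B(1,4)] FArr_Cmp[OF B(2,3)] FArr_Cmp[OF B(2,4)] B(5-8) o by simp_all
  have 1: "i' \<bullet> \<alpha>1 = \<alpha> \<bullet> FArr G i" "j' \<bullet> \<alpha>2 = \<alpha> \<bullet> FArr G j"
    unfolding \<alpha>_def using B(1-4) B'(1,2) assms(3,4) Gpi o by simp_all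
  have 2: "p' \<bullet> \<alpha> = \<alpha>1 \<bullet> FArr G p" "q' \<bullet> \<alpha> = \<alpha>2 \<bullet> FArr G q"
    unfolding \<alpha>_def using B(1-4) B'(1-4) assms(3,4) o D.biproduct_simps[OF assms(2)] by simp_all
  show ?thesis
    unfolding is_biproduct_def
    by (intro exI[of _ \<alpha>] conjI) (use B B' o \<alpha> assms(3,4) 1 2 in simp_all)
qed

lemma comma_additive: "additive_category E"
proof -
  interpret E: category E by (rule comma_category)
  show ?thesis
  proof (rule additive_category.intro[OF comma_category], rule additive_category_axioms.intro)
    fix a b assume ab: "a \<in> Obj E" "b \<in> Obj E"
    obtain c d \<alpha> c' d' \<alpha>' where x: "a = (c, d, \<alpha>)" "b = (c', d', \<alpha>')" by (metis prod.exhaust_sel)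
    have o: "c \<in> Obj C" "d \<in> Obj D" "\<alpha> \<in> Hom D (FObj G c) d" "c' \<in> Obj C" "d' \<in> Obj D"
      "\<alpha>' \<in> Hom D (FObj G c') d'" using ab unfolding x by simp_all
    show "comm_group (Hom_group E a b)"
    proof (rule comm_groupI; unfold Hom_group_def monoid.simps partial_object.simps)
      fix u v assume u: "u \<in> Hom E a b" and v: "v \<in> Hom E a b"
      obtain f g where f: "u = ((c, d, \<alpha>), (f, g), (c', d', \<alpha>'))" "f \<in> Hom C c c'" "g \<in> Hom D d d'"
        using u unfolding x by (rule comma_HomE)
      obtain f' g' where f': "v = ((c, d, \<alpha>), (f', g'), (c', d', \<alpha>'))" "f' \<in> Hom C c c'" "g' \<in> Hom D d d'"
        using v unfolding x by (rule comma_HomE)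
      show "u \<boxplus>\<^bsub>E\<^esub> v \<in> Hom E a b" using comma_Pls_Hom u v unfolding f(1) f'(1) comma_simps by blast
      show "u \<boxplus>\<^bsub>E\<^esub> v = v \<boxplus>\<^bsub>E\<^esub> u" unfolding f(1) f'(1) comma_simps
        using C.Pls_commute[of f f'] D.Pls_commute[of g g'] f(2,3) f'(2,3) by simp
    next
      fix u assume u: "u \<in> Hom E a b"
      obtain f g where f: "u = ((c, d, \<alpha>), (f, g), (c', d', \<alpha>'))" "f \<in> Hom C c c'" "g \<in> Hom D d d'"
        "g \<bullet> \<alpha> = \<alpha>' \<bullet> FArr G f" using u unfolding x by (rule comma_HomE)
      show "Zer E a b \<boxplus>\<^bsub>E\<^esub> u = u" unfolding x f(1) using f(2,3) by simp
      have "((c, d, \<alpha>), (C.Neg f, D.Neg g), (c', d', \<alpha>')) \<in> Hom E a b"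
        unfolding x using o f(2-4) by simp
      moreover have "((c, d, \<alpha>), (C.Neg f, D.Neg g), (c', d', \<alpha>')) \<boxplus>\<^bsub>E\<^esub> u = Zer E a b"
        unfolding x f(1) using f(2,3) by simp
      ultimately show "\<exists>y\<in>Hom E a b. y \<boxplus>\<^bsub>E\<^esub> u = Zer E a b" by blast
    next
      fix u v w assume u: "u \<in> Hom E a b" and v: "v \<in> Hom E a b" and w: "w \<in> Hom E a b"
      obtain f g where f: "u = ((c, d, \<alpha>), (f, g), (c', d', \<alpha>'))" "f \<in> Hom C c c'" "g \<in> Hom D d d'"
        using u unfolding x by (rule comma_HomE)
      obtain f' g' where f': "v = ((c, d, \<alpha>), (f', g'), (c', d', \<alpha>'))" "f' \<in> Hom C c c'" "g' \<in> Hom D d d'"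
        using v unfolding x by (rule comma_HomE)
      obtain f'' g'' where f'': "w = ((c, d, \<alpha>), (f'', g''), (c', d', \<alpha>'))" "f'' \<in> Hom C c c'" "g'' \<in> Hom D d d'"
        using w unfolding x by (rule comma_HomE)
      show "u \<boxplus>\<^bsub>E\<^esub> v \<boxplus>\<^bsub>E\<^esub> w = u \<boxplus>\<^bsub>E\<^esub> (v \<boxplus>\<^bsub>E\<^esub> w)" unfolding f(1) f'(1) f''(1) comma_simps
        using f(2,3) f'(2,3) f''(2,3) by simp
    next
      show "Zer E a b \<in> Hom E a b" unfolding x using o by simp
    qed
  next
    fix f a b g c h assume f: "f \<in> Hom E a b" and g: "g \<in> Hom E b c" and h: "h \<in> Hom E b c"
    obtain c1 d1 \<alpha>1 c2 d2 \<alpha>2 c3 d3 \<alpha>3 where x: "a = (c1, d1, \<alpha>1)" "b = (c2, d2, \<alpha>2)" "c = (c3, d3, \<alpha>3)"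
      by (metis prod.exhaust_sel)
    obtain f1 f2 where f': "f = (a, (f1, f2), b)" "f1 \<in> Hom C c1 c2" "f2 \<in> Hom D d1 d2"
      using f unfolding x by (rule comma_HomE)
    obtain g1 g2 where g': "g = (b, (g1, g2), c)" "g1 \<in> Hom C c2 c3" "g2 \<in> Hom D d2 d3"
      using g unfolding x by (rule comma_HomE)
    obtain h1 h2 where h': "h = (b, (h1, h2), c)" "h1 \<in> Hom C c2 c3" "h2 \<in> Hom D d2 d3"
      using h unfolding x by (rule comma_HomE)
    show "(g \<boxplus>\<^bsub>E\<^esub> h) \<cdot>\<^bsub>E\<^esub> f = g \<cdot>\<^bsub>E\<^esub> f \<boxplus>\<^bsub>E\<^esub> h \<cdot>\<^bsub>E\<^esub> f"
      unfolding f'(1) g'(1) h'(1) using f'(2,3) g'(2,3) h'(2,3) by simp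
  next
    fix f a b g h c assume f: "f \<in> Hom E a b" and g: "g \<in> Hom E a b" and h: "h \<in> Hom E b c"
    obtain c1 d1 \<alpha>1 c2 d2 \<alpha>2 c3 d3 \<alpha>3 where x: "a = (c1, d1, \<alpha>1)" "b = (c2, d2, \<alpha>2)" "c = (c3, d3, \<alpha>3)"
      by (metis prod.exhaust_sel)
    obtain f1 f2 where f': "f = (a, (f1, f2), b)" "f1 \<in> Hom C c1 c2" "f2 \<in> Hom D d1 d2"
      using f unfolding x by (rule comma_HomE)
    obtain g1 g2 where g': "g = (a, (g1, g2), b)" "g1 \<in> Hom C c1 c2" "g2 \<in> Hom D d1 d2"
      using g unfolding x by (rule comma_HomE)
    obtain h1 h2 where h': "h = (b, (h1, h2), c)" "h1 \<in> Hom C c2 c3" "h2 \<in> Hom D d2 d3"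
      using h unfolding x by (rule comma_HomE)
    show "h \<cdot>\<^bsub>E\<^esub> (f \<boxplus>\<^bsub>E\<^esub> g) = h \<cdot>\<^bsub>E\<^esub> f \<boxplus>\<^bsub>E\<^esub> h \<cdot>\<^bsub>E\<^esub> g"
      unfolding f'(1) g'(1) h'(1) using f'(2,3) g'(2,3) h'(2,3) by simp
  next
    obtain z z' where z: "is_zero_object C z" "is_zero_object D z'"
      using C.ex_zero_object D.ex_zero_object by blast
    have zO: "z \<in> Obj C" "z' \<in> Obj D" using z by (simp_all add: is_zero_object_def)
    define \<zeta> where "\<zeta> = Zer D (FObj G z) z'"
    have \<zeta>: "\<zeta> \<in> Hom D (FObj G z) z'" unfolding \<zeta>_def using zO by simp
    have "is_zero_object E (z, z', \<zeta>)"
      unfolding is_zero_object_def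
    proof (intro conjI ballI)
      show "(z, z', \<zeta>) \<in> Obj E" using zO \<zeta> by simp
      fix a assume a: "a \<in> Obj E"
      obtain c d \<alpha> where x: "a = (c, d, \<alpha>)" by (metis prod.exhaust_sel)
      have o: "c \<in> Obj C" "d \<in> Obj D" "\<alpha> \<in> Hom D (FObj G c) d" using a unfolding x by simp_all
      show "\<exists>!f. f \<in> Hom E (z, z', \<zeta>) a"
      proof (rule ex1I[of _ "Zer E (z, z', \<zeta>) a"])
        show "Zer E (z, z', \<zeta>) a \<in> Hom E (z, z', \<zeta>) a" unfolding x using o zO \<zeta> by simp
        fix f assume "f \<in> Hom E (z, z', \<zeta>) a"
        then obtain g h where "f = ((z, z', \<zeta>), (g, h), (c, d, \<alpha>))" "g \<in> Hom C z c" "h \<in> Hom D z' d"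
          unfolding x by (rule comma_HomE)
        then show "f = Zer E (z, z', \<zeta>) a" unfolding x comma_simps
          using C.from_zero[OF z(1)] D.from_zero[OF z(2)] by blast
      qed
      show "\<exists>!f. f \<in> Hom E a (z, z', \<zeta>)"
      proof (rule ex1I[of _ "Zer E a (z, z', \<zeta>)"])
        show "Zer E a (z, z', \<zeta>) \<in> Hom E a (z, z', \<zeta>)" unfolding x using o zO \<zeta> by simp
        fix f assume "f \<in> Hom E a (z, z', \<zeta>)"
        then obtain g h where "f = ((c, d, \<alpha>), (g, h), (z, z', \<zeta>))" "g \<in> Hom C c z" "h \<in> Hom D d z'"
          unfolding x by (rule comma_HomE)
        then show "f = Zer E a (z, z', \<zeta>)" unfolding x comma_simps
          using C.to_zero[OF z(1)] D.to_zero[OF z(2)] by blast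
      qed
    qed
    then show "\<exists>z. is_zero_object E z" by blast
  next
    fix a b assume ab: "a \<in> Obj E" "b \<in> Obj E"
    obtain c d \<alpha> c' d' \<alpha>' where x: "a = (c, d, \<alpha>)" "b = (c', d', \<alpha>')" by (metis prod.exhaust_sel)
    have o: "c \<in> Obj C" "d \<in> Obj D" "\<alpha> \<in> Hom D (FObj G c) d" "c' \<in> Obj C" "d' \<in> Obj D"
      "\<alpha>' \<in> Hom D (FObj G c') d'" using ab unfolding x by simp_all
    obtain s i j p q where s: "is_biproduct C c c' s i j p q" using C.ex_biproduct[OF o(1,4)] .
    obtain s' i' j' p' q' where s': "is_biproduct D d d' s' i' j' p' q'" using D.ex_biproduct[OF o(2,5)] .
    obtain \<beta> where b: "is_biproduct E a b (s, s', \<beta>) (a, (i, i'), (s, s', \<beta>)) (b, (j, j'), (s, s', \<beta>))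
      ((s, s', \<beta>), (p, p'), a) ((s, s', \<beta>), (q, q'), b)"
      using comma_biproduct[OF s s' o(3,6)] unfolding x by blast
    then have "(s, s', \<beta>) \<in> Obj E" unfolding is_biproduct_def x by simp
    then show "\<exists>s\<in>Obj E. is_direct_sum E a b s" using b unfolding is_direct_sum_def by blast
  qed
qed

end

sublocale right_exact_abelian \<subseteq> E: additive_category "comma C D G"
  by (rule comma_additive)

context right_exact_abelian
begin

lemma comma_Obj_cases: "(\<And>c d \<alpha>. x = (c, d, \<alpha>) \<Longrightarrow> P) \<Longrightarrow> P" for x :: "('o1, 'o2, 'm2) comma_obj"
  by (metis prod.exhaust_sel)

section \<open>Monos, epis, kernels and cokernels of the comma category, componentwise\<close>

lemma comma_monicI:
  assumes "((c, d, \<alpha>), (f, g), (c', d', \<alpha>')) \<in> Hom E (c, d, \<alpha>) (c', d', \<alpha>')" "monic C f" "monic D g"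
  shows "monic E ((c, d, \<alpha>), (f, g), (c', d', \<alpha>'))"
proof (rule E.monicI[OF assms(1)])
  note m = comma_HomD[OF assms(1)]
  fix t y assume y: "y \<in> Hom E t (c, d, \<alpha>)" "((c, d, \<alpha>), (f, g), (c', d', \<alpha>')) \<cdot>\<^bsub>E\<^esub> y = Zer E t (c', d', \<alpha>')"
  obtain a b \<tau> where t: "t = (a, b, \<tau>)" by (rule comma_Obj_cases)
  obtain u v where u: "y = ((a, b, \<tau>), (u, v), (c, d, \<alpha>))" "u \<in> Hom C a c" "v \<in> Hom D b d"
    using y(1) unfolding t by (rule comma_HomE)
  have "f \<cdot>\<^bsub>C\<^esub> u = Zer C a c'" "g \<bullet> v = Zer D b d'" using y(2) unfolding t u(1) by simp_all
  then have "u = Zer C a c" "v = Zer D b d"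
    using C.monic_Zer[OF assms(2) _ m(9) u(2)] D.monic_Zer[OF assms(3) _ m(10) u(3)] by blast+
  then show "y = Zer E t (c, d, \<alpha>)" unfolding t u(1) by simp
qed

lemma comma_epicI:
  assumes "((c, d, \<alpha>), (f, g), (c', d', \<alpha>')) \<in> Hom E (c, d, \<alpha>) (c', d', \<alpha>')" "epic C f" "epic D g"
  shows "epic E ((c, d, \<alpha>), (f, g), (c', d', \<alpha>'))"
proof (rule E.epicI[OF assms(1)])
  note m = comma_HomD[OF assms(1)]
  fix t y assume y: "y \<in> Hom E (c', d', \<alpha>') t" "y \<cdot>\<^bsub>E\<^esub> ((c, d, \<alpha>), (f, g), (c', d', \<alpha>')) = Zer E (c, d, \<alpha>) t"
  obtain a b \<tau> where t: "t = (a, b, \<tau>)" by (rule comma_Obj_cases)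
  obtain u v where u: "y = ((c', d', \<alpha>'), (u, v), (a, b, \<tau>))" "u \<in> Hom C c' a" "v \<in> Hom D d' b"
    using y(1) unfolding t by (rule comma_HomE)
  have "u \<cdot>\<^bsub>C\<^esub> f = Zer C c a" "v \<bullet> g = Zer D d b" using y(2) unfolding t u(1) by simp_all
  then have "u = Zer C c' a" "v = Zer D d' b"
    using C.epic_Zer[OF assms(2) _ m(9) u(2)] D.epic_Zer[OF assms(3) _ m(10) u(3)] by blast+
  then show "y = Zer E (c', d', \<alpha>') t" unfolding t u(1) by simp
qed

definition zeroC :: 'o1 where "zeroC = (SOME z. is_zero_object C z)"
definition zeroD :: 'o2 where "zeroD = (SOME z. is_zero_object D z)"

lemma zeroC: "is_zero_object C zeroC" "zeroC \<in> Obj C"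
proof -
  show "is_zero_object C zeroC" unfolding zeroC_def using someI_ex[OF C.ex_zero_object] .
  then show "zeroC \<in> Obj C" by (simp add: is_zero_object_def)
qed

lemma zeroD: "is_zero_object D zeroD" "zeroD \<in> Obj D"
proof -
  show "is_zero_object D zeroD" unfolding zeroD_def using someI_ex[OF D.ex_zero_object] .
  then show "zeroD \<in> Obj D" by (simp add: is_zero_object_def)
qed

text \<open>\<open>left_obj\<close> and \<open>right_obj\<close> are left adjoint to the two projections, and \<open>left_zero_obj\<close> is right
  adjoint to the first one; they test exactness and projectivity componentwise.\<close>

definition left_obj :: "'o1 \<Rightarrow> ('o1, 'o2, 'm2) comma_obj" where
  "left_obj c = (c, FObj G c, Idt D (FObj G c))"

definition right_obj :: "'o2 \<Rightarrow> ('o1, 'o2, 'm2) comma_obj" where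
  "right_obj d = (zeroC, d, Zer D (FObj G zeroC) d)"

definition left_zero_obj :: "'o1 \<Rightarrow> ('o1, 'o2, 'm2) comma_obj" where
  "left_zero_obj c = (c, zeroD, Zer D (FObj G c) zeroD)"

lemma comma_Obj_intros:
  "c \<in> Obj C \<Longrightarrow> (c, FObj G c, Idt D (FObj G c)) \<in> Obj E"
  "d \<in> Obj D \<Longrightarrow> (zeroC, d, Zer D (FObj G zeroC) d) \<in> Obj E"
  "c \<in> Obj C \<Longrightarrow> (c, zeroD, Zer D (FObj G c) zeroD) \<in> Obj E"
  using zeroC(2) zeroD(2) by simp_all

lemma from_left_obj:
  assumes "(c, d, \<alpha>) \<in> Obj E" "y \<in> Hom C t c"
  shows "(left_obj t, (y, \<alpha> \<bullet> FArr G y), (c, d, \<alpha>)) \<in> Hom E (left_obj t) (c, d, \<alpha>)"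
  unfolding left_obj_def using assms C.Hom_Obj[OF assms(2)] by simp

lemma from_right_obj:
  assumes "(c, d, \<alpha>) \<in> Obj E" "y \<in> Hom D t d"
  shows "(right_obj t, (Zer C zeroC c, y), (c, d, \<alpha>)) \<in> Hom E (right_obj t) (c, d, \<alpha>)"
  unfolding right_obj_def using assms D.Hom_Obj[OF assms(2)] zeroC(2) by simp

lemma to_left_zero_obj:
  assumes "(c, d, \<alpha>) \<in> Obj E" "y \<in> Hom C c t"
  shows "((c, d, \<alpha>), (y, Zer D d zeroD), left_zero_obj t) \<in> Hom E (c, d, \<alpha>) (left_zero_obj t)"
  unfolding left_zero_obj_def using assms C.Hom_Obj[OF assms(2)] zeroD(2) by simp

text \<open>Arrows into \<open>right_obj t\<close> correspond to arrows to \<open>t\<close> out of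
  the cokernel of \<open>\<alpha>\<close>; this makes \<open>right_obj\<close> the test object for
  cokernels of structure arrows.\<close>

lemma to_right_obj:
  assumes "(c, d, \<alpha>) \<in> Obj E" "y \<in> Hom D d t" "y \<bullet> \<alpha> = Zer D (FObj G c) t"
  shows "((c, d, \<alpha>), (Zer C c zeroC, y), right_obj t) \<in> Hom E (c, d, \<alpha>) (right_obj t)"
  unfolding right_obj_def using assms D.Hom_Obj[OF assms(2)] zeroC(2) by simp

text \<open>An arrow killed by a component is transposed to one from \<open>left_obj t\<close>,
  respectively \<open>right_obj t\<close>, and cancelled in the comma category.\<close>

lemma comma_monicD:
  assumes "((c, d, \<alpha>), (f, g), (c', d', \<alpha>')) \<in> Hom E (c, d, \<alpha>) (c', d', \<alpha>')"
    "monic E ((c, d, \<alpha>), (f, g), (c', d', \<alpha>'))"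
  shows "monic C f" "monic D g"
proof -
  note m = comma_HomD[OF assms(1)]
  have o: "(c, d, \<alpha>) \<in> Obj E" using m by simp
  show "monic C f"
  proof (rule C.monicI[OF m(9)])
    fix t y assume y: "y \<in> Hom C t c" "f \<cdot>\<^bsub>C\<^esub> y = Zer C t c'"
    have to: "t \<in> Obj C" using C.Hom_Obj[OF y(1)] by blast
    have "g \<bullet> (\<alpha> \<bullet> FArr G y) = \<alpha>' \<bullet> FArr G (f \<cdot>\<^bsub>C\<^esub> y)"
      using D.Cmp_eq[OF m(11) FArr_Hom[OF y(1)] m(5,10)] m(8,9) y(1) by simp
    also have "\<dots> = Zer D (FObj G t) d'" unfolding y(2) using m(6,8) to by simp
    finally have "((c, d, \<alpha>), (f, g), (c', d', \<alpha>')) \<cdot>\<^bsub>E\<^esub> (left_obj t, (y, \<alpha> \<bullet> FArr G y), (c, d, \<alpha>)) =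
        Zer E (left_obj t) (c', d', \<alpha>')"
      unfolding left_obj_def using y(2) by simp
    then have "(left_obj t, (y, \<alpha> \<bullet> FArr G y), (c, d, \<alpha>)) = Zer E (left_obj t) (c, d, \<alpha>)"
      using E.monic_Zer[OF assms(2) _ assms(1) from_left_obj[OF o y(1)]] by blast
    then show "y = Zer C t c" unfolding left_obj_def by simp
  qed
  show "monic D g"
  proof (rule D.monicI[OF m(10)])
    fix t y assume y: "y \<in> Hom D t d" "g \<bullet> y = Zer D t d'"
    have "((c, d, \<alpha>), (f, g), (c', d', \<alpha>')) \<cdot>\<^bsub>E\<^esub> (right_obj t, (Zer C zeroC c, y), (c, d, \<alpha>)) =
        Zer E (right_obj t) (c', d', \<alpha>')"
      unfolding right_obj_def using y(2) m(9) zeroC(2) by simp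
    then have "(right_obj t, (Zer C zeroC c, y), (c, d, \<alpha>)) = Zer E (right_obj t) (c, d, \<alpha>)"
      using E.monic_Zer[OF assms(2) _ assms(1) from_right_obj[OF o y(1)]] by blast
    then show "y = Zer D t d" unfolding right_obj_def by simp
  qed
qed

lemma comma_epicD:
  assumes "((c, d, \<alpha>), (f, g), (c', d', \<alpha>')) \<in> Hom E (c, d, \<alpha>) (c', d', \<alpha>')"
    "epic E ((c, d, \<alpha>), (f, g), (c', d', \<alpha>'))"
  shows "epic C f" "epic D g"
proof -
  note m = comma_HomD[OF assms(1)]
  have o: "(c', d', \<alpha>') \<in> Obj E" using m by simp
  show ef: "epic C f"
  proof (rule C.epicI[OF m(9)])
    fix t y assume y: "y \<in> Hom C c' t" "y \<cdot>\<^bsub>C\<^esub> f = Zer C c t"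
    have "((c', d', \<alpha>'), (y, Zer D d' zeroD), left_zero_obj t) \<cdot>\<^bsub>E\<^esub> ((c, d, \<alpha>), (f, g), (c', d', \<alpha>')) =
        Zer E (c, d, \<alpha>) (left_zero_obj t)"
      unfolding left_zero_obj_def using y(2) m(10) zeroD(2) by simp
    then have "((c', d', \<alpha>'), (y, Zer D d' zeroD), left_zero_obj t) = Zer E (c', d', \<alpha>') (left_zero_obj t)"
      using E.epic_Zer[OF assms(2) _ assms(1) to_left_zero_obj[OF o y(1)]] by blast
    then show "y = Zer C c' t" unfolding left_zero_obj_def by simp
  qed
  show "epic D g"
  proof (rule D.epicI[OF m(10)])
    fix t y assume y: "y \<in> Hom D d' t" "y \<bullet> g = Zer D d t"
    have to: "t \<in> Obj D" using D.Hom_Obj[OF y(1)] by blast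
    \<comment> \<open>To define an arrow into \<open>right_obj t\<close>, \<open>y\<close> has to
      kill \<open>\<alpha>'\<close>. This follows by cancelling \<open>FArr G f\<close>, which is
      epic because the first component has been settled before.\<close>
    have "(y \<bullet> \<alpha>') \<bullet> FArr G f = y \<bullet> (g \<bullet> \<alpha>)"
      unfolding m(11) using y(1) m(8,9) by simp
    also have "\<dots> = Zer D (FObj G c) t"
      using D.Cmp_eq[OF y(2) m(5,10) y(1)] m(5) to by simp
    finally have ya: "y \<bullet> \<alpha>' = Zer D (FObj G c') t"
      using D.epic_Zer[OF FArr_epic[OF ef m(9)] _ FArr_Hom[OF m(9)], of "y \<bullet> \<alpha>'" t] y(1) m(8) by simp
    have "((c', d', \<alpha>'), (Zer C c' zeroC, y), right_obj t) \<cdot>\<^bsub>E\<^esub> ((c, d, \<alpha>), (f, g), (c', d', \<alpha>')) =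
        Zer E (c, d, \<alpha>) (right_obj t)"
      unfolding right_obj_def using y(2) m(9) zeroC(2) by simp
    then have "((c', d', \<alpha>'), (Zer C c' zeroC, y), right_obj t) = Zer E (c', d', \<alpha>') (right_obj t)"
      using E.epic_Zer[OF assms(2) _ assms(1) to_right_obj[OF o y(1) ya]] by blast
    then show "y = Zer D d' t" unfolding right_obj_def by simp
  qed
qed

lemma comma_kernelI:
  assumes "((a, b, \<kappa>), (k, l), (c, d, \<alpha>)) \<in> Hom E (a, b, \<kappa>) (c, d, \<alpha>)"
    and "((c, d, \<alpha>), (f, g), (c', d', \<alpha>')) \<in> Hom E (c, d, \<alpha>) (c', d', \<alpha>')"
    and "is_kernel C f k" "is_kernel D g l"
  shows "is_kernel E ((c, d, \<alpha>), (f, g), (c', d', \<alpha>')) ((a, b, \<kappa>), (k, l), (c, d, \<alpha>))"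
proof (rule E.is_kernelI[OF assms(2,1)])
  note m = comma_HomD[OF assms(1)] and n = comma_HomD[OF assms(2)]
  have mono: "monic C k" "monic D l" using C.is_kernel_monic[OF assms(3)] D.is_kernel_monic[OF assms(4)] .
  then show "monic E ((a, b, \<kappa>), (k, l), (c, d, \<alpha>))" using comma_monicI[OF assms(1)] by blast
  show "((c, d, \<alpha>), (f, g), (c', d', \<alpha>')) \<cdot>\<^bsub>E\<^esub> ((a, b, \<kappa>), (k, l), (c, d, \<alpha>)) = Zer E (a, b, \<kappa>) (c', d', \<alpha>')"
    using C.is_kernelD(2)[OF assms(3) n(9)] D.is_kernelD(2)[OF assms(4) n(10)] m(9,10) by simp
  fix t h assume h: "h \<in> Hom E t (c, d, \<alpha>)" "((c, d, \<alpha>), (f, g), (c', d', \<alpha>')) \<cdot>\<^bsub>E\<^esub> h = Zer E t (c', d', \<alpha>')"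
  obtain x y \<tau> where t: "t = (x, y, \<tau>)" by (rule comma_Obj_cases)
  obtain u v where u: "h = ((x, y, \<tau>), (u, v), (c, d, \<alpha>))" "u \<in> Hom C x c" "v \<in> Hom D y d"
    "v \<bullet> \<tau> = \<alpha> \<bullet> FArr G u" using h(1) unfolding t by (rule comma_HomE)
  have o: "(x, y, \<tau>) \<in> Obj E" "(a, b, \<kappa>) \<in> Obj E" using h(1) assms(1) unfolding t u(1) by simp_all
  have z: "f \<cdot>\<^bsub>C\<^esub> u = Zer C x c'" "g \<bullet> v = Zer D y d'" using h(2) unfolding t u(1) by simp_all
  obtain u' where u': "u' \<in> Hom C x a" "k \<cdot>\<^bsub>C\<^esub> u' = u"
    using C.is_kernel_lift[OF assms(3) n(9) m(9) u(2) z(1)] by blast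
  obtain v' where v': "v' \<in> Hom D y b" "l \<bullet> v' = v"
    using D.is_kernel_lift[OF assms(4) n(10) m(10) u(3) z(2)] by blast
  have \<tau>: "\<tau> \<in> Hom D (FObj G x) y" using o(1) by simp
  \<comment> \<open>The componentwise lifts are compatible with the structure arrows after
    composition with \<open>l\<close>, and \<open>l\<close> is monic.\<close>
  have "l \<bullet> (v' \<bullet> \<tau>) = \<alpha> \<bullet> FArr G (k \<cdot>\<^bsub>C\<^esub> u')"
    using D.Cmp_eq[OF v'(2) \<tau> v'(1) m(10)] u(4) u'(2) by simp
  also have "\<dots> = (\<alpha> \<bullet> FArr G k) \<bullet> FArr G u'" using m(8,9) u'(1) by simp
  also have "\<dots> = l \<bullet> (\<kappa> \<bullet> FArr G u')" using D.Cmp_eq[OF m(11) FArr_Hom[OF u'(1)] m(5,10)] by simp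
  finally have "v' \<bullet> \<tau> = \<kappa> \<bullet> FArr G u'"
    using D.monic_cancel[OF mono(2) _ m(10), of "v' \<bullet> \<tau>" "\<kappa> \<bullet> FArr G u'" "FObj G x"] v'(1) \<tau> m(5) u'(1) by simp
  then have "((x, y, \<tau>), (u', v'), (a, b, \<kappa>)) \<in> Hom E t (a, b, \<kappa>)" unfolding t using o u'(1) v'(1) by simp
  then show "\<exists>u\<in>Hom E t (a, b, \<kappa>). ((a, b, \<kappa>), (k, l), (c, d, \<alpha>)) \<cdot>\<^bsub>E\<^esub> u = h"
    using u'(2) v'(2) unfolding t u(1) by (intro bexI[of _ "((x, y, \<tau>), (u', v'), (a, b, \<kappa>))"]) simp_all
qed

lemma comma_cokernelI:
  assumes "((a, b, \<kappa>), (k, l), (c, d, \<alpha>)) \<in> Hom E (a, b, \<kappa>) (c, d, \<alpha>)"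
    and "((c, d, \<alpha>), (f, g), (c', d', \<alpha>')) \<in> Hom E (c, d, \<alpha>) (c', d', \<alpha>')"
    and "is_cokernel C k f" "is_cokernel D l g"
  shows "is_cokernel E ((a, b, \<kappa>), (k, l), (c, d, \<alpha>)) ((c, d, \<alpha>), (f, g), (c', d', \<alpha>'))"
proof (rule E.is_cokernelI[OF assms(1,2)])
  note m = comma_HomD[OF assms(1)] and n = comma_HomD[OF assms(2)]
  have ep: "epic C f" "epic D g" using C.is_cokernel_epic[OF assms(3)] D.is_cokernel_epic[OF assms(4)] .
  then show "epic E ((c, d, \<alpha>), (f, g), (c', d', \<alpha>'))" using comma_epicI[OF assms(2)] by blast
  show "((c, d, \<alpha>), (f, g), (c', d', \<alpha>')) \<cdot>\<^bsub>E\<^esub> ((a, b, \<kappa>), (k, l), (c, d, \<alpha>)) = Zer E (a, b, \<kappa>) (c', d', \<alpha>')"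
    using C.is_cokernelD(2)[OF assms(3) m(9)] D.is_cokernelD(2)[OF assms(4) m(10)] n(9,10) by simp
  fix t h assume h: "h \<in> Hom E (c, d, \<alpha>) t" "h \<cdot>\<^bsub>E\<^esub> ((a, b, \<kappa>), (k, l), (c, d, \<alpha>)) = Zer E (a, b, \<kappa>) t"
  obtain x y \<tau> where t: "t = (x, y, \<tau>)" by (rule comma_Obj_cases)
  obtain u v where u: "h = ((c, d, \<alpha>), (u, v), (x, y, \<tau>))" "u \<in> Hom C c x" "v \<in> Hom D d y"
    "v \<bullet> \<alpha> = \<tau> \<bullet> FArr G u" using h(1) unfolding t by (rule comma_HomE)
  have o: "(x, y, \<tau>) \<in> Obj E" "(c', d', \<alpha>') \<in> Obj E" using h(1) assms(2) unfolding t u(1) by simp_all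
  have z: "u \<cdot>\<^bsub>C\<^esub> k = Zer C a x" "v \<bullet> l = Zer D b y" using h(2) unfolding t u(1) by simp_all
  obtain u' where u': "u' \<in> Hom C c' x" "u' \<cdot>\<^bsub>C\<^esub> f = u"
    using C.is_cokernel_lift[OF assms(3) m(9) n(9) u(2) z(1)] by blast
  obtain v' where v': "v' \<in> Hom D d' y" "v' \<bullet> g = v"
    using D.is_cokernel_lift[OF assms(4) m(10) n(10) u(3) z(2)] by blast
  have \<tau>: "\<tau> \<in> Hom D (FObj G x) y" using o(1) by simp
  have "(v' \<bullet> \<alpha>') \<bullet> FArr G f = v' \<bullet> (g \<bullet> \<alpha>)" unfolding n(11) using v'(1) n(8,9) by simp
  also have "\<dots> = \<tau> \<bullet> FArr G (u' \<cdot>\<^bsub>C\<^esub> f)" using D.Cmp_eq[OF v'(2) n(5,10) v'(1)] u(4) u'(2) by simp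
  also have "\<dots> = (\<tau> \<bullet> FArr G u') \<bullet> FArr G f" using \<tau> n(9) u'(1) by simp
  finally have "v' \<bullet> \<alpha>' = \<tau> \<bullet> FArr G u'"
    using D.epic_cancel[OF FArr_epic[OF ep(1) n(9)] _ FArr_Hom[OF n(9)], of "v' \<bullet> \<alpha>'" "\<tau> \<bullet> FArr G u'" y]
      v'(1) \<tau> n(8) u'(1) by simp
  then have "((c', d', \<alpha>'), (u', v'), (x, y, \<tau>)) \<in> Hom E (c', d', \<alpha>') t" unfolding t using o u'(1) v'(1) by simp
  then show "\<exists>u\<in>Hom E (c', d', \<alpha>') t. u \<cdot>\<^bsub>E\<^esub> ((c, d, \<alpha>), (f, g), (c', d', \<alpha>')) = h"
    using u'(2) v'(2) unfolding t u(1) by (intro bexI[of _ "((c', d', \<alpha>'), (u', v'), (x, y, \<tau>))"]) simp_all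
qed

lemma comma_kernel:
  assumes "((c, d, \<alpha>), (f, g), (c', d', \<alpha>')) \<in> Hom E (c, d, \<alpha>) (c', d', \<alpha>')"
    and "is_kernel C f k" "is_kernel D g l" "k \<in> Hom C a c" "l \<in> Hom D b d"
  shows "\<exists>\<kappa>. ((a, b, \<kappa>), (k, l), (c, d, \<alpha>)) \<in> Hom E (a, b, \<kappa>) (c, d, \<alpha>)"
proof -
  note n = comma_HomD[OF assms(1)]
  have o: "a \<in> Obj C" "b \<in> Obj D" using C.Hom_Obj[OF assms(4)] D.Hom_Obj[OF assms(5)] by blast+
  have fk: "f \<cdot>\<^bsub>C\<^esub> k = Zer C a c'" using C.is_kernelD(2)[OF assms(2) n(9)] assms(4) by simp
  have ak: "\<alpha> \<bullet> FArr G k \<in> Hom D (FObj G a) d" using n(5) assms(4) by simp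
  have "g \<bullet> (\<alpha> \<bullet> FArr G k) = \<alpha>' \<bullet> FArr G (f \<cdot>\<^bsub>C\<^esub> k)"
    using D.Cmp_eq[OF n(11) FArr_Hom[OF assms(4)] n(5,10)] n(8,9) assms(4) by simp
  also have "\<dots> = Zer D (FObj G a) d'" unfolding fk using o n(6,8) by simp
  finally obtain \<kappa> where "\<kappa> \<in> Hom D (FObj G a) b" "l \<bullet> \<kappa> = \<alpha> \<bullet> FArr G k"
    using D.is_kernel_lift[OF assms(3) n(10) assms(5) ak] by blast
  then show ?thesis using o n assms(4,5) by (intro exI[of _ \<kappa>]) simp
qed

text \<open>The structure arrow must start at \<open>FObj G c'\<close>. It is induced because
  \<open>G\<close> preserves the cokernel of \<open>k\<close>, which is where right exactness
  enters.\<close>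

lemma comma_cokernel:
  assumes "((a, b, \<kappa>), (k, l), (c, d, \<alpha>)) \<in> Hom E (a, b, \<kappa>) (c, d, \<alpha>)"
    and "is_cokernel C k f" "is_cokernel D l g" "f \<in> Hom C c c'" "g \<in> Hom D d d'"
  shows "\<exists>\<alpha>'. ((c, d, \<alpha>), (f, g), (c', d', \<alpha>')) \<in> Hom E (c, d, \<alpha>) (c', d', \<alpha>')"
proof -
  note n = comma_HomD[OF assms(1)]
  have o: "c' \<in> Obj C" "d' \<in> Obj D" using C.Hom_Obj[OF assms(4)] D.Hom_Obj[OF assms(5)] by blast+
  have gl: "g \<bullet> l = Zer D b d'" using D.is_cokernelD(2)[OF assms(3) n(10)] assms(5) by simp
  have ga: "g \<bullet> \<alpha> \<in> Hom D (FObj G c) d'" using n(8) assms(5) by simp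
  have "g \<bullet> \<alpha> \<bullet> FArr G k = (g \<bullet> l) \<bullet> \<kappa>"
    using n(5,8,9,10,11) assms(5) by simp
  also have "\<dots> = Zer D (FObj G a) d'" unfolding gl using n(5) o by simp
  finally obtain \<gamma> where "\<gamma> \<in> Hom D (FObj G c') d'" "\<gamma> \<bullet> FArr G f = g \<bullet> \<alpha>"
    using D.is_cokernel_lift[OF FArr_cokernel[OF assms(2) n(9) assms(4)] FArr_Hom[OF n(9)] FArr_Hom[OF assms(4)] ga]
    by blast
  then show ?thesis using o n assms(4,5) by (intro exI[of _ \<gamma>]) simp
qed

lemma comma_abelian: "abelian_category E"
proof (rule abelian_category.intro[OF comma_additive], rule abelian_category_axioms.intro)
  fix x assume xA: "x \<in> Arr E"
  then obtain c d \<alpha> f g c' d' \<alpha>' where x: "x = ((c, d, \<alpha>), (f, g), (c', d', \<alpha>'))" by (rule comma_Arr_cases)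
  have h: "((c, d, \<alpha>), (f, g), (c', d', \<alpha>')) \<in> Hom E (c, d, \<alpha>) (c', d', \<alpha>')" using xA unfolding x by simp
  note m = comma_HomD[OF h]
  obtain a k b l where k: "k \<in> Hom C a c" "is_kernel C f k" "l \<in> Hom D b d" "is_kernel D g l"
    using C.ex_kernel_Hom[OF m(9)] D.ex_kernel_Hom[OF m(10)] by blast
  obtain \<kappa> where "((a, b, \<kappa>), (k, l), (c, d, \<alpha>)) \<in> Hom E (a, b, \<kappa>) (c, d, \<alpha>)"
    using comma_kernel[OF h k(2,4,1,3)] by blast
  then show "\<exists>k. is_kernel E x k" unfolding x using comma_kernelI[OF _ h k(2,4)] by blast
  obtain a k b l where k: "k \<in> Hom C c' a" "is_cokernel C f k" "l \<in> Hom D d' b" "is_cokernel D g l"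
    using C.ex_cokernel_Hom[OF m(9)] D.ex_cokernel_Hom[OF m(10)] by blast
  obtain \<kappa> where "((c', d', \<alpha>'), (k, l), (a, b, \<kappa>)) \<in> Hom E (c', d', \<alpha>') (a, b, \<kappa>)"
    using comma_cokernel[OF h k(2,4,1,3)] by blast
  then show "\<exists>k. is_cokernel E x k" unfolding x using comma_cokernelI[OF h _ k(2,4)] by blast
next
  fix x assume mx: "monic E x"
  then have xA: "x \<in> Arr E" by simp
  then obtain c d \<alpha> f g c' d' \<alpha>' where x: "x = ((c, d, \<alpha>), (f, g), (c', d', \<alpha>'))" by (rule comma_Arr_cases)
  have h: "((c, d, \<alpha>), (f, g), (c', d', \<alpha>')) \<in> Hom E (c, d, \<alpha>) (c', d', \<alpha>')" using xA unfolding x by simp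
  note m = comma_HomD[OF h] and mono = comma_monicD[OF h mx[unfolded x]]
  obtain a k b l where k: "k \<in> Hom C c' a" "is_cokernel C f k" "l \<in> Hom D d' b" "is_cokernel D g l"
    using C.ex_cokernel_Hom[OF m(9)] D.ex_cokernel_Hom[OF m(10)] by blast
  obtain \<kappa> where \<kappa>: "((c', d', \<alpha>'), (k, l), (a, b, \<kappa>)) \<in> Hom E (c', d', \<alpha>') (a, b, \<kappa>)"
    using comma_cokernel[OF h k(2,4,1,3)] by blast
  show "\<exists>g. is_kernel E g x" unfolding x
    using comma_kernelI[OF h \<kappa> C.is_kernel_of_cokernel[OF mono(1) k(2) m(9) k(1)]
        D.is_kernel_of_cokernel[OF mono(2) k(4) m(10) k(3)]] by blast
next
  fix x assume mx: "epic E x"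
  then have xA: "x \<in> Arr E" by simp
  then obtain c d \<alpha> f g c' d' \<alpha>' where x: "x = ((c, d, \<alpha>), (f, g), (c', d', \<alpha>'))" by (rule comma_Arr_cases)
  have h: "((c, d, \<alpha>), (f, g), (c', d', \<alpha>')) \<in> Hom E (c, d, \<alpha>) (c', d', \<alpha>')" using xA unfolding x by simp
  note m = comma_HomD[OF h] and ep = comma_epicD[OF h mx[unfolded x]]
  obtain a k b l where k: "k \<in> Hom C a c" "is_kernel C f k" "l \<in> Hom D b d" "is_kernel D g l"
    using C.ex_kernel_Hom[OF m(9)] D.ex_kernel_Hom[OF m(10)] by blast
  obtain \<kappa> where \<kappa>: "((a, b, \<kappa>), (k, l), (c, d, \<alpha>)) \<in> Hom E (a, b, \<kappa>) (c, d, \<alpha>)"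
    using comma_kernel[OF h k(2,4,1,3)] by blast
  show "\<exists>g. is_cokernel E g x" unfolding x
    using comma_cokernelI[OF \<kappa> h C.is_cokernel_of_kernel[OF ep(1) k(2) m(9) k(1)]
        D.is_cokernel_of_kernel[OF ep(2) k(4) m(10) k(3)]] by blast
qed

end

sublocale right_exact_abelian \<subseteq> E: abelian_category "comma C D G"
  by (rule comma_abelian)

context right_exact_abelian
begin

lemma comma_short_exactI:
  assumes "((a, b, \<kappa>), (k, l), (c, d, \<alpha>)) \<in> Hom E (a, b, \<kappa>) (c, d, \<alpha>)"
    and "((c, d, \<alpha>), (f, g), (c', d', \<alpha>')) \<in> Hom E (c, d, \<alpha>) (c', d', \<alpha>')"
    and "short_exact C a k c f c'" "short_exact D b l d g d'"
  shows "short_exact E (a, b, \<kappa>) ((a, b, \<kappa>), (k, l), (c, d, \<alpha>)) (c, d, \<alpha>) ((c, d, \<alpha>), (f, g), (c', d', \<alpha>')) (c', d', \<alpha>')"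
proof -
  note S = C.short_exactD[OF assms(3)] and T = D.short_exactD[OF assms(4)]
  show ?thesis
    using E.short_exact_of_kernel[OF comma_kernelI[OF assms(1,2) S(5) T(5)] comma_epicI[OF assms(2) S(4) T(4)] assms(1,2)] .
qed

text \<open>Exactness in the middle is again tested on \<open>left_obj t\<close> for the first
  component and on \<open>right_obj t\<close> for the second.\<close>

lemma comma_short_exactD:
  assumes "short_exact E (a, b, \<kappa>) x (c, d, \<alpha>) y (c', d', \<alpha>')"
  shows "\<exists>k l f g. x = ((a, b, \<kappa>), (k, l), (c, d, \<alpha>)) \<and> y = ((c, d, \<alpha>), (f, g), (c', d', \<alpha>')) \<and>
    x \<in> Hom E (a, b, \<kappa>) (c, d, \<alpha>) \<and> y \<in> Hom E (c, d, \<alpha>) (c', d', \<alpha>') \<and>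
    short_exact C a k c f c' \<and> short_exact D b l d g d'"
proof -
  note S = E.short_exactD[OF assms]
  obtain k l where x: "x = ((a, b, \<kappa>), (k, l), (c, d, \<alpha>))" using S(1) by (rule comma_HomE)
  obtain f g where y: "y = ((c, d, \<alpha>), (f, g), (c', d', \<alpha>'))" using S(2) by (rule comma_HomE)
  note m = comma_HomD[OF S(1)[unfolded x]] and n = comma_HomD[OF S(2)[unfolded y]]
  note mono = comma_monicD[OF S(1,3)[unfolded x]] and ep = comma_epicD[OF S(2,4)[unfolded y]]
  have z: "f \<cdot>\<^bsub>C\<^esub> k = Zer C a c'" "g \<bullet> l = Zer D b d'" using S(7) unfolding x y by simp_all
  have o: "(c, d, \<alpha>) \<in> Obj E" using S(10) .
  have "short_exact C a k c f c'"
  proof (rule C.short_exactI_kernel[OF m(9) n(9) mono(1) ep(1) z(1)])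
    fix t w assume w: "w \<in> Hom C t c" "f \<cdot>\<^bsub>C\<^esub> w = Zer C t c'"
    have to: "t \<in> Obj C" using C.Hom_Obj[OF w(1)] by blast
    have "g \<bullet> (\<alpha> \<bullet> FArr G w) = \<alpha>' \<bullet> FArr G (f \<cdot>\<^bsub>C\<^esub> w)"
      using D.Cmp_eq[OF n(11) FArr_Hom[OF w(1)] n(5,10)] n(8,9) w(1) by simp
    also have "\<dots> = Zer D (FObj G t) d'" unfolding w(2) using n(6,8) to by simp
    finally have "y \<cdot>\<^bsub>E\<^esub> (left_obj t, (w, \<alpha> \<bullet> FArr G w), (c, d, \<alpha>)) = Zer E (left_obj t) (c', d', \<alpha>')"
      unfolding left_obj_def y using w(2) by simp
    then obtain v where v: "v \<in> Hom E (left_obj t) (a, b, \<kappa>)" "x \<cdot>\<^bsub>E\<^esub> v = (left_obj t, (w, \<alpha> \<bullet> FArr G w), (c, d, \<alpha>))"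
      using E.short_exact_kernel_lift[OF assms from_left_obj[OF o w(1)]] by blast
    obtain v1 v2 where v': "v = (left_obj t, (v1, v2), (a, b, \<kappa>))" "v1 \<in> Hom C t a"
      using v(1) unfolding left_obj_def by (rule comma_HomE)
    show "\<exists>v\<in>Hom C t a. k \<cdot>\<^bsub>C\<^esub> v = w" using v(2) v'(2) unfolding v'(1) x left_obj_def by auto
  qed
  moreover have "short_exact D b l d g d'"
  proof (rule D.short_exactI_kernel[OF m(10) n(10) mono(2) ep(2) z(2)])
    fix t w assume w: "w \<in> Hom D t d" "g \<bullet> w = Zer D t d'"
    have "y \<cdot>\<^bsub>E\<^esub> (right_obj t, (Zer C zeroC c, w), (c, d, \<alpha>)) = Zer E (right_obj t) (c', d', \<alpha>')"
      unfolding right_obj_def y using w(2) n(9) zeroC(2) by simp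
    then obtain v where v: "v \<in> Hom E (right_obj t) (a, b, \<kappa>)" "x \<cdot>\<^bsub>E\<^esub> v = (right_obj t, (Zer C zeroC c, w), (c, d, \<alpha>))"
      using E.short_exact_kernel_lift[OF assms from_right_obj[OF o w(1)]] by blast
    obtain v1 v2 where v': "v = (right_obj t, (v1, v2), (a, b, \<kappa>))" "v2 \<in> Hom D t b"
      using v(1) unfolding right_obj_def by (rule comma_HomE)
    show "\<exists>v\<in>Hom D t b. l \<bullet> v = w" using v(2) v'(2) unfolding v'(1) x right_obj_def by auto
  qed
  ultimately show ?thesis using S(1,2) x y by blast
qed

section \<open>Projectives and Ext in the comma category\<close>

text \<open>The object is \<open>left_obj p\<close> plus \<open>right_obj q\<close>. Lifts can
  therefore be chosen freely on \<open>p\<close> and on \<open>q\<close>; on the summand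
  \<open>FObj G p\<close> the lift is dictated by the structure arrow.\<close>

lemma comma_projectiveI:
  assumes "projective C p" "projective D q" "is_biproduct D (FObj G p) q s i j p1 p2"
  shows "projective E (p, s, i)"
proof -
  note B = D.biproductD[OF assms(3)] and Bo = D.biproduct_Obj[OF assms(3)]
  have pO: "p \<in> Obj C" using assms(1) unfolding projective_def by blast
  have o: "(p, s, i) \<in> Obj E" using pO B(1) Bo by simp
  show ?thesis
  proof (rule E.projectiveI[OF o])
    fix a b x f assume x: "epic E x" "x \<in> Hom E a b" and f: "f \<in> Hom E (p, s, i) b"
    obtain a1 a2 \<alpha> b1 b2 \<beta> where ab: "a = (a1, a2, \<alpha>)" "b = (b1, b2, \<beta>)" by (metis prod.exhaust_sel)
    obtain g1 g2 where g: "x = ((a1, a2, \<alpha>), (g1, g2), (b1, b2, \<beta>))" using x(2) unfolding ab by (rule comma_HomE)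
    obtain f1 f2 where f': "f = ((p, s, i), (f1, f2), (b1, b2, \<beta>))" using f unfolding ab by (rule comma_HomE)
    note M = comma_HomD[OF x(2)[unfolded g ab]] and F = comma_HomD[OF f[unfolded f' ab]]
    note ep = comma_epicD[OF x(2)[unfolded g ab] x(1)[unfolded g]]
    obtain h1 where h1: "h1 \<in> Hom C p a1" "g1 \<cdot>\<^bsub>C\<^esub> h1 = f1"
      using C.projective_lift[OF assms(1) ep(1) M(9) F(9)] by blast
    have "f2 \<bullet> j \<in> Hom D q b2" using F(10) B(2) by simp
    then obtain h' where h': "h' \<in> Hom D q a2" "g2 \<bullet> h' = f2 \<bullet> j"
      using D.projective_lift[OF assms(2) ep(2) M(10)] by blast
    define h2 where "h2 = (\<alpha> \<bullet> FArr G h1) \<bullet> p1 \<uplus> h' \<bullet> p2"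
    have h2: "h2 \<in> Hom D s a2" unfolding h2_def using M(5) h1(1) h'(1) B(3,4) by simp
    have "h2 \<bullet> i = \<alpha> \<bullet> FArr G h1" unfolding h2_def using M(5) h1(1) h'(1) B Bo M(4) by simp
    then have h: "((p, s, i), (h1, h2), (a1, a2, \<alpha>)) \<in> Hom E (p, s, i) (a1, a2, \<alpha>)"
      using o M(3-5) h1(1) h2 by simp
    have "g2 \<bullet> h2 = (g2 \<bullet> (\<alpha> \<bullet> FArr G h1)) \<bullet> p1 \<uplus> (g2 \<bullet> h') \<bullet> p2"
      unfolding h2_def using M(5,10) h1(1) h'(1) B(3,4) by simp
    also have "g2 \<bullet> (\<alpha> \<bullet> FArr G h1) = \<beta> \<bullet> FArr G (g1 \<cdot>\<^bsub>C\<^esub> h1)"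
      using D.Cmp_eq[OF M(11) FArr_Hom[OF h1(1)] M(5,10)] M(8,9) h1(1) by simp
    also have "\<dots> = f2 \<bullet> i" unfolding h1(2) using F(11) by simp
    also have "g2 \<bullet> h' = f2 \<bullet> j" by (rule h'(2))
    also have "(f2 \<bullet> i) \<bullet> p1 \<uplus> (f2 \<bullet> j) \<bullet> p2 = f2"
      using D.biproduct_decomp'[OF assms(3) F(10)] .
    finally have "x \<cdot>\<^bsub>E\<^esub> ((p, s, i), (h1, h2), (a1, a2, \<alpha>)) = f" unfolding g f' using h1(2) by simp
    then show "\<exists>h\<in>Hom E (p, s, i) a. x \<cdot>\<^bsub>E\<^esub> h = f" using h unfolding ab by blast
  qed
qed

text \<open>The monic structure arrow is part of the conclusion because every projective object is a
  retract of such a cover and inherits it.\<close>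

lemma comma_projective_cover:
  assumes "enough_projectives C" "enough_projectives D" "(c, d, \<alpha>) \<in> Obj E"
  shows "\<exists>p s i x. projective E (p, s, i) \<and> monic D i \<and> x \<in> Hom E (p, s, i) (c, d, \<alpha>) \<and> epic E x"
proof -
  have o: "c \<in> Obj C" "d \<in> Obj D" "\<alpha> \<in> Hom D (FObj G c) d" using assms(3) by simp_all
  obtain p e where p: "projective C p" "e \<in> Hom C p c" "epic C e"
    using assms(1) o(1) unfolding enough_projectives_def by blast
  obtain q e' where q: "projective D q" "e' \<in> Hom D q d" "epic D e'"
    using assms(2) o(2) unfolding enough_projectives_def by blast
  have pq: "p \<in> Obj C" "q \<in> Obj D" using p q unfolding projective_def by blast+
  obtain s i j p1 p2 where s: "is_biproduct D (FObj G p) q s i j p1 p2" using D.ex_biproduct[OF FObj_Obj[OF pq(1)] pq(2)] .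
  note B = D.biproductD[OF s] and Bo = D.biproduct_Obj[OF s]
  define g where "g = (\<alpha> \<bullet> FArr G e) \<bullet> p1 \<uplus> e' \<bullet> p2"
  have g: "g \<in> Hom D s d" unfolding g_def using o p(2) q(2) B(3,4) by simp
  have gi: "g \<bullet> i = \<alpha> \<bullet> FArr G e" "g \<bullet> j = e'"
    unfolding g_def using o p(2) q(2) B Bo by simp_all
  have "epic D g" using D.epic_left_factor[OF _ B(2) g] gi(2) q(3) by simp
  moreover have x: "((p, s, i), (e, g), (c, d, \<alpha>)) \<in> Hom E (p, s, i) (c, d, \<alpha>)"
    using o pq Bo B(1) p(2) g gi by simp
  ultimately show ?thesis
    using comma_epicI[OF x p(3)] comma_projectiveI[OF p(1) q(1) s] D.monic_split[OF B(5,1,3)] by blast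
qed

lemma comma_enough_projectives:
  assumes "enough_projectives C" "enough_projectives D"
  shows "enough_projectives E"
  unfolding enough_projectives_def
proof
  fix a assume a: "a \<in> Obj E"
  obtain c d \<alpha> where x: "a = (c, d, \<alpha>)" by (rule comma_Obj_cases)
  show "\<exists>p. projective E p \<and> (\<exists>f\<in>Hom E p a. epic E f)"
    using comma_projective_cover[OF assms a[unfolded x]] unfolding x by blast
qed

text \<open>Lifting against epis between objects \<open>left_zero_obj\<close> tests
  \<open>r\<close>, and against epis between objects \<open>right_obj\<close> tests the cokernel of
  \<open>\<rho>\<close>. For \<open>\<rho>\<close> itself, a section of a cover embeds it into a
  monic structure arrow.\<close>

lemma comma_projectiveD:
  assumes "enough_projectives C" "enough_projectives D" "projective E (r, s, \<rho>)"
  shows "projective C r" "monic D \<rho>" "\<lbrakk>is_cokernel D \<rho> c; c \<in> Hom D s v\<rbrakk> \<Longrightarrow> projective D v"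
proof -
  have o: "(r, s, \<rho>) \<in> Obj E" using assms(3) unfolding projective_def by blast
  then have o': "r \<in> Obj C" "s \<in> Obj D" "\<rho> \<in> Hom D (FObj G r) s" by simp_all
  show "projective C r"
  proof (rule C.projectiveI[OF o'(1)])
    fix x y g f assume g: "epic C g" "g \<in> Hom C x y" and f: "f \<in> Hom C r y"
    have xy: "x \<in> Obj C" "y \<in> Obj C" using C.Hom_Obj[OF g(2)] .
    have m: "(left_zero_obj x, (g, Idt D zeroD), left_zero_obj y) \<in> Hom E (left_zero_obj x) (left_zero_obj y)"
      unfolding left_zero_obj_def using xy g(2) zeroD(2) by simp
    have e: "epic E (left_zero_obj x, (g, Idt D zeroD), left_zero_obj y)"
      using comma_epicI[OF m[unfolded left_zero_obj_def] g(1) D.epic_Idt[OF zeroD(2)]] unfolding left_zero_obj_def .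
    obtain h where h: "h \<in> Hom E (r, s, \<rho>) (left_zero_obj x)"
      "(left_zero_obj x, (g, Idt D zeroD), left_zero_obj y) \<cdot>\<^bsub>E\<^esub> h = ((r, s, \<rho>), (f, Zer D s zeroD), left_zero_obj y)"
      using E.projective_lift[OF assms(3) e m to_left_zero_obj[OF o f]] by blast
    obtain h1 h2 where h': "h = ((r, s, \<rho>), (h1, h2), left_zero_obj x)" "h1 \<in> Hom C r x"
      using h(1) unfolding left_zero_obj_def by (rule comma_HomE)
    show "\<exists>h\<in>Hom C r x. g \<cdot>\<^bsub>C\<^esub> h = f" using h(2) h'(2) unfolding h'(1) left_zero_obj_def by auto
  qed
  show "monic D \<rho>"
  proof -
    obtain p t i x where p: "monic D i" "x \<in> Hom E (p, t, i) (r, s, \<rho>)" "epic E x"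
      using comma_projective_cover[OF assms(1,2) o] by blast
    obtain y where y: "y \<in> Hom E (r, s, \<rho>) (p, t, i)" "x \<cdot>\<^bsub>E\<^esub> y = Idt E (r, s, \<rho>)"
      using E.projective_lift[OF assms(3) p(3,2) E.Idt_Hom[OF o]] by blast
    obtain x1 x2 where x: "x = ((p, t, i), (x1, x2), (r, s, \<rho>))" using p(2) by (rule comma_HomE)
    obtain y1 y2 where y': "y = ((r, s, \<rho>), (y1, y2), (p, t, i))" using y(1) by (rule comma_HomE)
    note X = comma_HomD[OF p(2)[unfolded x]] and Y = comma_HomD[OF y(1)[unfolded y']]
    have "x1 \<cdot>\<^bsub>C\<^esub> y1 = Idt C r" using y(2) unfolding x y' by simp
    then have "FArr G x1 \<bullet> FArr G y1 = Idt D (FObj G r)" using FArr_Cmp[OF Y(9) X(9)] o'(1) by simp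
    then have "monic D (FArr G y1)" using D.monic_split[OF _ FArr_Hom[OF Y(9)] FArr_Hom[OF X(9)]] by blast
    then have "monic D (i \<bullet> FArr G y1)" using D.monic_Cmp[OF _ p(1) FArr_Hom[OF Y(9)] Y(8)] by blast
    then have "monic D (y2 \<bullet> \<rho>)" using Y(11) by simp
    then show ?thesis using D.monic_right_factor[OF _ o'(3) Y(10)] by blast
  qed
  assume c: "is_cokernel D \<rho> c" "c \<in> Hom D s v"
  have vO: "v \<in> Obj D" using D.Hom_Obj[OF c(2)] by blast
  show "projective D v"
  proof (rule D.projectiveI[OF vO])
    fix x y g f assume g: "epic D g" "g \<in> Hom D x y" and f: "f \<in> Hom D v y"
    have xy: "x \<in> Obj D" "y \<in> Obj D" using D.Hom_Obj[OF g(2)] .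
    have m: "(right_obj x, (Idt C zeroC, g), right_obj y) \<in> Hom E (right_obj x) (right_obj y)"
      unfolding right_obj_def using xy g(2) zeroC(2) by simp
    have e: "epic E (right_obj x, (Idt C zeroC, g), right_obj y)"
      using comma_epicI[OF m[unfolded right_obj_def] C.epic_Idt[OF zeroC(2)] g(1)] unfolding right_obj_def .
    have fc: "f \<bullet> c \<in> Hom D s y" using f c(2) by simp
    have c0: "c \<bullet> \<rho> = Zer D (FObj G r) v" using D.is_cokernelD(2)[OF c(1) o'(3)] c(2) by simp
    have fc0: "f \<bullet> c \<bullet> \<rho> = Zer D (FObj G r) y" using f c(2) o' c0 by simp
    obtain h where h: "h \<in> Hom E (r, s, \<rho>) (right_obj x)"
      "(right_obj x, (Idt C zeroC, g), right_obj y) \<cdot>\<^bsub>E\<^esub> h = ((r, s, \<rho>), (Zer C r zeroC, f \<bullet> c), right_obj y)"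
      using E.projective_lift[OF assms(3) e m to_right_obj[OF o fc fc0]] by blast
    obtain h1 h2 where h': "h = ((r, s, \<rho>), (h1, h2), right_obj x)" "h1 \<in> Hom C r zeroC" "h2 \<in> Hom D s x"
      "h2 \<bullet> \<rho> = Zer D (FObj G zeroC) x \<bullet> FArr G h1"
      using h(1) unfolding right_obj_def by (rule comma_HomE)
    have "h2 \<bullet> \<rho> = Zer D (FObj G r) x" unfolding h'(4) using h'(2) xy by simp
    then obtain w where w: "w \<in> Hom D v x" "w \<bullet> c = h2"
      using D.is_cokernel_lift[OF c(1) o'(3) c(2) h'(3)] by blast
    have "(g \<bullet> w) \<bullet> c = g \<bullet> h2" using w g(2) c(2) by simp
    also have "\<dots> = f \<bullet> c" using h(2) unfolding h'(1) right_obj_def by simp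
    finally have "g \<bullet> w = f"
      using D.epic_cancel[OF D.is_cokernel_epic[OF c(1)] _ c(2), of "g \<bullet> w" f y] g(2) w(1) f by simp
    then show "\<exists>h\<in>Hom D v x. g \<bullet> h = f" using w(1) by blast
  qed
qed

text \<open>The first component is extended from \<open>K\<close> to \<open>M\<close> using
  \<open>Ext\<^sup>1(z, x) = 0\<close>. This prescribes the second component on the images of both
  \<open>K'\<close> and \<open>G M\<close> in \<open>M'\<close>; the quotient of \<open>M'\<close>
  by their sum is \<open>v\<close>, so \<open>Ext\<^sup>1(v, y) = 0\<close> extends it to all of
  \<open>M'\<close>.\<close>

lemma comma_ext1_zero:
  assumes "(z, z', \<zeta>) \<in> Obj E" "(x, y, \<beta>) \<in> Obj E" "monic D \<zeta>" "is_cokernel D \<zeta> q" "q \<in> Hom D z' v"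
    and "C.ext1_zero x z" "D.ext1_zero y v"
  shows "E.ext1_zero (x, y, \<beta>) (z, z', \<zeta>)"
  unfolding ses_into_def
proof (intro allI impI)
  fix k0 f0 m0 g0 assume ses: "short_exact E k0 f0 m0 g0 (z, z', \<zeta>)"
  obtain K K' \<kappa> M M' \<mu> where km: "k0 = (K, K', \<kappa>)" "m0 = (M, M', \<mu>)" by (metis prod.exhaust_sel)
  obtain k1 k2 g1 g2 where f: "f0 = ((K, K', \<kappa>), (k1, k2), (M, M', \<mu>))" "g0 = ((M, M', \<mu>), (g1, g2), (z, z', \<zeta>))"
    and fH: "f0 \<in> Hom E (K, K', \<kappa>) (M, M', \<mu>)" and gH: "g0 \<in> Hom E (M, M', \<mu>) (z, z', \<zeta>)"
    and sC: "short_exact C K k1 M g1 z" and sD: "short_exact D K' k2 M' g2 z'"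
    using comma_short_exactD[OF ses[unfolded km]] by blast
  note F = comma_HomD[OF fH[unfolded f]] and H = comma_HomD[OF gH[unfolded f]]
  note SC = C.short_exactD[OF sC] and SD = D.short_exactD[OF sD] and GS = FArr_short_exact[OF sC]
  have \<beta>: "x \<in> Obj C" "y \<in> Obj D" "\<beta> \<in> Hom D (FObj G x) y" using assms(2) by simp_all
  show "extends_along E (x, y, \<beta>) f0"
    unfolding extends_along_iff[OF fH]
  proof
    fix \<phi> assume \<phi>H: "\<phi> \<in> Hom E (K, K', \<kappa>) (x, y, \<beta>)"
    obtain \<phi>1 \<phi>2 where \<phi>: "\<phi> = ((K, K', \<kappa>), (\<phi>1, \<phi>2), (x, y, \<beta>))" "\<phi>1 \<in> Hom C K x" "\<phi>2 \<in> Hom D K' y"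
      "\<phi>2 \<bullet> \<kappa> = \<beta> \<bullet> FArr G \<phi>1" using \<phi>H by (rule comma_HomE)
    obtain \<psi>1 where \<psi>1: "\<psi>1 \<in> Hom C M x" "\<psi>1 \<cdot>\<^bsub>C\<^esub> k1 = \<phi>1" using C.ext1_zeroD[OF assms(6) sC \<phi>(2)] by blast
    obtain s i1 i2 p1 p2 where s: "is_biproduct D K' (FObj G M) s i1 i2 p1 p2"
      using D.ex_biproduct[OF SD(9) FObj_Obj[OF SC(10)]] .
    note B = D.biproductD[OF s] and Bo = D.biproduct_Obj[OF s] and Bs = D.biproduct_simps[OF s]
    \<comment> \<open>\<open>u\<close> maps \<open>K'\<close> and \<open>G M\<close> into
      \<open>M'\<close>, and \<open>\<chi>\<close> is the prescribed arrow on their direct sum. An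
      extension of \<open>\<chi>\<close> along \<open>u\<close> respects the structure arrows
      automatically, by its value on \<open>G M\<close>.\<close>
    define u where "u = k2 \<bullet> p1 \<uplus> \<mu> \<bullet> p2"
    define \<chi> where "\<chi> = \<phi>2 \<bullet> p1 \<uplus> (\<beta> \<bullet> FArr G \<psi>1) \<bullet> p2"
    have b\<psi>: "\<beta> \<bullet> FArr G \<psi>1 \<in> Hom D (FObj G M) y" using \<beta> \<psi>1(1) by simp
    have u: "u \<in> Hom D s M'" unfolding u_def using F(8,10) B(3,4) by simp
    have \<chi>: "\<chi> \<in> Hom D s y" unfolding \<chi>_def using \<phi>(3) b\<psi> B(3,4) by (simp del: D.Cmp_assoc_right)
    have uy: "u \<bullet> w = k2 \<bullet> (p1 \<bullet> w) \<uplus> \<mu> \<bullet> (p2 \<bullet> w)" if "w \<in> Hom D t s" for w t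
      unfolding u_def using F(8,10) B(3,4) that by simp
    have \<chi>y: "\<chi> \<bullet> w = \<phi>2 \<bullet> (p1 \<bullet> w) \<uplus> \<beta> \<bullet> (FArr G \<psi>1 \<bullet> (p2 \<bullet> w))" if "w \<in> Hom D t s" for w t
      unfolding \<chi>_def using \<phi>(3) \<beta> \<psi>1(1) B(3,4) that by simp
    have ui: "u \<bullet> i1 = k2" "u \<bullet> i2 = \<mu>"
      using uy[OF B(1)] uy[OF B(2)] B F(8,10) Bo SD(10) by simp_all
    have \<chi>i: "\<chi> \<bullet> i1 = \<phi>2" "\<chi> \<bullet> i2 = \<beta> \<bullet> FArr G \<psi>1"
      using \<chi>y[OF B(1)] \<chi>y[OF B(2)] B \<phi>(3) \<beta> \<psi>1(1) Bo by simp_all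
    \<comment> \<open>\<open>W\<close> is the sum of the images of \<open>K'\<close> and
      \<open>G M\<close> in \<open>M'\<close>.\<close>
    obtain W w e where e: "epic D e" "monic D w" "e \<in> Hom D s W" "w \<in> Hom D W M'" "w \<bullet> e = u"
      using D.factor[OF u] by blast
    have q0: "q \<bullet> \<zeta> = Zer D (FObj G z) v" using D.is_cokernelD(2)[OF assms(4) H(8)] assms(5) by simp
    have qg: "q \<bullet> g2 \<in> Hom D M' v" using assms(5) H(10) by simp
    have vO: "v \<in> Obj D" using D.Hom_Obj[OF assms(5)] by blast
    have sW: "short_exact D W w M' (q \<bullet> g2) v"
    proof (rule D.short_exactI[OF e(4) qg e(2) D.epic_Cmp[OF SD(4) D.is_cokernel_epic[OF assms(4)] SD(2) assms(5)]])
      have "g2 \<bullet> u = (g2 \<bullet> k2) \<bullet> p1 \<uplus> (g2 \<bullet> \<mu>) \<bullet> p2"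
        unfolding u_def using F(8,10) H(10) B(3,4) by simp
      then have "g2 \<bullet> u = (\<zeta> \<bullet> FArr G g1) \<bullet> p2"
        unfolding SD(7) H(11) using H(8,9) B(3,4) SD(11) by simp
      then have "q \<bullet> (g2 \<bullet> u) = (q \<bullet> \<zeta>) \<bullet> (FArr G g1 \<bullet> p2)"
        using assms(5) H(8,9) B(4) by simp
      then have "(q \<bullet> g2 \<bullet> w) \<bullet> e = Zer D s v"
        unfolding q0 e(5)[symmetric] using assms(5) H(9,10) e(3,4) B(4) vO by simp
      then show "q \<bullet> g2 \<bullet> w = Zer D W v"
        using D.epic_Zer[OF e(1) _ e(3), of "q \<bullet> g2 \<bullet> w" v] qg e(4) by simp
      fix t l assume l: "l \<in> Hom D t M'" "q \<bullet> g2 \<bullet> l = Zer D t v"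
      have gl: "g2 \<bullet> l \<in> Hom D t z'" "q \<bullet> (g2 \<bullet> l) = Zer D t v" using l H(10) assms(5) by simp_all
      \<comment> \<open>An element \<open>l\<close> of \<open>M'\<close> that dies in
        \<open>v\<close> has its image in \<open>z'\<close> coming from \<open>G z\<close>, hence
        from \<open>G M\<close> since \<open>FArr G g1\<close> is epic. Subtracting that element of
        \<open>G M\<close> leaves one of \<open>K'\<close>.\<close>
      obtain s1 r1 a where 1: "epic D r1" "r1 \<in> Hom D s1 t" "a \<in> Hom D s1 (FObj G z)" "\<zeta> \<bullet> a = g2 \<bullet> l \<bullet> r1"
        using D.exactD[OF D.exact_of_cokernel[OF assms(4) H(8) assms(5)] H(8) assms(5) gl] by blast
      obtain s2 r2 b where 2: "epic D r2" "r2 \<in> Hom D s2 s1" "b \<in> Hom D s2 (FObj G M)" "FArr G g1 \<bullet> b = a \<bullet> r2"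
        using D.cover[OF GS(4,2) 1(3)] by blast
      have rr: "r1 \<bullet> r2 \<in> Hom D s2 t" "epic D (r1 \<bullet> r2)" using 1(2) 2(2) D.epic_Cmp[OF 2(1) 1(1) 2(2) 1(2)] by simp_all
      have "g2 \<bullet> (\<mu> \<bullet> b) = \<zeta> \<bullet> (FArr G g1 \<bullet> b)"
        using D.Cmp_eq[OF H(11) 2(3) H(5,10)] H(8,9) 2(3) by simp
      also have "\<dots> = g2 \<bullet> (l \<bullet> (r1 \<bullet> r2))"
        unfolding 2(4) using D.Cmp_eq[OF 1(4) 2(2) 1(3) H(8)] H(10) l(1) 1(2) 2(2) by simp
      finally have "g2 \<bullet> (l \<bullet> (r1 \<bullet> r2)) = g2 \<bullet> (\<mu> \<bullet> b)" by simp
      moreover have lr: "l \<bullet> (r1 \<bullet> r2) \<in> Hom D s2 M'" "\<mu> \<bullet> b \<in> Hom D s2 M'" using l(1) rr(1) H(5) 2(3) by simp_all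
      ultimately obtain n where n: "n \<in> Hom D s2 K'" "l \<bullet> (r1 \<bullet> r2) = \<mu> \<bullet> b \<uplus> k2 \<bullet> n"
        using D.kernel_diff[OF SD(5,2,1)] by blast
      define o' where "o' = i1 \<bullet> n \<uplus> i2 \<bullet> b"
      have o': "o' \<in> Hom D s2 s" unfolding o'_def using n(1) 2(3) B(1,2) by simp
      have "u \<bullet> o' = (u \<bullet> i1) \<bullet> n \<uplus> (u \<bullet> i2) \<bullet> b"
        unfolding o'_def using u B(1,2) n(1) 2(3) by simp
      then have "w \<bullet> (e \<bullet> o') = k2 \<bullet> n \<uplus> \<mu> \<bullet> b"
        unfolding ui using D.Cmp_eq[OF e(5) o' e(3,4)] by simp
      also have "\<dots> = l \<bullet> (r1 \<bullet> r2)"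
        unfolding n(2) using D.Pls_commute[of "k2 \<bullet> n" "\<mu> \<bullet> b"] SD(1) n(1) H(5) 2(3) by simp
      finally have "w \<bullet> (e \<bullet> o') = l \<bullet> (r1 \<bullet> r2)" .
      moreover have "e \<bullet> o' \<in> Hom D s2 W" using e(3) o' by simp
      ultimately show "\<exists>s r x. epic D r \<and> r \<in> Hom D s t \<and> x \<in> Hom D s W \<and> w \<bullet> x = l \<bullet> r"
        using rr by blast
    qed
    obtain N n where n: "n \<in> Hom D N s" "is_kernel D e n" "e \<bullet> n = Zer D N W" using D.ex_kernel_Hom[OF e(3)] by blast
    have NO: "N \<in> Obj D" using D.Hom_Obj[OF n(1)] by blast
    have en: "is_cokernel D n e" using D.is_cokernel_of_kernel[OF e(1) n(2) e(3) n(1)] .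
    \<comment> \<open>The prescription descends from the direct sum to \<open>W\<close>. For an
      element of the kernel of \<open>u\<close>, monicity of \<open>\<zeta>\<close> shows that its
      \<open>G M\<close> part dies in \<open>G z\<close>, so it comes from some \<open>b\<close>
      over \<open>G K\<close>; the \<open>K'\<close> part is then the negative of
      \<open>\<kappa> \<bullet> b\<close>. There both prescriptions agree because
      \<open>\<phi>\<close> is an arrow of the comma category.\<close>
    have "\<chi> \<bullet> n = Zer D N y"
    proof -
      have pn: "p1 \<bullet> n \<in> Hom D N K'" "p2 \<bullet> n \<in> Hom D N (FObj G M)" using n(1) B(3,4) by simp_all
      have "u \<bullet> n = Zer D N M'" using D.Cmp_assoc[OF n(1) e(3,4)] n(3) e(4,5) NO by simp
      then have un: "k2 \<bullet> (p1 \<bullet> n) \<uplus> \<mu> \<bullet> (p2 \<bullet> n) = Zer D N M'" using uy[OF n(1)] by simp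
      have g2k: "g2 \<bullet> (k2 \<bullet> (p1 \<bullet> n)) = Zer D N z'"
        using D.Cmp_eq[OF SD(7) pn(1) SD(1,2)] pn(1) SD(11) by simp
      have g2m: "g2 \<bullet> (\<mu> \<bullet> (p2 \<bullet> n)) = \<zeta> \<bullet> (FArr G g1 \<bullet> (p2 \<bullet> n))"
        using D.Cmp_eq[OF H(11) pn(2) H(5,10)] H(8,9) pn(2) by simp
      have "g2 \<bullet> (k2 \<bullet> (p1 \<bullet> n) \<uplus> \<mu> \<bullet> (p2 \<bullet> n)) =
          g2 \<bullet> (k2 \<bullet> (p1 \<bullet> n)) \<uplus> g2 \<bullet> (\<mu> \<bullet> (p2 \<bullet> n))"
        using SD(1,2) H(5) pn by (simp del: D.Cmp_assoc_right)
      then have "\<zeta> \<bullet> (FArr G g1 \<bullet> (p2 \<bullet> n)) = Zer D N z'"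
        unfolding un g2k g2m using SD(2) NO H(8,9) pn(2) by simp
      then have gp: "FArr G g1 \<bullet> (p2 \<bullet> n) = Zer D N (FObj G z)"
        using D.monic_Zer[OF assms(3) _ H(8), of "FArr G g1 \<bullet> (p2 \<bullet> n)" N] H(9) pn(2) by simp
      obtain s1 r b where r: "epic D r" "r \<in> Hom D s1 N" "b \<in> Hom D s1 (FObj G K)"
        "FArr G k1 \<bullet> b = p2 \<bullet> n \<bullet> r"
        using D.exactD[OF GS(3,1,2) pn(2) gp] by blast
      have nr: "n \<bullet> r \<in> Hom D s1 s" using n(1) r(2) by simp
      have p1r: "p1 \<bullet> (n \<bullet> r) \<in> Hom D s1 K'" using nr B(3) by simp
      have p2r: "p2 \<bullet> (n \<bullet> r) = FArr G k1 \<bullet> b" unfolding r(4) using n(1) r(2) B(4) by simp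
      have kb: "\<kappa> \<bullet> b \<in> Hom D s1 K'" using F(5) r(3) by simp
      have "u \<bullet> (n \<bullet> r) = Zer D s1 M'"
        using D.Cmp_eq[OF \<open>u \<bullet> n = Zer D N M'\<close> r(2) n(1) u] r(2) SD(10) by simp
      then have "k2 \<bullet> (p1 \<bullet> (n \<bullet> r)) \<uplus> \<mu> \<bullet> (FArr G k1 \<bullet> b) = Zer D s1 M'"
        using uy[OF nr] p2r by simp
      also have "\<mu> \<bullet> (FArr G k1 \<bullet> b) = k2 \<bullet> (\<kappa> \<bullet> b)"
        using D.Cmp_eq[OF F(11) r(3) F(5,10)] F(8,9) r(3) by simp
      finally have "k2 \<bullet> (p1 \<bullet> (n \<bullet> r) \<uplus> \<kappa> \<bullet> b) = Zer D s1 M'"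
        using SD(1) p1r kb by (simp del: D.Cmp_assoc_right)
      then have z0: "p1 \<bullet> (n \<bullet> r) \<uplus> \<kappa> \<bullet> b = Zer D s1 K'"
        using D.monic_Zer[OF SD(3) _ SD(1), of "p1 \<bullet> (n \<bullet> r) \<uplus> \<kappa> \<bullet> b" s1] p1r kb
        by (simp del: D.Cmp_assoc_right)
      have "\<chi> \<bullet> (n \<bullet> r) = \<phi>2 \<bullet> (p1 \<bullet> (n \<bullet> r)) \<uplus> \<beta> \<bullet> (FArr G \<psi>1 \<bullet> (FArr G k1 \<bullet> b))"
        unfolding \<chi>y[OF nr] p2r ..
      also have "FArr G \<psi>1 \<bullet> (FArr G k1 \<bullet> b) = FArr G \<phi>1 \<bullet> b"
        using D.Cmp_eq[OF _ r(3) FArr_Hom[OF F(9)] FArr_Hom[OF \<psi>1(1)]] FArr_Cmp[OF F(9) \<psi>1(1)] \<psi>1(2) by simp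
      also have "\<beta> \<bullet> (FArr G \<phi>1 \<bullet> b) = \<phi>2 \<bullet> (\<kappa> \<bullet> b)"
        using D.Cmp_eq[OF \<phi>(4) r(3) F(5) \<phi>(3)] \<beta> \<phi>(2) r(3) by simp
      also have "\<phi>2 \<bullet> (p1 \<bullet> (n \<bullet> r)) \<uplus> \<phi>2 \<bullet> (\<kappa> \<bullet> b) = \<phi>2 \<bullet> (p1 \<bullet> (n \<bullet> r) \<uplus> \<kappa> \<bullet> b)"
        using \<phi>(3) p1r kb by (simp del: D.Cmp_assoc_right)
      also have "\<dots> = Zer D s1 y" unfolding z0 using \<phi>(3) D.Hom_Obj[OF nr] by simp
      finally have "(\<chi> \<bullet> n) \<bullet> r = Zer D s1 y" using \<chi> n(1) r(2) by simp
      then show ?thesis using D.epic_Zer[OF r(1) _ r(2), of "\<chi> \<bullet> n" y] \<chi> n(1) by simp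
    qed
    then obtain \<chi>' where \<chi>': "\<chi>' \<in> Hom D W y" "\<chi>' \<bullet> e = \<chi>" using D.is_cokernel_lift[OF en n(1) e(3) \<chi>] by blast
    obtain \<psi>2 where \<psi>2: "\<psi>2 \<in> Hom D M' y" "\<psi>2 \<bullet> w = \<chi>'" using D.ext1_zeroD[OF assms(7) sW \<chi>'(1)] by blast
    have \<psi>u: "\<psi>2 \<bullet> u = \<chi>" using D.Cmp_eq[OF \<psi>2(2) e(3,4) \<psi>2(1)] e(5) \<chi>'(2) by simp
    have "\<psi>2 \<bullet> k2 = \<phi>2" using D.Cmp_eq[OF \<psi>u B(1) u \<psi>2(1)] ui(1) \<chi>i(1) by simp
    moreover have "\<psi>2 \<bullet> \<mu> = \<beta> \<bullet> FArr G \<psi>1" using D.Cmp_eq[OF \<psi>u B(2) u \<psi>2(1)] ui(2) \<chi>i(2) by simp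
    then have "((M, M', \<mu>), (\<psi>1, \<psi>2), (x, y, \<beta>)) \<in> Hom E (M, M', \<mu>) (x, y, \<beta>)"
      using H(3-5) \<beta> \<psi>1(1) \<psi>2(1) by simp
    ultimately show "\<exists>\<psi>\<in>Hom E (M, M', \<mu>) (x, y, \<beta>). \<psi> \<cdot>\<^bsub>E\<^esub> f0 = \<phi>"
      unfolding f(1) \<phi>(1) using \<psi>1(2) by (intro bexI[of _ "((M, M', \<mu>), (\<psi>1, \<psi>2), (x, y, \<beta>))"]) simp_all
  qed
qed

text \<open>A condition that passes to syzygies, with \<open>m\<close> lowered by one, and forces the groups \<open>Ext\<close> from
  the object to \<open>(x, y, \<beta>)\<close> to vanish in degrees \<open>1, \<dots>, m + 1\<close>.\<close>

definition acyclic_upto :: "'o1 \<Rightarrow> 'o2 \<Rightarrow> nat \<Rightarrow> ('o1, 'o2, 'm2) comma_obj \<Rightarrow> bool" where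
  "acyclic_upto x y m = (\<lambda>(z, z', \<zeta>). (z, z', \<zeta>) \<in> Obj E \<and> monic D \<zeta> \<and>
     (\<forall>i\<le>m. tor_zero i z \<and> syz C (C.ext1_zero x) i z) \<and>
     (\<exists>q v. q \<in> Hom D z' v \<and> is_cokernel D \<zeta> q \<and> (\<forall>i\<le>m. syz D (D.ext1_zero y) i v)))"

text \<open>Vanishing of \<open>L\<^sub>1 G\<close> on \<open>z\<close> makes
  \<open>FArr G k1\<close> monic, and \<open>\<rho>\<close> is monic by projectivity. Since
  \<open>k2 \<bullet> \<kappa> = \<rho> \<bullet> FArr G k1\<close>, the structure arrow
  \<open>\<kappa>\<close> is monic too.\<close>

lemma acyclic_upto_syzygy:
  assumes "enough_projectives C" "enough_projectives D"
    and "acyclic_upto x y (Suc m) (z, z', \<zeta>)" "short_exact E (k, k', \<kappa>) f (r, r', \<rho>) g (z, z', \<zeta>)"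
    and "projective E (r, r', \<rho>)"
  shows "acyclic_upto x y m (k, k', \<kappa>)"
proof -
  have Z: "monic D \<zeta>" "\<And>i. i \<le> Suc m \<Longrightarrow> tor_zero i z" "\<And>i. i \<le> Suc m \<Longrightarrow> syz C (C.ext1_zero x) i z"
    using assms(3) unfolding acyclic_upto_def by auto
  obtain q v where q: "q \<in> Hom D z' v" "is_cokernel D \<zeta> q" "\<And>i. i \<le> Suc m \<Longrightarrow> syz D (D.ext1_zero y) i v"
    using assms(3) unfolding acyclic_upto_def by auto
  obtain k1 k2 g1 g2 where f: "f = ((k, k', \<kappa>), (k1, k2), (r, r', \<rho>))" "g = ((r, r', \<rho>), (g1, g2), (z, z', \<zeta>))"
    and fH: "f \<in> Hom E (k, k', \<kappa>) (r, r', \<rho>)" and gH: "g \<in> Hom E (r, r', \<rho>) (z, z', \<zeta>)"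
    and sC: "short_exact C k k1 r g1 z" and sD: "short_exact D k' k2 r' g2 z'"
    using comma_short_exactD[OF assms(4)] by blast
  note F = comma_HomD[OF fH[unfolded f]] and H = comma_HomD[OF gH[unfolded f]]
  note GS = FArr_short_exact[OF sC]
  note R = comma_projectiveD[OF assms(1,2,5)]
  have "monic D (FArr G k1)" using tor1_zeroD[OF _ sC] Z(2)[of 0] by simp
  then have "monic D (\<rho> \<bullet> FArr G k1)" using D.monic_Cmp[OF _ R(2) GS(1) F(8)] by blast
  then have mono: "monic D \<kappa>" using D.monic_right_factor[OF _ F(5,10)] F(11) by simp
  have tor: "tor_zero i k" if "i \<le> m" for i using tor_zero_any[OF Z(2) sC R(1)] that by simp
  have ext: "syz C (C.ext1_zero x) i k" if "i \<le> m" for i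
    using C.syz_any_presentation[OF C.ext1_zero_stable Z(3) sC R(1)] that by simp
  obtain kv qk where qk: "qk \<in> Hom D k' kv" "is_cokernel D \<kappa> qk" using D.ex_cokernel_Hom[OF F(5)] by blast
  obtain rv qr where qr: "qr \<in> Hom D r' rv" "is_cokernel D \<rho> qr" using D.ex_cokernel_Hom[OF H(5)] by blast
  \<comment> \<open>The snake lemma applies because \<open>\<zeta>\<close> is monic. The cokernel
    \<open>rv\<close> of \<open>\<rho>\<close> is projective, so \<open>kv\<close> is a syzygy of
    \<open>v\<close>.\<close>
  obtain a b where "short_exact D kv a rv b v"
    using D.snake_cokernel[OF GS(3,4,1,2) sD F(5) H(5) H(8) Z(1) F(11) H(11) qk(2) qr(2) q(2) qk(1) qr(1) q(1)]
    by blast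
  then have "syz D (D.ext1_zero y) i kv" if "i \<le> m" for i
    using D.syz_any_presentation[OF D.ext1_zero_stable q(3) _ R(3)[OF qr(2,1)]] that by simp
  then show ?thesis unfolding acyclic_upto_def using F(3-5) mono tor ext qk by auto
qed

lemma acyclic_upto_ext:
  assumes "enough_projectives C" "enough_projectives D" "(x, y, \<beta>) \<in> Obj E"
    and "acyclic_upto x y m p" "j \<le> m"
  shows "syz E (E.ext1_zero (x, y, \<beta>)) j p"
  using assms(4,5)
proof (induction j arbitrary: m p)
  case 0
  obtain z z' \<zeta> where p: "p = (z, z', \<zeta>)" by (rule comma_Obj_cases)
  obtain q v where q: "q \<in> Hom D z' v" "is_cokernel D \<zeta> q" "syz D (D.ext1_zero y) 0 v"
    using 0(1) unfolding acyclic_upto_def p by auto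
  have Z: "(z, z', \<zeta>) \<in> Obj E" "monic D \<zeta>" "syz C (C.ext1_zero x) 0 z"
    using 0(1) unfolding acyclic_upto_def p by auto
  show ?case unfolding p
    using comma_ext1_zero[OF Z(1) assms(3) Z(2) q(2,1)] Z(3) q(3) by simp
next
  case (Suc j)
  obtain m' where m: "m = Suc m'" using Suc.prems(2) by (cases m) auto
  have pO: "p \<in> Obj E" using Suc.prems(1) unfolding acyclic_upto_def by auto
  \<comment> \<open>Any presentation will do, since \<open>acyclic_upto_syzygy\<close> applies to
    all of them.\<close>
  obtain k f r g where ses: "short_exact E k f r g p" "projective E r"
    using E.ex_projective_presentation[OF comma_enough_projectives[OF assms(1,2)] pO] by blast
  obtain z z' \<zeta> k1 k2 \<kappa> r1 r2 \<rho> where e: "p = (z, z', \<zeta>)" "k = (k1, k2, \<kappa>)" "r = (r1, r2, \<rho>)"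
    by (metis prod.exhaust_sel)
  have "acyclic_upto x y m' k"
    using acyclic_upto_syzygy[OF assms(1,2) Suc.prems(1)[unfolded m e] ses[unfolded e]] unfolding e .
  then have "syz E (E.ext1_zero (x, y, \<beta>)) j k" using Suc.IH Suc.prems(2) m by simp
  then show ?case unfolding syz.simps using ses by blast
qed

end

section \<open>The cotorsion pair in the comma category\<close>

context abelian_category
begin

lemma monic_from_zero: "\<lbrakk>is_zero_object E z; f \<in> Hom E z a\<rbrakk> \<Longrightarrow> monic E f"
  by (rule monicI) (use to_zero in blast)+

lemma is_cokernel_from_zero:
  assumes "is_zero_object E z" "f \<in> Hom E z a"
  shows "is_cokernel E f (Idt E a)"
proof -
  have o: "a \<in> Obj E" "z \<in> Obj E" using Hom_Obj[OF assms(2)] by blast+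
  have f: "f = Zer E z a" using from_zero[OF assms] .
  show ?thesis
  proof (rule is_cokernelI[OF assms(2) Idt_Hom[OF o(1)] _ epic_Idt[OF o(1)]])
    show "Idt E a \<cdot> f = Zer E z a" unfolding f using o by simp
    fix t h assume "h \<in> Hom E a t"
    then show "\<exists>u\<in>Hom E a t. u \<cdot> Idt E a = h" by (intro bexI[of _ h]) simp_all
  qed
qed

lemma short_exact_Idt_zero:
  assumes "is_zero_object E z" "a \<in> Obj E"
  shows "short_exact E a (Idt E a) a (Zer E a z) z"
proof -
  have z: "z \<in> Obj E" using assms(1) unfolding is_zero_object_def by blast
  have h: "Zer E a z \<in> Hom E a z" using assms(2) z by simp
  have "is_cokernel E (Idt E a) (Zer E a z)"
  proof (rule is_cokernelI[OF Idt_Hom[OF assms(2)]])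
    show "Zer E a z \<in> Hom E a z" by (rule h)
    show "Zer E a z \<cdot> Idt E a = Zer E a z" using assms(2) z by simp
    show "epic E (Zer E a z)" by (rule epicI[OF h]) (use from_zero[OF assms(1)] in blast)
    fix t g assume g: "g \<in> Hom E a t" "g \<cdot> Idt E a = Zer E a t"
    then have "g = Zer E a t" "t \<in> Obj E" using Hom_Obj[OF g(1)] by simp_all
    then show "\<exists>u\<in>Hom E z t. u \<cdot> Zer E a z = g"
      using assms(2) z by (intro bexI[of _ "Zer E z t"]) simp_all
  qed
  then show ?thesis
    using short_exact_of_cokernel[OF _ monic_Idt[OF assms(2)] Idt_Hom[OF assms(2)]] h by blast
qed

text \<open>Taking cokernels is an additive functor on arrows, so a biproduct decomposition of
  \<open>\<sigma>\<close> into \<open>\<alpha>1\<close> and \<open>\<alpha>2\<close> induces one of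
  cokernels. The identities are checked after cancelling the epis \<open>c1\<close>,
  \<open>c2\<close> and \<open>c\<close>.\<close>

lemma cokernel_direct_sum:
  assumes B: "is_biproduct E w1 w2 s i j p q"
    and \<alpha>: "\<alpha>1 \<in> Hom E x1 w1" "\<alpha>2 \<in> Hom E x2 w2" "\<sigma> \<in> Hom E y s"
    and h: "i' \<in> Hom E x1 y" "j' \<in> Hom E x2 y" "p' \<in> Hom E y x1" "q' \<in> Hom E y x2"
    and eq: "i \<cdot> \<alpha>1 = \<sigma> \<cdot> i'" "j \<cdot> \<alpha>2 = \<sigma> \<cdot> j'"
      "p \<cdot> \<sigma> = \<alpha>1 \<cdot> p'" "q \<cdot> \<sigma> = \<alpha>2 \<cdot> q'"
    and c: "is_cokernel E \<alpha>1 c1" "is_cokernel E \<alpha>2 c2" "is_cokernel E \<sigma> c"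
      "c1 \<in> Hom E w1 v1" "c2 \<in> Hom E w2 v2" "c \<in> Hom E s v"
  shows "is_direct_sum E v1 v2 v"
proof -
  note b = biproductD[OF B]
  have z: "c1 \<cdot> \<alpha>1 = Zer E x1 v1" "c2 \<cdot> \<alpha>2 = Zer E x2 v2" "c \<cdot> \<sigma> = Zer E y v"
    using is_cokernelD(2)[OF c(1) \<alpha>(1)] is_cokernelD(2)[OF c(2) \<alpha>(2)] is_cokernelD(2)[OF c(3) \<alpha>(3)]
      c(4-6) by simp_all
  have o: "v1 \<in> Obj E" "v2 \<in> Obj E" "v \<in> Obj E" "w1 \<in> Obj E" "w2 \<in> Obj E"
    using Hom_Obj c(4-6) by blast+
  note ep = is_cokernel_epic[OF c(1)] is_cokernel_epic[OF c(2)] is_cokernel_epic[OF c(3)]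
  have t: "c \<cdot> i \<in> Hom E w1 v" "c \<cdot> j \<in> Hom E w2 v" "c1 \<cdot> p \<in> Hom E s v1" "c2 \<cdot> q \<in> Hom E s v2"
    using b(1-4) c(4-6) by simp_all
  have "c \<cdot> i \<cdot> \<alpha>1 = Zer E x1 v"
    using Cmp_eq[OF z(3) h(1) \<alpha>(3) c(6)] b(1) c(6) \<alpha>(1) h(1) eq(1) o by simp
  then obtain I where I: "I \<in> Hom E v1 v" "I \<cdot> c1 = c \<cdot> i"
    using is_cokernel_lift[OF c(1) \<alpha>(1) c(4) t(1)] by blast
  have "c \<cdot> j \<cdot> \<alpha>2 = Zer E x2 v"
    using Cmp_eq[OF z(3) h(2) \<alpha>(3) c(6)] b(2) c(6) \<alpha>(2) h(2) eq(2) o by simp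
  then obtain J where J: "J \<in> Hom E v2 v" "J \<cdot> c2 = c \<cdot> j"
    using is_cokernel_lift[OF c(2) \<alpha>(2) c(5) t(2)] by blast
  have "c1 \<cdot> p \<cdot> \<sigma> = Zer E y v1"
    using Cmp_eq[OF z(1) h(3) \<alpha>(1) c(4)] b(3) c(4) \<alpha>(3) h(3) eq(3) o by simp
  then obtain P where P: "P \<in> Hom E v v1" "P \<cdot> c = c1 \<cdot> p"
    using is_cokernel_lift[OF c(3) \<alpha>(3) c(6) t(3)] by blast
  have "c2 \<cdot> q \<cdot> \<sigma> = Zer E y v2"
    using Cmp_eq[OF z(2) h(4) \<alpha>(2) c(5)] b(4) c(5) \<alpha>(3) h(4) eq(4) o by simp
  then obtain Q where Q: "Q \<in> Hom E v v2" "Q \<cdot> c = c2 \<cdot> q"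
    using is_cokernel_lift[OF c(3) \<alpha>(3) c(6) t(4)] by blast
  have comp: "(R \<cdot> K) \<cdot> e = e' \<cdot> (r \<cdot> k)"
    if "K \<in> Hom E a v" "K \<cdot> e = c \<cdot> k" "R \<in> Hom E v a'" "R \<cdot> c = e' \<cdot> r"
      "e \<in> Hom E l a" "k \<in> Hom E l s" "r \<in> Hom E s l'" "e' \<in> Hom E l' a'"
    for R K e e' r k a a' l l'
  proof -
    have "(R \<cdot> K) \<cdot> e = R \<cdot> (c \<cdot> k)" using that(1,2,3,5) by simp
    also have "\<dots> = e' \<cdot> (r \<cdot> k)" using Cmp_eq[OF that(4,6) c(6) that(3)] that(6-8) by simp
    finally show ?thesis .
  qed
  have "(P \<cdot> I) \<cdot> c1 = Idt E v1 \<cdot> c1" using comp[OF I P c(4) b(1,3) c(4)] b(5) c(4) by simp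
  then have PI: "P \<cdot> I = Idt E v1"
    using epic_cancel[OF ep(1) _ c(4), of "P \<cdot> I" "Idt E v1" v1] P(1) I(1) o by simp
  have "(Q \<cdot> J) \<cdot> c2 = Idt E v2 \<cdot> c2" using comp[OF J Q c(5) b(2,4) c(5)] b(6) c(5) by simp
  then have QJ: "Q \<cdot> J = Idt E v2"
    using epic_cancel[OF ep(2) _ c(5), of "Q \<cdot> J" "Idt E v2" v2] Q(1) J(1) o by simp
  have "(Q \<cdot> I) \<cdot> c1 = Zer E w1 v2" using comp[OF I Q c(4) b(1,4) c(5)] b(7) c(5) o by simp
  then have QI: "Q \<cdot> I = Zer E v1 v2"
    using epic_Zer[OF ep(1) _ c(4), of "Q \<cdot> I" v2] Q(1) I(1) by simp
  have "(P \<cdot> J) \<cdot> c2 = Zer E w2 v1" using comp[OF J P c(5) b(2,3) c(4)] b(8) c(4) o by simp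
  then have PJ: "P \<cdot> J = Zer E v2 v1"
    using epic_Zer[OF ep(2) _ c(5), of "P \<cdot> J" v1] P(1) J(1) by simp
  have IPH: "I \<cdot> P \<boxplus> J \<cdot> Q \<in> Hom E v v" using I(1) J(1) P(1) Q(1) by simp
  have "(I \<cdot> P \<boxplus> J \<cdot> Q) \<cdot> c = I \<cdot> (P \<cdot> c) \<boxplus> J \<cdot> (Q \<cdot> c)"
    using I(1) J(1) P(1) Q(1) c(6) by simp
  also have "\<dots> = (c \<cdot> i) \<cdot> p \<boxplus> (c \<cdot> j) \<cdot> q"
    unfolding P(2) Q(2) using Cmp_eq[OF I(2) b(3) c(4) I(1)] Cmp_eq[OF J(2) b(4) c(5) J(1)] by simp
  also have "\<dots> = Idt E v \<cdot> c" using biproduct_decomp'[OF B c(6)] c(6) by simp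
  finally have "I \<cdot> P \<boxplus> J \<cdot> Q = Idt E v"
    using epic_cancel[OF ep(3) _ c(6) IPH, of "Idt E v"] o by simp
  then have "is_biproduct E v1 v2 v I J P Q"
    unfolding is_biproduct_def using I(1) J(1) P(1) Q(1) PI QJ QI PJ by blast
  then show ?thesis unfolding is_direct_sum_def by blast
qed

lemma zero_object_in_subcategory:
  assumes "additive_subcategory E M" "is_zero_object E z"
  shows "z \<in> M"
proof -
  obtain w where w: "w \<in> M" "is_zero_object E w" using assms(1) unfolding additive_subcategory_def by blast
  have o: "z \<in> Obj E" "w \<in> Obj E" using assms(2) w(2) unfolding is_zero_object_def by blast+
  have h: "Zer E w z \<in> Hom E w z" "Zer E z w \<in> Hom E z w" using o by simp_all
  have "Zer E z w \<cdot> Zer E w z = Idt E w" "Zer E w z \<cdot> Zer E z w = Idt E z"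
    using o w(2) assms(2) unfolding zero_object_iff by simp_all
  then have "isomorphic_objects E w z" unfolding isomorphic_objects_def using h by blast
  then show ?thesis using assms(1) w(1) o(1) unfolding additive_subcategory_def by blast
qed

end

context right_exact_abelian
begin

section \<open>Closure properties of the two classes\<close>

lemma comma_biproductD:
  assumes "is_biproduct E (a1, a2, \<alpha>) (b1, b2, \<beta>) (s1, s2, \<sigma>) i j p q"
  shows "\<exists>i1 i2 j1 j2 p1 p2 q1 q2. is_biproduct C a1 b1 s1 i1 j1 p1 q1 \<and> is_biproduct D a2 b2 s2 i2 j2 p2 q2 \<and>
    i2 \<bullet> \<alpha> = \<sigma> \<bullet> FArr G i1 \<and> j2 \<bullet> \<beta> = \<sigma> \<bullet> FArr G j1 \<and>
    p2 \<bullet> \<sigma> = \<alpha> \<bullet> FArr G p1 \<and> q2 \<bullet> \<sigma> = \<beta> \<bullet> FArr G q1"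
proof -
  note B = E.biproductD[OF assms]
  obtain i1 i2 where i: "i = ((a1, a2, \<alpha>), (i1, i2), (s1, s2, \<sigma>))" "i1 \<in> Hom C a1 s1" "i2 \<in> Hom D a2 s2"
    "i2 \<bullet> \<alpha> = \<sigma> \<bullet> FArr G i1" using B(1) by (rule comma_HomE)
  obtain j1 j2 where j: "j = ((b1, b2, \<beta>), (j1, j2), (s1, s2, \<sigma>))" "j1 \<in> Hom C b1 s1" "j2 \<in> Hom D b2 s2"
    "j2 \<bullet> \<beta> = \<sigma> \<bullet> FArr G j1" using B(2) by (rule comma_HomE)
  obtain p1 p2 where p: "p = ((s1, s2, \<sigma>), (p1, p2), (a1, a2, \<alpha>))" "p1 \<in> Hom C s1 a1" "p2 \<in> Hom D s2 a2"
    "p2 \<bullet> \<sigma> = \<alpha> \<bullet> FArr G p1" using B(3) by (rule comma_HomE)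
  obtain q1 q2 where q: "q = ((s1, s2, \<sigma>), (q1, q2), (b1, b2, \<beta>))" "q1 \<in> Hom C s1 b1" "q2 \<in> Hom D s2 b2"
    "q2 \<bullet> \<sigma> = \<beta> \<bullet> FArr G q1" using B(4) by (rule comma_HomE)
  have "is_biproduct C a1 b1 s1 i1 j1 p1 q1" "is_biproduct D a2 b2 s2 i2 j2 p2 q2"
    using B(5-9) i(2,3) j(2,3) p(2,3) q(2,3) unfolding is_biproduct_def i(1) j(1) p(1) q(1) by simp_all
  then show ?thesis using i(4) j(4) p(4) q(4) by blast
qed

lemma comma_zero_object:
  assumes "is_zero_object C z" "is_zero_object D z'"
  shows "is_zero_object E (z, z', Zer D (FObj G z) z')"
  using assms unfolding C.zero_object_iff D.zero_object_iff E.zero_object_iff by simp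

lemma P_classI:
  assumes "(u, d, \<alpha>) \<in> Obj E" "u \<in> U" "monic D \<alpha>" "is_cokernel D \<alpha> q" "q \<in> Hom D d v" "v \<in> V"
  shows "(u, d, \<alpha>) \<in> P_class C D G U V"
  using assms unfolding P_class_def by auto

lemma P_classD:
  assumes "(u, d, \<alpha>) \<in> P_class C D G U V"
  shows "(u, d, \<alpha>) \<in> Obj E" "u \<in> U" "monic D \<alpha>" "\<exists>q v. is_cokernel D \<alpha> q \<and> q \<in> Hom D d v \<and> v \<in> V"
proof -
  show o: "(u, d, \<alpha>) \<in> Obj E" "u \<in> U" "monic D \<alpha>" using assms unfolding P_class_def by blast+
  obtain q where q: "is_cokernel D \<alpha> q" "Cod D q \<in> V" using assms unfolding P_class_def by blast
  have "\<alpha> \<in> Hom D (FObj G u) d" using o(1) by simp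
  then show "\<exists>q v. is_cokernel D \<alpha> q \<and> q \<in> Hom D d v \<and> v \<in> V" using D.is_cokernelD(1)[OF q(1)] q by blast
qed

lemma P_class_iso:
  assumes U: "additive_subcategory C U" and a: "a \<in> P_class C D G U V" and b: "b \<in> Obj E"
    and iso: "isomorphic_objects E a b"
  shows "b \<in> P_class C D G U V"
proof -
  obtain u w \<alpha> u' w' \<alpha>' where x: "a = (u, w, \<alpha>)" "b = (u', w', \<alpha>')" by (metis prod.exhaust_sel)
  note A = P_classD[OF a[unfolded x]]
  obtain q v where q: "is_cokernel D \<alpha> q" "q \<in> Hom D w v" "v \<in> V" using A(4) by blast
  obtain f g where fg: "f \<in> Hom E a b" "g \<in> Hom E b a" "g \<cdot>\<^bsub>E\<^esub> f = Idt E a" "f \<cdot>\<^bsub>E\<^esub> g = Idt E b"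
    using iso unfolding isomorphic_objects_def by blast
  obtain f1 f2 where f: "f = ((u, w, \<alpha>), (f1, f2), (u', w', \<alpha>'))" using fg(1) unfolding x by (rule comma_HomE)
  obtain g1 g2 where g: "g = ((u', w', \<alpha>'), (g1, g2), (u, w, \<alpha>))" using fg(2) unfolding x by (rule comma_HomE)
  note F = comma_HomD[OF fg(1)[unfolded f x]] and H = comma_HomD[OF fg(2)[unfolded g x]]
  have e: "g1 \<cdot>\<^bsub>C\<^esub> f1 = Idt C u" "f1 \<cdot>\<^bsub>C\<^esub> g1 = Idt C u'" "g2 \<bullet> f2 = Idt D w" "f2 \<bullet> g2 = Idt D w'"
    using fg(3,4) unfolding x f g by simp_all
  have "isomorphic_objects C u u'" unfolding isomorphic_objects_def using F(9) H(9) e by blast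
  then have u': "u' \<in> U" using additive_subcategoryD(2)[OF U A(2) F(6)] by blast
  have "FArr G f1 \<bullet> FArr G g1 = Idt D (FObj G u')" using FArr_Cmp[OF H(9) F(9)] e(2) F(6) by simp
  then have "monic D (FArr G g1)" using D.monic_split[OF _ FArr_Hom[OF H(9)] FArr_Hom[OF F(9)]] by blast
  then have "monic D (\<alpha> \<bullet> FArr G g1)" using D.monic_Cmp[OF _ A(3) FArr_Hom[OF H(9)] F(5)] by blast
  then have "monic D (g2 \<bullet> \<alpha>')" using H(11) by simp
  then have mono: "monic D \<alpha>'" using D.monic_right_factor[OF _ F(8) H(10)] by blast
  have q0: "q \<bullet> \<alpha> = Zer D (FObj G u) v" using D.is_cokernelD(2)[OF q(1) F(5)] q(2) by simp
  have vO: "v \<in> Obj D" using D.Hom_Obj[OF q(2)] by blast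
  have qg: "q \<bullet> g2 \<in> Hom D w' v" using q(2) H(10) by simp
  \<comment> \<open>The cokernel of \<open>\<alpha>\<close> is transported along the isomorphism
    with its target \<open>v\<close> unchanged, so membership in \<open>V\<close> carries over
    directly.\<close>
  have "is_cokernel D \<alpha>' (q \<bullet> g2)"
  proof (rule D.is_cokernelI[OF F(8) qg])
    have "q \<bullet> (\<alpha> \<bullet> FArr G g1) = Zer D (FObj G u) v \<bullet> FArr G g1"
      using D.Cmp_eq[OF q0 FArr_Hom[OF H(9)] F(5) q(2)] .
    then show "q \<bullet> g2 \<bullet> \<alpha>' = Zer D (FObj G u') v"
      unfolding H(11)[symmetric] using q(2) H(8-10) F(8) vO by simp
    show "epic D (q \<bullet> g2)"
      using D.epic_Cmp[OF D.epic_split[OF e(3) H(10) F(10)] D.is_cokernel_epic[OF q(1)] H(10) q(2)] .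
    fix t h assume h: "h \<in> Hom D w' t" "h \<bullet> \<alpha>' = Zer D (FObj G u') t"
    have hf: "h \<bullet> f2 \<in> Hom D w t" using h(1) F(10) by simp
    have "h \<bullet> f2 \<bullet> \<alpha> = h \<bullet> (\<alpha>' \<bullet> FArr G f1)" using h(1) F(5,10,11) by simp
    also have "\<dots> = Zer D (FObj G u') t \<bullet> FArr G f1" using D.Cmp_eq[OF h(2) FArr_Hom[OF F(9)] F(8) h(1)] .
    finally have "h \<bullet> f2 \<bullet> \<alpha> = Zer D (FObj G u) t" using F(9) D.Hom_Obj[OF h(1)] by simp
    then obtain l where l: "l \<in> Hom D v t" "l \<bullet> q = h \<bullet> f2"
      using D.is_cokernel_lift[OF q(1) F(5) q(2) hf] by blast
    have "l \<bullet> (q \<bullet> g2) = h \<bullet> (f2 \<bullet> g2)"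
      using D.Cmp_eq[OF l(2) H(10) q(2) l(1)] h(1) F(10) H(10) by simp
    then have "l \<bullet> (q \<bullet> g2) = h" unfolding e(4) using h(1) by simp
    then show "\<exists>u\<in>Hom D v t. u \<bullet> (q \<bullet> g2) = h" using l(1) by blast
  qed
  then show ?thesis unfolding x using P_classI[OF b[unfolded x] u' mono _ qg q(3)] by blast
qed

lemma P_class_sum:
  assumes U: "additive_subcategory C U" and V: "additive_subcategory D V"
    and a: "a \<in> P_class C D G U V" and b: "b \<in> P_class C D G U V"
    and s: "s \<in> Obj E" "is_direct_sum E a b s"
  shows "s \<in> P_class C D G U V"
proof -
  obtain u1 w1 \<alpha>1 u2 w2 \<alpha>2 s1 s2 \<sigma> where x: "a = (u1, w1, \<alpha>1)" "b = (u2, w2, \<alpha>2)" "s = (s1, s2, \<sigma>)"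
    by (metis prod.exhaust_sel)
  note A = P_classD[OF a[unfolded x]] and B = P_classD[OF b[unfolded x]]
  obtain c1 v1 where c1: "is_cokernel D \<alpha>1 c1" "c1 \<in> Hom D w1 v1" "v1 \<in> V" using A(4) by blast
  obtain c2 v2 where c2: "is_cokernel D \<alpha>2 c2" "c2 \<in> Hom D w2 v2" "v2 \<in> V" using B(4) by blast
  obtain i j p q where bp: "is_biproduct E (u1, w1, \<alpha>1) (u2, w2, \<alpha>2) (s1, s2, \<sigma>) i j p q"
    using s(2) unfolding is_direct_sum_def x by blast
  obtain i1 i2 j1 j2 p1 p2 q1 q2 where bi: "is_biproduct C u1 u2 s1 i1 j1 p1 q1" "is_biproduct D w1 w2 s2 i2 j2 p2 q2"
    "i2 \<bullet> \<alpha>1 = \<sigma> \<bullet> FArr G i1" "j2 \<bullet> \<alpha>2 = \<sigma> \<bullet> FArr G j1"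
    "p2 \<bullet> \<sigma> = \<alpha>1 \<bullet> FArr G p1" "q2 \<bullet> \<sigma> = \<alpha>2 \<bullet> FArr G q1"
    using comma_biproductD[OF bp] by blast
  note B1 = C.biproductD[OF bi(1)]
  have \<alpha>: "\<alpha>1 \<in> Hom D (FObj G u1) w1" "\<alpha>2 \<in> Hom D (FObj G u2) w2" "\<sigma> \<in> Hom D (FObj G s1) s2"
    and so: "s1 \<in> Obj C" "s2 \<in> Obj D" "w1 \<in> Obj D" "w2 \<in> Obj D" "u1 \<in> Obj C" "u2 \<in> Obj C"
    using A(1) B(1) s(1) unfolding x by simp_all
  obtain v c where c: "c \<in> Hom D s2 v" "is_cokernel D \<sigma> c" using D.ex_cokernel_Hom[OF \<alpha>(3)] by blast
  have "is_direct_sum D v1 v2 v"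
    using D.cokernel_direct_sum[OF bi(2) \<alpha> FArr_Hom[OF B1(1)] FArr_Hom[OF B1(2)] FArr_Hom[OF B1(3)] FArr_Hom[OF B1(4)]
        bi(3-6) c1(1) c2(1) c(2) c1(2) c2(2) c(1)] .
  then have v: "v \<in> V" using additive_subcategoryD(3)[OF V c1(3) c2(3)] D.Hom_Obj[OF c(1)] by blast
  have "is_direct_sum C u1 u2 s1" using bi(1) unfolding is_direct_sum_def by blast
  then have "s1 \<in> U" using additive_subcategoryD(3)[OF U A(2) B(2) so(1)] by blast
  \<comment> \<open>An element killed by \<open>\<sigma>\<close> has both coordinates killed by the
    monic arrows \<open>\<alpha>1\<close> and \<open>\<alpha>2\<close>; additivity of
    \<open>G\<close> recovers the element from its coordinates.\<close>
  moreover have "monic D \<sigma>"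
  proof (rule D.monicI[OF \<alpha>(3)])
    fix t y assume y: "y \<in> Hom D t (FObj G s1)" "\<sigma> \<bullet> y = Zer D t s2"
    have to: "t \<in> Obj D" using D.Hom_Obj[OF y(1)] by blast
    note B2 = D.biproductD[OF bi(2)]
    have py: "FArr G p1 \<bullet> y \<in> Hom D t (FObj G u1)" "FArr G q1 \<bullet> y \<in> Hom D t (FObj G u2)"
      using y(1) B1(3,4) by simp_all
    have "\<alpha>1 \<bullet> (FArr G p1 \<bullet> y) = p2 \<bullet> (\<sigma> \<bullet> y)"
      using D.Cmp_eq[OF bi(5) y(1) \<alpha>(3) B2(3)] \<alpha>(1) B1(3) y(1) by simp
    then have "\<alpha>1 \<bullet> (FArr G p1 \<bullet> y) = Zer D t w1" using y(2) B2(3) to by simp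
    then have e1: "FArr G p1 \<bullet> y = Zer D t (FObj G u1)" using D.monic_Zer[OF A(3) _ \<alpha>(1) py(1)] by blast
    have "\<alpha>2 \<bullet> (FArr G q1 \<bullet> y) = q2 \<bullet> (\<sigma> \<bullet> y)"
      using D.Cmp_eq[OF bi(6) y(1) \<alpha>(3) B2(4)] \<alpha>(2) B1(4) y(1) by simp
    then have "\<alpha>2 \<bullet> (FArr G q1 \<bullet> y) = Zer D t w2" using y(2) B2(4) to by simp
    then have e2: "FArr G q1 \<bullet> y = Zer D t (FObj G u2)" using D.monic_Zer[OF B(3) _ \<alpha>(2) py(2)] by blast
    have "FArr G (i1 \<cdot>\<^bsub>C\<^esub> p1 \<boxplus>\<^bsub>C\<^esub> j1 \<cdot>\<^bsub>C\<^esub> q1) \<bullet> y =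
        FArr G i1 \<bullet> (FArr G p1 \<bullet> y) \<uplus> FArr G j1 \<bullet> (FArr G q1 \<bullet> y)"
      using B1(1-4) y(1) by simp
    then show "y = Zer D t (FObj G s1)" unfolding e1 e2 B1(9) using B1(1,2) to so y(1) by simp
  qed
  ultimately show ?thesis using P_classI[OF _ _ _ c(2,1) v] s(1) unfolding x by blast
qed

lemma left_obj_P:
  assumes "additive_subcategory C U" "additive_subcategory D V" "u \<in> U"
  shows "left_obj u \<in> P_class C D G U V"
proof -
  have u: "u \<in> Obj C" using additive_subcategoryD(1)[OF assms(1)] assms(3) by blast
  have ses: "short_exact D (FObj G u) (Idt D (FObj G u)) (FObj G u) (Zer D (FObj G u) zeroD) zeroD"
    using D.short_exact_Idt_zero[OF zeroD(1) FObj_Obj[OF u]] .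
  show ?thesis unfolding left_obj_def
    using P_classI[OF comma_Obj_intros(1)[OF u] assms(3) D.short_exactD(3,6,2)[OF ses]
        D.zero_object_in_subcategory[OF assms(2) zeroD(1)]] .
qed

lemma right_obj_P:
  assumes "additive_subcategory C U" "additive_subcategory D V" "v \<in> V"
  shows "right_obj v \<in> P_class C D G U V"
proof -
  have v: "v \<in> Obj D" using additive_subcategoryD(1)[OF assms(2)] assms(3) by blast
  have z: "is_zero_object D (FObj G zeroC)" "Zer D (FObj G zeroC) v \<in> Hom D (FObj G zeroC) v"
    using FObj_zero[OF zeroC(1)] v zeroC(2) by simp_all
  show ?thesis unfolding right_obj_def
    using P_classI[OF comma_Obj_intros(2)[OF v] C.zero_object_in_subcategory[OF assms(1) zeroC(1)]
        D.monic_from_zero[OF z] D.is_cokernel_from_zero[OF z] D.Idt_Hom[OF v] assms(3)] .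
qed

lemma P_class_additive:
  assumes U: "additive_subcategory C U" and V: "additive_subcategory D V"
  shows "additive_subcategory E (P_class C D G U V)"
  unfolding additive_subcategory_def
proof (intro conjI ballI impI)
  show "P_class C D G U V \<subseteq> Obj E" unfolding P_class_def by auto
  have "right_obj zeroD \<in> P_class C D G U V"
    using right_obj_P[OF U V D.zero_object_in_subcategory[OF V zeroD(1)]] .
  then show "\<exists>z\<in>P_class C D G U V. is_zero_object E z"
    using comma_zero_object[OF zeroC(1) zeroD(1)] unfolding right_obj_def by blast
qed (use P_class_iso[OF U] P_class_sum[OF U V] in blast)+

lemma A_class_summands:
  assumes "closed_under_summands C X" "closed_under_summands D Y"
  shows "closed_under_summands E (A_class C D G X Y)"
  unfolding closed_under_summands_def
proof (intro ballI impI)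
  fix a b s assume a: "a \<in> Obj E" and b: "b \<in> Obj E" and s: "s \<in> A_class C D G X Y" "is_direct_sum E a b s"
  obtain a1 a2 \<alpha> b1 b2 \<beta> s1 s2 \<sigma> where x: "a = (a1, a2, \<alpha>)" "b = (b1, b2, \<beta>)" "s = (s1, s2, \<sigma>)"
    by (metis prod.exhaust_sel)
  obtain i j p q where bp: "is_biproduct E (a1, a2, \<alpha>) (b1, b2, \<beta>) (s1, s2, \<sigma>) i j p q"
    using s(2) unfolding is_direct_sum_def x by blast
  have "is_direct_sum C a1 b1 s1" "is_direct_sum D a2 b2 s2"
    using comma_biproductD[OF bp] unfolding is_direct_sum_def by blast+
  moreover have "s1 \<in> X" "s2 \<in> Y" using s(1) unfolding A_class_def x by auto
  moreover have "a1 \<in> Obj C" "a2 \<in> Obj D" "b1 \<in> Obj C" "b2 \<in> Obj D" using a b unfolding x by simp_all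
  ultimately have "a1 \<in> X" "a2 \<in> Y" using assms unfolding closed_under_summands_def by blast+
  then show "a \<in> A_class C D G X Y" using a unfolding A_class_def x by simp
qed

section \<open>Transporting coresolutions and constructing approximations\<close>

lemma right_obj_short_exact:
  assumes "short_exact D a f b g c"
  shows "\<exists>f' g'. short_exact E (right_obj a) f' (right_obj b) g' (right_obj c)"
proof -
  note S = D.short_exactD[OF assms]
  have z: "Idt C zeroC = Zer C zeroC zeroC" using zeroC(1) unfolding C.zero_object_iff by blast
  have ses: "short_exact C zeroC (Idt C zeroC) zeroC (Zer C zeroC zeroC) zeroC"
    using C.short_exact_Idt_zero[OF zeroC] .
  have f: "(right_obj a, (Idt C zeroC, f), right_obj b) \<in> Hom E (right_obj a) (right_obj b)"
    unfolding right_obj_def using S(1,9,10) zeroC(2) by simp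
  have g: "(right_obj b, (Zer C zeroC zeroC, g), right_obj c) \<in> Hom E (right_obj b) (right_obj c)"
    unfolding right_obj_def using S(2,10,11) zeroC(2) by simp
  show ?thesis
    using comma_short_exactI[OF f[unfolded right_obj_def] g[unfolded right_obj_def] ses assms]
    unfolding right_obj_def by blast
qed

text \<open>The second components form the image sequence under \<open>G\<close>, whose first arrow
  is monic because \<open>L\<^sub>1 G\<close> vanishes on \<open>c\<close>.\<close>

lemma left_obj_short_exact:
  assumes "short_exact C a f b g c" "tor1_zero c"
  shows "\<exists>f' g'. short_exact E (left_obj a) f' (left_obj b) g' (left_obj c)"
proof -
  note S = C.short_exactD[OF assms(1)] and GS = FArr_short_exact[OF assms(1)]
  have ses: "short_exact D (FObj G a) (FArr G f) (FObj G b) (FArr G g) (FObj G c)"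
    using D.short_exact_of_exact_monic[OF GS(3) tor1_zeroD[OF assms(2,1)] GS(4,1,2)] .
  have f: "(left_obj a, (f, FArr G f), left_obj b) \<in> Hom E (left_obj a) (left_obj b)"
    unfolding left_obj_def using S(1,9,10) by simp
  have g: "(left_obj b, (g, FArr G g), left_obj c) \<in> Hom E (left_obj b) (left_obj c)"
    unfolding left_obj_def using S(2,10,11) by simp
  show ?thesis
    using comma_short_exactI[OF f[unfolded left_obj_def] g[unfolded left_obj_def] assms(1) ses]
    unfolding left_obj_def by blast
qed

lemma right_obj_coresolved:
  assumes U: "additive_subcategory C U" and V: "additive_subcategory D V"
    and "N \<in> finite_coresolved D m V"
  shows "right_obj N \<in> finite_coresolved E m (P_class C D G U V)"
  using assms(3)
proof (induction m arbitrary: N)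
  case 0
  then have "N \<in> V" using D.finite_coresolved_0[OF V] by blast
  then show ?case
    using E.finite_coresolved_0[OF P_class_additive[OF U V]] right_obj_P[OF U V] by blast
next
  case (Suc m)
  then obtain f K g N' where K: "short_exact D N f K g N'" "K \<in> V" "N' \<in> finite_coresolved D m V"
    using D.finite_coresolved_Suc by blast
  then show ?case
    unfolding E.finite_coresolved_Suc using right_obj_short_exact[OF K(1)] right_obj_P[OF U V K(2)] Suc.IH[OF K(3)] by blast
qed

text \<open>Every cokernel \<open>N'\<close> met along the coresolution has a shorter coresolution
  of its own, so \<open>tor_zero_finite_coresolved\<close> makes \<open>L\<^sub>1 G\<close> vanish
  there and \<open>left_obj\<close> preserves each short exact piece.\<close>

lemma left_obj_coresolved:
  assumes U: "additive_subcategory C U" and V: "additive_subcategory D V" and "enough_projectives C"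
    and tor: "\<And>i u. \<lbrakk>i \<le> n; u \<in> U\<rbrakk> \<Longrightarrow> tor_zero i u"
    and "N \<in> finite_coresolved C m U" "m \<le> n"
  shows "left_obj N \<in> finite_coresolved E m (P_class C D G U V)"
  using assms(5,6)
proof (induction m arbitrary: N)
  case 0
  then have "N \<in> U" using C.finite_coresolved_0[OF U] by blast
  then show ?case
    using E.finite_coresolved_0[OF P_class_additive[OF U V]] left_obj_P[OF U V] by blast
next
  case (Suc m)
  then obtain f K g N' where K: "short_exact C N f K g N'" "K \<in> U" "N' \<in> finite_coresolved C m U"
    using C.finite_coresolved_Suc by blast
  have "tor_zero 0 N'"
    using tor_zero_finite_coresolved[where j = 0 and n = n, OF assms(3) K(3) _ U tor] Suc.prems(2) by simp
  then have "tor1_zero N'" by simp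
  then show ?case
    unfolding E.finite_coresolved_Suc
    using left_obj_short_exact[OF K(1)] left_obj_P[OF U V K(2)] Suc.IH[OF K(3)] Suc.prems(2)
    by (meson Suc_leD)
qed

text \<open>A pushout keeps the monic \<open>FArr G f\<close> monic on the side of \<open>d\<close>
  and keeps its cokernel \<open>FObj G k\<close>. The induced structure arrow of the quotient is
  then the identity, which is why \<open>left_obj k\<close> appears.\<close>

lemma pushout_along_structure_arrow:
  assumes "short_exact C c f x g k" "monic D (FArr G f)" "(c, d, \<alpha>) \<in> Obj E"
  shows "\<exists>d' \<alpha>' f' g'. (x, d', \<alpha>') \<in> Obj E \<and> short_exact E (c, d, \<alpha>) f' (x, d', \<alpha>') g' (left_obj k)"
proof -
  note S = C.short_exactD[OF assms(1)] and GS = FArr_short_exact[OF assms(1)]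
  have a: "d \<in> Obj D" "\<alpha> \<in> Hom D (FObj G c) d" using assms(3) by simp_all
  obtain s i1 i2 p1 p2 where s: "is_biproduct D (FObj G x) d s i1 i2 p1 p2"
    using D.ex_biproduct[OF FObj_Obj[OF S(10)] a(1)] .
  note B = D.biproductD[OF s] and Bo = D.biproduct_Obj[OF s] and Bs = D.biproduct_simps[OF s]
  \<comment> \<open>The pushout \<open>d'\<close> is the cokernel of \<open>u\<close>, and
    \<open>h\<close> below is induced by \<open>FArr G g\<close> on the first summand and zero on
    the second.\<close>
  define u where "u = i1 \<bullet> FArr G f \<uplus> D.Neg (i2 \<bullet> \<alpha>)"
  have u: "u \<in> Hom D (FObj G c) s" unfolding u_def using B(1,2) GS(1) a(2) by simp
  obtain d' w where w: "w \<in> Hom D s d'" "is_cokernel D u w" "w \<bullet> u = Zer D (FObj G c) d'" "epic D w"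
    using D.ex_cokernel_Hom[OF u] by blast
  have cO: "FObj G c \<in> Obj D" "d' \<in> Obj D" using S(9) D.Hom_Obj[OF w(1)] by simp_all
  define \<alpha>' where "\<alpha>' = w \<bullet> i1"
  define b where "b = w \<bullet> i2"
  have t: "\<alpha>' \<in> Hom D (FObj G x) d'" "b \<in> Hom D d d'" unfolding \<alpha>'_def b_def using w(1) B(1,2) by simp_all
  have wu: "w \<bullet> u = \<alpha>' \<bullet> FArr G f \<uplus> D.Neg (b \<bullet> \<alpha>)"
    unfolding u_def \<alpha>'_def b_def using w(1) B(1,2) GS(1) a(2) by simp
  have sq: "\<alpha>' \<bullet> FArr G f = b \<bullet> \<alpha>"
    by (rule D.eq_of_diff_Zer) (use wu w(3) t GS(1) a(2) in simp_all)
  have gp: "FArr G g \<bullet> p1 \<in> Hom D s (FObj G k)" using GS(2) B(3) by simp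
  have p1u: "p1 \<bullet> u = FArr G f" unfolding u_def using Bs B(1-4) GS(1) a cO FObj_Obj[OF S(10)] by simp
  have "FArr G g \<bullet> p1 \<bullet> u = Zer D (FObj G c) (FObj G k)"
    using D.Cmp_assoc[OF u B(3) GS(2)] p1u GS(5) by simp
  then obtain h where h: "h \<in> Hom D d' (FObj G k)" "h \<bullet> w = FArr G g \<bullet> p1"
    using D.is_cokernel_lift[OF w(2) u w(1) gp] by blast
  have ha: "h \<bullet> \<alpha>' = FArr G g"
    unfolding \<alpha>'_def using D.Cmp_eq[OF h(2) B(1) w(1) h(1)] GS(2) B by simp
  have hb: "h \<bullet> b = Zer D d (FObj G k)"
    unfolding b_def using D.Cmp_eq[OF h(2) B(2) w(1) h(1)] GS(2) B a(1) by simp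
  have "short_exact D d b d' h (FObj G k)"
  proof (rule D.short_exactI[OF t(2) h(1) _ _ hb])
    show "epic D h" using D.epic_left_factor[OF _ t(1) h(1)] ha GS(4) by simp
    show "monic D b"
    proof (rule D.monicI[OF t(2)])
      fix t y assume y: "y \<in> Hom D t d" "b \<bullet> y = Zer D t d'"
      have iy: "i2 \<bullet> y \<in> Hom D t s" "w \<bullet> (i2 \<bullet> y) = Zer D t d'"
        using y B(2) w(1) unfolding b_def by simp_all
      obtain s' r z where r: "epic D r" "r \<in> Hom D s' t" "z \<in> Hom D s' (FObj G c)" "u \<bullet> z = i2 \<bullet> y \<bullet> r"
        using D.exactD[OF D.exact_of_cokernel[OF w(2) u w(1)] u w(1) iy] by blast
      have yr: "y \<bullet> r \<in> Hom D s' d" using y(1) r(2) by simp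
      have uz: "u \<bullet> z = i2 \<bullet> (y \<bullet> r)" unfolding r(4) using y(1) r(2) B(2) by simp
      have "FArr G f \<bullet> z = p1 \<bullet> (u \<bullet> z)" using D.Cmp_eq[OF p1u r(3) u B(3)] by simp
      also have "\<dots> = Zer D s' (FObj G x)" unfolding uz using Bs(4)[OF yr] .
      finally have "z = Zer D s' (FObj G c)" using D.monic_Zer[OF assms(2) _ GS(1) r(3)] by blast
      then have "i2 \<bullet> (y \<bullet> r) = Zer D s' s" unfolding uz[symmetric] using u D.Hom_Obj[OF yr] by simp
      then have "y \<bullet> r = Zer D s' d" using Bs(2)[OF yr] B(4) D.Hom_Obj[OF yr] by simp
      then show "y = Zer D t d" using D.epic_Zer[OF r(1) _ r(2) y(1)] by blast
    qed
    fix t y assume y: "y \<in> Hom D t d'" "h \<bullet> y = Zer D t (FObj G k)"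
    obtain s1 r1 z where 1: "epic D r1" "r1 \<in> Hom D s1 t" "z \<in> Hom D s1 s" "w \<bullet> z = y \<bullet> r1"
      using D.cover[OF w(4,1) y(1)] by blast
    have pz: "p1 \<bullet> z \<in> Hom D s1 (FObj G x)" "p2 \<bullet> z \<in> Hom D s1 d" using 1(3) B(3,4) by simp_all
    have "FArr G g \<bullet> (p1 \<bullet> z) = h \<bullet> (w \<bullet> z)"
      using D.Cmp_eq[OF h(2) 1(3) w(1) h(1)] GS(2) B(3) 1(3) by simp
    also have "\<dots> = Zer D t (FObj G k) \<bullet> r1" unfolding 1(4) using D.Cmp_eq[OF y(2) 1(2) y(1) h(1)] .
    finally have "FArr G g \<bullet> (p1 \<bullet> z) = Zer D s1 (FObj G k)" using 1(2) S(11) by simp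
    then obtain s2 r2 l where 2: "epic D r2" "r2 \<in> Hom D s2 s1" "l \<in> Hom D s2 (FObj G c)"
      "FArr G f \<bullet> l = p1 \<bullet> z \<bullet> r2"
      using D.exactD[OF GS(3,1,2) pz(1)] by blast
    have zr: "z \<bullet> r2 \<in> Hom D s2 s" using 1(3) 2(2) by simp
    have p2z: "p2 \<bullet> (z \<bullet> r2) \<in> Hom D s2 d" using zr B(4) by simp
    have p1z: "p1 \<bullet> (z \<bullet> r2) = FArr G f \<bullet> l" unfolding 2(4) using 1(3) 2(2) B(3) by simp
    have al: "\<alpha> \<bullet> l \<in> Hom D s2 d" using a(2) 2(3) by simp
    have rr: "r1 \<bullet> r2 \<in> Hom D s2 t" "epic D (r1 \<bullet> r2)" using 1(2) 2(2) D.epic_Cmp[OF 2(1) 1(1) 2(2) 1(2)] by simp_all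
    \<comment> \<open>A representative \<open>z\<close> of \<open>y\<close> has its first coordinate
      in the image of \<open>FArr G f\<close>. The pushout relation moves that coordinate across to
      \<open>d\<close> through \<open>\<alpha>\<close>.\<close>
    have "y \<bullet> (r1 \<bullet> r2) = w \<bullet> (z \<bullet> r2)"
      using D.Cmp_eq[OF 1(4) 2(2) 1(3) w(1)] y(1) 1(2) 2(2) by simp
    also have "\<dots> = w \<bullet> (i1 \<bullet> (FArr G f \<bullet> l) \<uplus> i2 \<bullet> (p2 \<bullet> (z \<bullet> r2)))"
      unfolding p1z[symmetric] D.biproduct_decomp[OF s zr] ..
    also have "\<dots> = \<alpha>' \<bullet> (FArr G f \<bullet> l) \<uplus> b \<bullet> (p2 \<bullet> (z \<bullet> r2))"
      unfolding \<alpha>'_def b_def using w(1) B(1,2,4) GS(1) 2(2,3) 1(3) by simp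
    also have "\<alpha>' \<bullet> (FArr G f \<bullet> l) = b \<bullet> (\<alpha> \<bullet> l)"
      using D.Cmp_eq[OF sq 2(3) GS(1) t(1)] t(2) a(2) 2(3) by simp
    also have "b \<bullet> (\<alpha> \<bullet> l) \<uplus> b \<bullet> (p2 \<bullet> (z \<bullet> r2)) = b \<bullet> (\<alpha> \<bullet> l \<uplus> p2 \<bullet> (z \<bullet> r2))"
      using t(2) al p2z by (simp del: D.Cmp_assoc_right)
    finally show "\<exists>s r x. epic D r \<and> r \<in> Hom D s t \<and> x \<in> Hom D s d \<and> b \<bullet> x = y \<bullet> r"
      using rr al p2z by (intro exI[of _ s2] exI[of _ "r1 \<bullet> r2"]
        exI[of _ "\<alpha> \<bullet> l \<uplus> p2 \<bullet> (z \<bullet> r2)"]) (simp del: D.Cmp_assoc_right D.Cmp_Pls)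
  qed
  moreover have o: "(x, d', \<alpha>') \<in> Obj E" using S(10) cO t(1) by simp
  moreover have "((c, d, \<alpha>), (f, b), (x, d', \<alpha>')) \<in> Hom E (c, d, \<alpha>) (x, d', \<alpha>')"
    using comma_HomI[OF assms(3) o S(1) t(2) sq[symmetric]] .
  moreover have "((x, d', \<alpha>'), (g, h), left_obj k) \<in> Hom E (x, d', \<alpha>') (left_obj k)"
    unfolding left_obj_def
    using comma_HomI[OF o comma_Obj_intros(1)[OF S(11)] S(2) h(1)] ha S(2) GS(2) by simp
  ultimately show ?thesis
    using comma_short_exactI[OF _ _ assms(1)] unfolding left_obj_def by blast
qed

text \<open>Only the second component grows, so the quotient has zero first component.\<close>

lemma short_exact_enlarge:
  assumes "(x, d, \<alpha>) \<in> Obj E" "short_exact D d f y g l"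
  shows "\<exists>\<alpha>' f' g'. (x, y, \<alpha>') \<in> Obj E \<and> short_exact E (x, d, \<alpha>) f' (x, y, \<alpha>') g' (right_obj l)"
proof -
  note S = D.short_exactD[OF assms(2)]
  have a: "x \<in> Obj C" "\<alpha> \<in> Hom D (FObj G x) d" using assms(1) by simp_all
  have o: "(x, y, f \<bullet> \<alpha>) \<in> Obj E" using a S(1,10) by simp
  have gf: "g \<bullet> (f \<bullet> \<alpha>) = Zer D (FObj G x) l"
    using D.Cmp_eq[OF S(7) a(2) S(1,2)] a(2) S(11) by simp
  have 1: "((x, d, \<alpha>), (Idt C x, f), (x, y, f \<bullet> \<alpha>)) \<in> Hom E (x, d, \<alpha>) (x, y, f \<bullet> \<alpha>)"
    using assms(1) o S(1) by simp
  have 2: "((x, y, f \<bullet> \<alpha>), (Zer C x zeroC, g), right_obj l) \<in> Hom E (x, y, f \<bullet> \<alpha>) (right_obj l)"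
    using to_right_obj[OF o S(2) gf] .
  show ?thesis
    using comma_short_exactI[OF 1 2[unfolded right_obj_def] C.short_exact_Idt_zero[OF zeroC(1) a(1)] assms(2)] o
    unfolding right_obj_def by blast
qed

lemma right_approximation:
  assumes U: "additive_subcategory C U" and V: "additive_subcategory D V" and "enough_projectives C"
    and tor: "\<And>i u. \<lbrakk>i \<le> n; u \<in> U\<rbrakk> \<Longrightarrow> tor_zero i u" and "m \<le> n"
    and appC: "\<And>a. a \<in> Obj C \<Longrightarrow> \<exists>r\<in>X. \<exists>p\<in>finite_coresolved C m U. \<exists>f g. short_exact C a f r g p"
    and appD: "\<And>a. a \<in> Obj D \<Longrightarrow> \<exists>r\<in>Y. \<exists>p\<in>finite_coresolved D m V. \<exists>f g. short_exact D a f r g p"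
    and ext: "closed_under_extensions E (finite_coresolved E m (P_class C D G U V))"
    and a: "a \<in> Obj E"
  shows "\<exists>r\<in>A_class C D G X Y. \<exists>p\<in>finite_coresolved E m (P_class C D G U V). \<exists>f g. short_exact E a f r g p"
proof -
  obtain c d \<alpha> where x: "a = (c, d, \<alpha>)" by (rule comma_Obj_cases)
  have c: "c \<in> Obj C" using a unfolding x by simp
  obtain X0 K f g where K: "X0 \<in> X" "K \<in> finite_coresolved C m U" "short_exact C c f X0 g K" using appC[OF c] by blast
  have "tor_zero 0 K"
    using tor_zero_finite_coresolved[where j = 0 and n = n, OF assms(3) K(2) _ U tor] assms(5) by simp
  then have "monic D (FArr G f)" using tor1_zeroD[OF _ K(3)] by simp
  then obtain d' \<alpha>' f1 g1 where 1: "(X0, d', \<alpha>') \<in> Obj E" "short_exact E a f1 (X0, d', \<alpha>') g1 (left_obj K)"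
    using pushout_along_structure_arrow[OF K(3) _ a[unfolded x]] unfolding x by blast
  have "d' \<in> Obj D" using 1(1) by simp
  then obtain Y0 L h l where L: "Y0 \<in> Y" "L \<in> finite_coresolved D m V" "short_exact D d' h Y0 l L" using appD by blast
  obtain \<alpha>'' f2 g2 where 2: "(X0, Y0, \<alpha>'') \<in> Obj E" "short_exact E (X0, d', \<alpha>') f2 (X0, Y0, \<alpha>'') g2 (right_obj L)"
    using short_exact_enlarge[OF 1(1) L(3)] by blast
  \<comment> \<open>The cokernel \<open>F\<close> of the composite embedding is an extension of the
    cokernel of the second step by that of the first, and the assumed closure under extensions
    places it in the coresolved class.\<close>
  obtain F \<pi> u v where F: "short_exact E a (f2 \<cdot>\<^bsub>E\<^esub> f1) (X0, Y0, \<alpha>'') \<pi> F" "short_exact E (left_obj K) u F v (right_obj L)"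
    using E.short_exact_quotient[OF 1(2) 2(2)] by blast
  have "left_obj K \<in> finite_coresolved E m (P_class C D G U V)"
    using left_obj_coresolved[OF U V assms(3) tor K(2) assms(5)] .
  moreover have "right_obj L \<in> finite_coresolved E m (P_class C D G U V)"
    using right_obj_coresolved[OF U V L(2)] .
  ultimately have "F \<in> finite_coresolved E m (P_class C D G U V)"
    using ext F(2) unfolding closed_under_extensions_def by blast
  moreover have "(X0, Y0, \<alpha>'') \<in> A_class C D G X Y" using 2(1) K(1) L(1) unfolding A_class_def by simp
  ultimately show ?thesis using F(1) by blast
qed

end

theorem corollary5p3:
  fixes C :: "('o1, 'm1) cat" and D :: "('o2, 'm2) cat"
    and G :: "('o1, 'm1, 'o2, 'm2) functor_data"
    and U X :: "'o1 set" and V Y :: "'o2 set" and n :: nat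
  assumes "abelian_category C" and "enough_projectives C" and "enough_injectives C"
    and "abelian_category D" and "enough_projectives D" and "enough_injectives D"
    and "right_exact_functor C D G"
    and "n \<ge> 1"
    and "right_cotorsion_pair C n U X"
    and "right_cotorsion_pair D n V Y"
    and "\<And>i u. \<lbrakk>1 \<le> i; i \<le> n + 1; u \<in> U\<rbrakk> \<Longrightarrow> is_zero_object D (left_derived_obj C D G i u)"
    and "coresolving (comma C D G) (A_class C D G X Y)"
    and "closed_under_extensions (comma C D G)
           (finite_coresolved (comma C D G) (n - 1) (P_class C D G U V))"
  shows "right_cotorsion_pair (comma C D G) n (P_class C D G U V) (A_class C D G X Y)"
proof -
  interpret right_exact_abelian C D G using assms(1,4,7) by (rule right_exact_abelian.intro[rotated 1])
  have U: "additive_subcategory C U" and X: "closed_under_summands C X" "X \<subseteq> Obj C"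
    and extC: "\<And>p r i. \<lbrakk>p \<in> U; r \<in> X; 1 \<le> i; i \<le> n\<rbrakk> \<Longrightarrow> trivial_group (Ext C i p r)"
    and appC: "\<And>a. a \<in> Obj C \<Longrightarrow> \<exists>r\<in>X. \<exists>p\<in>finite_coresolved C (n - 1) U. \<exists>f g. short_exact C a f r g p"
    using assms(9) additive_subcategoryD(1) unfolding right_cotorsion_pair_def by blast+
  have V: "additive_subcategory D V" and Y: "closed_under_summands D Y" "Y \<subseteq> Obj D"
    and extD: "\<And>p r i. \<lbrakk>p \<in> V; r \<in> Y; 1 \<le> i; i \<le> n\<rbrakk> \<Longrightarrow> trivial_group (Ext D i p r)"
    and appD: "\<And>a. a \<in> Obj D \<Longrightarrow> \<exists>r\<in>Y. \<exists>p\<in>finite_coresolved D (n - 1) V. \<exists>f g. short_exact D a f r g p"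
    using assms(10) additive_subcategoryD(1) unfolding right_cotorsion_pair_def by blast+
  have UO: "U \<subseteq> Obj C" and VO: "V \<subseteq> Obj D" using additive_subcategoryD(1) U V by blast+
  \<comment> \<open>Because of the index shift, \<open>i \<le> n\<close> covers the degrees from
    \<open>1\<close> to \<open>n + 1\<close> of the hypothesis.\<close>
  have tor: "tor_zero i u" if "i \<le> n" "u \<in> U" for i u
    using tor_zero_left_derived[OF assms(2) _ assms(11)[of "Suc i" u]] that UO by auto
  show ?thesis
    unfolding right_cotorsion_pair_def
  proof (intro conjI ballI allI impI)
    show "additive_subcategory E (P_class C D G U V)" using P_class_additive[OF U V] .
    show "additive_subcategory E (A_class C D G X Y)" using assms(12) unfolding coresolving_def by blast
    show "closed_under_summands E (A_class C D G X Y)" using A_class_summands[OF X(1) Y(1)] .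
    show "\<exists>r\<in>A_class C D G X Y. \<exists>p\<in>finite_coresolved E (n - 1) (P_class C D G U V). \<exists>f g. short_exact E a f r g p"
      if "a \<in> Obj E" for a
      using right_approximation[OF U V assms(2) tor _ appC appD assms(13) that] by simp
    fix p r i assume p: "p \<in> P_class C D G U V" and r: "r \<in> A_class C D G X Y" and i: "1 \<le> i \<and> i \<le> n"
    \<comment> \<open>\<open>Ext\<close> in degree \<open>i\<close> is the first degree on a syzygy
      number \<open>j = i - 1\<close>.\<close>
    obtain j where j: "i = Suc j" "j \<le> n - 1" using i by (cases i) auto
    obtain u w \<alpha> x y \<beta> where e: "p = (u, w, \<alpha>)" "r = (x, y, \<beta>)" by (metis prod.exhaust_sel)
    note P = P_classD[OF p[unfolded e]]
    have r': "(x, y, \<beta>) \<in> Obj E" "x \<in> X" "y \<in> Y" using r unfolding A_class_def e by auto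
    obtain q v where q: "is_cokernel D \<alpha> q" "q \<in> Hom D w v" "v \<in> V" using P(4) by blast
    have 1: "tor_zero i u \<and> syz C (C.ext1_zero x) i u" if "i \<le> n - 1" for i
      using tor[OF _ P(2)] C.syz_ext1_zero_iff[OF assms(2), of u x i] extC[OF P(2) r'(2), of "Suc i"]
        that assms(8) UO X(2) P(2) r'(2) by auto
    have 2: "syz D (D.ext1_zero y) i v" if "i \<le> n - 1" for i
      using D.syz_ext1_zero_iff[OF assms(5), of v y i] extD[OF q(3) r'(3), of "Suc i"]
        that assms(8) VO Y(2) q(3) r'(3) by auto
    \<comment> \<open>Level \<open>n - 1\<close> stands for the degrees \<open>1, ..., n\<close>,
      the range in which both given pairs are orthogonal.\<close>
    have "acyclic_upto x y (n - 1) p"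
      unfolding acyclic_upto_def e using P(1,3) 1 2 q(1,2) by blast
    then have "syz E (E.ext1_zero r) j p"
      using acyclic_upto_ext[OF assms(2,5) r'(1) _ j(2)] unfolding e by blast
    then show "trivial_group (Ext E i p r)"
      using E.syz_ext1_zero_iff[OF comma_enough_projectives[OF assms(2,5)]] P(1) r'(1) unfolding j(1) e by blast
  qed
qed

end
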